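(* Let $W$ be an admissible potential and let $U=(u_1,u_2)\in X$ be a minimizer of $E$. Then the spectral problem $$L_+\Phi_R=-\lambda\Phi_I,\qquad L_-\Phi_I=\lambda\Phi_R$$ has no eigenvalues $\lambda\in\mathbb{C}$ with $\operatorname{Re}(\lambda)\ne 0$.
   Context: $\mathbb{R}^2_+=\{(x,y)\in\mathbb{R}^2: x,y\ge 0\}$. A function $W:\mathbb{C}^2\to\mathbb{R}$ is called an admissible potential if: (1) $W(\Psi)=W(|\psi_1|,|\psi_2|)=F(|\psi_1|^2,|\psi_2|^2)$ for all $\Psi=(\psi_1,\psi_2)\in\mathbb{C}^2$, with some $F\in C^3(\mathbb{R}^2;\mathbb{R})$; (2) $W\ge 0$ on $\mathbb{C}^2$, and there are $a,b>0$ such that $W(\Psi)=0$ if and only if $(|\psi_1|,|\psi_2|)=\mathbf a:=(a,0)$ or $(|\psi_1|,|\psi_2|)=\mathbf b:=(0,b)$; (3) $\mathbf a,\mathbf b$ are non-degenerate global minima of $W$ restricted to $\mathbb{R}^2$; (4) there are $R_0,c_0>0$ with $\nabla W(U)\cdot U\ge c_0|U|^2$ for all $U\in\mathbb{R}^2_+$ with $|U|\ge R_0$. Energy: $E(\Psi)=\frac12\int_{-\infty}^{\infty}\bigl(|\psi_1'|^2+|\psi_2'|^2+W(\psi_1,\psi_2)\bigr)\,dx\in[0,\infty]$. $X$ is the set of $U\in H^1_{loc}(\mathbb{R};\mathbb{R}^2)$ with $U(x)\to\mathbf a$ as $x\to+\infty$ and $U(x)\to\mathbf b$ as $x\to-\infty$;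 a minimizer in $X$ is $U\in X$ with $E(U)=\inf_X E$. The self-adjoint operators $L_\pm$ in $L^2$ (two-component, domain $H^2$) are, with all derivatives of $F$ evaluated at $(u_1(x)^2,u_2(x)^2)$, $$L_+=\begin{pmatrix}-\partial_x^2+\partial_1F+2\,\partial_1^2F\,u_1^2 & 2\,\partial_1\partial_2F\,u_1u_2\\ 2\,\partial_1\partial_2F\,u_1u_2 & -\partial_x^2+\partial_2F+2\,\partial_2^2F\,u_2^2\end{pmatrix},\qquad L_-=\begin{pmatrix}-\partial_x^2+\partial_1F&0\\0&-\partial_x^2+\partial_2F\end{pmatrix}.$$ $\lambda\in\mathbb{C}$ is an eigenvalue of the spectral problem if there is a nonzero pair $(\Phi_R,\Phi_I)$ of $\mathbb{C}^2$-valued functions, $\Phi_R\in\mathrm{Dom}(L_+)$, $\Phi_I\in\mathrm{Dom}(L_-)$ (both $H^2(\mathbb{R};\mathbb{C}^2)$), satisfying it. *)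

theory Defs
  imports "HOL-Analysis.Analysis"
begin

section \<open>Functions of class $C^k$ on Euclidean space\<close>

definition partial :: "'n::finite \<Rightarrow> (real ^ 'n \<Rightarrow> real) \<Rightarrow> real ^ 'n \<Rightarrow> real" where
  "partial i f p = deriv (\<lambda>t. f (p + t *\<^sub>R axis i 1)) 0"

text \<open>All iterated partial derivatives of order at most \<open>k\<close> exist everywhere and are continuous.\<close>

fun C_k :: "nat \<Rightarrow> (real ^ 'n::finite \<Rightarrow> real) \<Rightarrow> bool" where
  "C_k 0 f \<longleftrightarrow> continuous_on UNIV f"
| "C_k (Suc k) f \<longleftrightarrow> continuous_on UNIV f \<and>
     (\<forall>i. (\<forall>p. (\<lambda>t. f (p + t *\<^sub>R axis i 1)) differentiable (at 0)) \<and> C_k k (partial i f))"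

definition gradient :: "(real ^ 'n::finite \<Rightarrow> real) \<Rightarrow> real ^ 'n \<Rightarrow> real ^ 'n" where
  "gradient f p = (\<chi> i. partial i f p)"

definition hessian :: "(real ^ 'n::finite \<Rightarrow> real) \<Rightarrow> real ^ 'n \<Rightarrow> real ^ 'n ^ 'n" where
  "hessian f p = (\<chi> i j. partial i (partial j f) p)"

definition nondegenerate_global_min :: "(real ^ 'n::finite \<Rightarrow> real) \<Rightarrow> real ^ 'n \<Rightarrow> bool" where
  "nondegenerate_global_min f p \<longleftrightarrow> (\<forall>q. f p \<le> f q) \<and> invertible (hessian f p)"


section \<open>Admissible potentials\<close>

definition cvec :: "real ^ 2 \<Rightarrow> complex ^ 2" where
  "cvec U = (\<chi> i. complex_of_real (U $ i))"

definition real_restriction :: "(complex ^ 2 \<Rightarrow> real) \<Rightarrow> real ^ 2 \<Rightarrow> real" where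
  "real_restriction W U = W (cvec U)"

text \<open>
  The function \<open>F\<close> and the numbers \<open>a\<close>, \<open>b\<close> whose existence makes \<open>W\<close> admissible are parameters
  here, because the operators $L_\pm$ and the function space \<open>X\<close> are written in terms of them.
  They are determined by \<open>W\<close> as far as they are used: \<open>a\<close> and \<open>b\<close> through the zero set of \<open>W\<close>, and
  \<open>F\<close> together with its partial derivatives on the closed first quadrant.
\<close>

definition admissible_potential ::
    "(complex ^ 2 \<Rightarrow> real) \<Rightarrow> (real ^ 2 \<Rightarrow> real) \<Rightarrow> real \<Rightarrow> real \<Rightarrow> bool" where
  "admissible_potential W F a b \<longleftrightarrow>
     C_k 3 F \<and>
     (\<forall>\<Psi>. W \<Psi> = real_restriction W (vector [cmod (\<Psi> $ 1), cmod (\<Psi> $ 2)]) \<and>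
          W \<Psi> = F (vector [(cmod (\<Psi> $ 1))\<^sup>2, (cmod (\<Psi> $ 2))\<^sup>2])) \<and>
     (\<forall>\<Psi>. W \<Psi> \<ge> 0) \<and> a > 0 \<and> b > 0 \<and>
     (\<forall>\<Psi>. W \<Psi> = 0 \<longleftrightarrow>
          (cmod (\<Psi> $ 1), cmod (\<Psi> $ 2)) = (a, 0) \<or> (cmod (\<Psi> $ 1), cmod (\<Psi> $ 2)) = (0, b)) \<and>
     nondegenerate_global_min (real_restriction W) (vector [a, 0]) \<and>
     nondegenerate_global_min (real_restriction W) (vector [0, b]) \<and>
     (\<exists>R\<^sub>0>0. \<exists>c\<^sub>0>0. \<forall>U. U $ 1 \<ge> 0 \<and> U $ 2 \<ge> 0 \<and> norm U \<ge> R\<^sub>0 \<longrightarrow>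
          gradient (real_restriction W) U \<bullet> U \<ge> c\<^sub>0 * (norm U)\<^sup>2)"


section \<open>Weak derivatives and Sobolev spaces on the real line\<close>

definition test_function :: "(real \<Rightarrow> real) \<Rightarrow> bool" where
  "test_function \<phi> \<longleftrightarrow>
     (\<forall>n x. (deriv ^^ n) \<phi> differentiable (at x)) \<and> (\<exists>R. \<forall>x. \<bar>x\<bar> > R \<longrightarrow> \<phi> x = 0)"

definition locally_integrable :: "(real \<Rightarrow> 'a::euclidean_space) \<Rightarrow> bool" where
  "locally_integrable f \<longleftrightarrow> (\<forall>s t. f absolutely_integrable_on {s..t})"

definition has_weak_derivative ::
    "(real \<Rightarrow> 'a::euclidean_space) \<Rightarrow> (real \<Rightarrow> 'a) \<Rightarrow> bool" where
  "has_weak_derivative f g \<longleftrightarrow> locally_integrable f \<and> locally_integrable g \<and>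
     (\<forall>\<phi>. test_function \<phi> \<longrightarrow>
        (LINT x|lebesgue. deriv \<phi> x *\<^sub>R f x) = - (LINT x|lebesgue. \<phi> x *\<^sub>R g x))"

text \<open>Determined up to equality almost everywhere; only used where a weak derivative exists.\<close>

definition weak_deriv :: "(real \<Rightarrow> 'a::euclidean_space) \<Rightarrow> real \<Rightarrow> 'a" where
  "weak_deriv f = (SOME g. has_weak_derivative f g)"

definition L2_on :: "real set \<Rightarrow> (real \<Rightarrow> 'a::euclidean_space) \<Rightarrow> bool" where
  "L2_on S f \<longleftrightarrow> set_borel_measurable lebesgue S f \<and>
     set_integrable lebesgue S (\<lambda>x. (norm (f x))\<^sup>2)"

definition L2_loc :: "(real \<Rightarrow> 'a::euclidean_space) \<Rightarrow> bool" where
  "L2_loc f \<longleftrightarrow> (\<forall>s t. L2_on {s..t} f)"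

definition H1_loc :: "(real \<Rightarrow> 'a::euclidean_space) \<Rightarrow> bool" where
  "H1_loc f \<longleftrightarrow> L2_loc f \<and> (\<exists>g. has_weak_derivative f g \<and> L2_loc g)"

definition H2 :: "(real \<Rightarrow> 'a::euclidean_space) \<Rightarrow> bool" where
  "H2 f \<longleftrightarrow> L2_on UNIV f \<and>
     (\<exists>g h. has_weak_derivative f g \<and> L2_on UNIV g \<and> has_weak_derivative g h \<and> L2_on UNIV h)"


section \<open>Energy and minimizers\<close>

definition energy :: "(complex ^ 2 \<Rightarrow> real) \<Rightarrow> (real \<Rightarrow> complex ^ 2) \<Rightarrow> ennreal" where
  "energy W \<Psi> =
     (\<integral>\<^sup>+x. ennreal ((cmod (weak_deriv \<Psi> x $ 1))\<^sup>2 + (cmod (weak_deriv \<Psi> x $ 2))\<^sup>2 + W (\<Psi> x))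
        \<partial>lebesgue) / 2"

text \<open>
  Elements of \<open>H1_loc\<close> are classes of functions modulo equality almost everywhere; the limits at
  infinity are those of the continuous representative, so that representative is taken here.
\<close>

definition X :: "real \<Rightarrow> real \<Rightarrow> (real \<Rightarrow> real ^ 2) set" where
  "X a b = {U. continuous_on UNIV U \<and> H1_loc U \<and>
     (U \<longlongrightarrow> vector [a, 0]) at_top \<and> (U \<longlongrightarrow> vector [0, b]) at_bot}"

definition minimizer_in_X ::
    "(complex ^ 2 \<Rightarrow> real) \<Rightarrow> real \<Rightarrow> real \<Rightarrow> (real \<Rightarrow> real ^ 2) \<Rightarrow> bool" where
  "minimizer_in_X W a b U \<longleftrightarrow> U \<in> X a b \<and>
     energy W (cvec \<circ> U) = (INF V \<in> X a b. energy W (cvec \<circ> V))"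


section \<open>The linearized operators and the spectral problem\<close>

definition L_plus ::
    "(real ^ 2 \<Rightarrow> real) \<Rightarrow> (real \<Rightarrow> real ^ 2) \<Rightarrow> (real \<Rightarrow> complex ^ 2) \<Rightarrow> real \<Rightarrow> complex ^ 2" where
  "L_plus F U \<Phi> x =
     (let u1 = U x $ 1; u2 = U x $ 2; p = vector [u1\<^sup>2, u2\<^sup>2]; \<Phi>'' = weak_deriv (weak_deriv \<Phi>) x in
      vector
       [- (\<Phi>'' $ 1) + of_real (partial 1 F p + 2 * partial 1 (partial 1 F) p * u1\<^sup>2) * \<Phi> x $ 1
          + of_real (2 * partial 1 (partial 2 F) p * u1 * u2) * \<Phi> x $ 2,
        of_real (2 * partial 1 (partial 2 F) p * u1 * u2) * \<Phi> x $ 1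
          - \<Phi>'' $ 2 + of_real (partial 2 F p + 2 * partial 2 (partial 2 F) p * u2\<^sup>2) * \<Phi> x $ 2])"

definition L_minus ::
    "(real ^ 2 \<Rightarrow> real) \<Rightarrow> (real \<Rightarrow> real ^ 2) \<Rightarrow> (real \<Rightarrow> complex ^ 2) \<Rightarrow> real \<Rightarrow> complex ^ 2" where
  "L_minus F U \<Phi> x =
     (let p = vector [(U x $ 1)\<^sup>2, (U x $ 2)\<^sup>2]; \<Phi>'' = weak_deriv (weak_deriv \<Phi>) x in
      vector [- (\<Phi>'' $ 1) + of_real (partial 1 F p) * \<Phi> x $ 1,
              - (\<Phi>'' $ 2) + of_real (partial 2 F p) * \<Phi> x $ 2])"

text \<open>
  Functions represent elements of $L^2$, so the equations and the nontriviality of the pair are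
  understood almost everywhere.
\<close>

definition spectral_eigenvalue ::
    "(real ^ 2 \<Rightarrow> real) \<Rightarrow> (real \<Rightarrow> real ^ 2) \<Rightarrow> complex \<Rightarrow> bool" where
  "spectral_eigenvalue F U \<mu> \<longleftrightarrow> (\<exists>\<Phi>\<^sub>R \<Phi>\<^sub>I. H2 \<Phi>\<^sub>R \<and> H2 \<Phi>\<^sub>I \<and>
     \<not> (AE x in lebesgue. \<Phi>\<^sub>R x = 0 \<and> \<Phi>\<^sub>I x = 0) \<and>
     (AE x in lebesgue. L_plus F U \<Phi>\<^sub>R x = - (\<mu> *s \<Phi>\<^sub>I x)) \<and>
     (AE x in lebesgue. L_minus F U \<Phi>\<^sub>I x = \<mu> *s \<Phi>\<^sub>R x))"

end

(*
  The components sqrt(u_j^2 + e^2 phi_j^2) of the modulus of U + i e phi form an admissible real map,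
  and passing to the modulus does not increase the kinetic energy. Hence a minimizer among real maps
  also minimizes among its complex perturbations. Perturbing U in real and in imaginary directions,
  the second variation gives L_+ >= 0 and L_- >= 0 as quadratic forms on H^1. If L_+ R = -mu I and
  L_- I = mu R, then <L_- I, I> = mu <R, I> and <L_+ R, R> = -mu <I, R> are real and nonnegative, so
  for Re mu nonzero both vanish. By the Cauchy-Schwarz inequality for nonnegative forms, L_- I and
  L_+ R are then orthogonal to H^1, and pairing them with mu R and mu I yields R = I = 0.

  Weak derivatives enter through absolutely continuous representatives: f is a primitive of its weak
  derivative. The chain rule for primitives is obtained from the mean value theorem and
  a bisection argument, avoiding differentiation almost everywhere.
*)
theory Submission
  imports Defs
begin

section \<open>Primitives of locally integrable functions\<close>


text \<open>The two variations differ in kind. Since W depends on the squares of the moduli and |u +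
  i e f|^2 = u^2 + e^2 f^2, an imaginary perturbation moves the argument of \<open>F\<close> by e^2
  f^2, so a first-order expansion of \<open>F\<close> already yields the form of L_-. A real
  perturbation moves it by 2 e u f + e^2 f^2; adding the inequalities for e and -e cancels the order
  e, and at order e^2 first and second derivatives of \<open>F\<close> combine into the form of L_+.

  The obstacle is the passage from pointwise expansions to integrals over the whole line. A test
  function in H^1 is bounded and vanishes at infinity, and \<open>U\<close> has bounded range, so
  the Taylor remainders are uniform in x and at most \<eta> e^2 times a constant times the
  integrable |f|^2; \<eta> is removed after integration.

  The inner product of \<open>complex ^ 2\<close> is real. A complex pairing is therefore recorded
  by two real numbers, obtained by testing against a function and against its multiple by i.\<close>

definition primitive :: "(real \<Rightarrow> 'a::euclidean_space) \<Rightarrow> (real \<Rightarrow> 'a) \<Rightarrow> bool" where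
  "primitive f g \<longleftrightarrow>
     (\<forall>s t. s \<le> t \<longrightarrow> g absolutely_integrable_on {s..t} \<and> (g has_integral (f t - f s)) {s..t})"

lemma primitive_has_integral: "primitive f g \<Longrightarrow> s \<le> t \<Longrightarrow> (g has_integral (f t - f s)) {s..t}"
  by (simp add: primitive_def)

lemma primitive_abs_integrable: "primitive f g \<Longrightarrow> g absolutely_integrable_on {s..t}"
proof (cases "s \<le> t")
  case False
  then have "{s..t} = {}" by simp
  then show ?thesis by (simp add: absolutely_integrable_on_def)
qed (simp add: primitive_def)

lemma primitive_continuous:
  assumes "primitive f g"
  shows "continuous_on UNIV f"
proof -
  have "isCont f x" for x
  proof -
    have int: "g integrable_on {x - 1..x + 1}"
      using primitive_abs_integrable[OF assms] set_lebesgue_integral_eq_integral(1) by blast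
    have "continuous_on {x - 1..x + 1} (\<lambda>y. f (x - 1) + integral {x - 1..y} g)"
      by (intro continuous_intros indefinite_integral_continuous_1 int)
    moreover have "f (x - 1) + integral {x - 1..y} g = f y" if "y \<in> {x - 1..x + 1}" for y
      using integral_unique[OF primitive_has_integral[OF assms, of "x - 1" y]] that by simp
    ultimately have "continuous_on {x - 1..x + 1} f"
      by (rule continuous_on_eq)
    then show ?thesis
      by (rule continuous_on_interior) simp
  qed
  then show ?thesis
    by (simp add: continuous_at_imp_continuous_on)
qed

lemma primitive_bounded_linear:
  fixes T :: "'a::euclidean_space \<Rightarrow> 'b::euclidean_space"
  assumes "primitive f g" "bounded_linear T"
  shows "primitive (\<lambda>x. T (f x)) (\<lambda>x. T (g x))"
  unfolding primitive_def
proof (intro allI impI conjI)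
  fix s t :: real assume "s \<le> t"
  show "(\<lambda>x. T (g x)) absolutely_integrable_on {s..t}"
    using absolutely_integrable_linear[OF primitive_abs_integrable[OF assms(1)] assms(2)]
    by (simp add: o_def)
  have "(T \<circ> g has_integral T (f t - f s)) {s..t}"
    by (rule has_integral_linear[OF primitive_has_integral[OF assms(1) \<open>s \<le> t\<close>] assms(2)])
  then show "((\<lambda>x. T (g x)) has_integral T (f t) - T (f s)) {s..t}"
    using assms(2) by (simp add: o_def linear_diff bounded_linear.linear)
qed

lemma primitive_add:
  assumes "primitive f g" "primitive f' g'"
  shows "primitive (\<lambda>x. f x + f' x) (\<lambda>x. g x + g' x)"
  unfolding primitive_def
proof (intro allI impI conjI)
  fix s t :: real assume st: "s \<le> t"
  show "(\<lambda>x. g x + g' x) absolutely_integrable_on {s..t}"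
    by (intro set_integral_add primitive_abs_integrable[OF assms(1)] primitive_abs_integrable[OF assms(2)])
  show "((\<lambda>x. g x + g' x) has_integral f t + f' t - (f s + f' s)) {s..t}"
    using has_integral_add[OF primitive_has_integral[OF assms(1) st] primitive_has_integral[OF assms(2) st]]
    by (simp add: algebra_simps)
qed

lemma primitive_scaleR: "primitive f g \<Longrightarrow> primitive (\<lambda>x. c *\<^sub>R f x) (\<lambda>x. c *\<^sub>R g x)"
  by (rule primitive_bounded_linear[OF _ bounded_linear_scaleR_right])

lemma primitive_Pair:
  assumes "primitive f f'" "primitive g g'"
  shows "primitive (\<lambda>x. (f x, g x)) (\<lambda>x. (f' x, g' x))"
proof -
  have "primitive (\<lambda>x. (f x, 0) + (0, g x)) (\<lambda>x. (f' x, 0) + (0, g' x))"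
    by (intro primitive_add primitive_bounded_linear[OF assms(1)] primitive_bounded_linear[OF assms(2)]
        bounded_linear_Pair bounded_linear_ident bounded_linear_zero)
  then show ?thesis by simp
qed

text \<open>Negligible sets do not affect either integral. This allows a weak derivative to be
  replaced by its continuous representative.\<close>

lemma primitive_cong_AE:
  fixes f :: "real \<Rightarrow> 'a::euclidean_space"
  assumes f: "primitive f g" and ae: "AE x in lebesgue. g x = g' x"
  shows "primitive f g'"
proof -
  obtain N where N: "N \<in> null_sets lebesgue" "{x. g x \<noteq> g' x} \<subseteq> N"
    using ae by (auto simp: eventually_ae_filter)
  then have neg: "negligible N" by (simp add: negligible_iff_null_sets)
  have eq: "g' x = g x" if "x \<in> S - N" for x S 
  proof -
    have "x \<notin> {x. g x \<noteq> g' x}" using N(2) that by blast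
    then show ?thesis by simp
  qed
  show ?thesis
    unfolding primitive_def
  proof (intro allI impI conjI)
    fix s t :: real assume "s \<le> t"
    show "g' absolutely_integrable_on {s..t}"
      by (rule absolutely_integrable_spike[OF primitive_abs_integrable[OF f] neg eq])
    show "(g' has_integral f t - f s) {s..t}"
      by (rule has_integral_spike[OF neg eq primitive_has_integral[OF f \<open>s \<le> t\<close>]])
  qed
qed

lemma primitive_exists:
  fixes g :: "real \<Rightarrow> 'a::euclidean_space"
  assumes "locally_integrable g"
  shows "\<exists>G. primitive G g"
proof
  have int: "g integrable_on {s..t}" for s t
    using assms set_lebesgue_integral_eq_integral(1) unfolding locally_integrable_def by blast
  \<comment> \<open>The oriented integral from 0 to x; \<open>{0..x}\<close> is empty for negative
    x, hence the two cases.\<close>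
  show "primitive (\<lambda>x. if 0 \<le> x then integral {0..x} g else - integral {x..0} g) g"
    unfolding primitive_def
  proof (intro allI impI conjI)
    fix s t :: real assume st: "s \<le> t"
    show "g absolutely_integrable_on {s..t}" using assms by (simp add: locally_integrable_def)
    have "integral {s..t} g = (if 0 \<le> t then integral {0..t} g else - integral {t..0} g)
         - (if 0 \<le> s then integral {0..s} g else - integral {s..0} g)"
      using st Henstock_Kurzweil_Integration.integral_combine[OF _ _ int, of s 0 t]
        Henstock_Kurzweil_Integration.integral_combine[OF _ _ int, of 0 s t]
        Henstock_Kurzweil_Integration.integral_combine[OF _ _ int, of s t 0]
      by (auto simp: algebra_simps)
    then show "(g has_integral (if 0 \<le> t then integral {0..t} g else - integral {t..0} g)
         - (if 0 \<le> s then integral {0..s} g else - integral {s..0} g)) {s..t}"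
      using int by (metis integrable_integral)
  qed
qed

lemma primitive_C1:
  fixes f :: "real \<Rightarrow> 'a::euclidean_space"
  assumes "\<And>x. (f has_vector_derivative f' x) (at x)" "continuous_on UNIV f'"
  shows "primitive f f'"
  unfolding primitive_def
proof (intro allI impI conjI)
  fix s t :: real assume "s \<le> t"
  show "f' absolutely_integrable_on {s..t}"
    by (rule absolutely_integrable_continuous_real[OF continuous_on_subset[OF assms(2)]]) simp
  show "(f' has_integral f t - f s) {s..t}"
    by (rule fundamental_theorem_of_calculus[OF \<open>s \<le> t\<close>]) (meson assms(1) has_vector_derivative_at_within)
qed

section \<open>The chain rule for primitives\<close>

lemma gradient_mvt:
  fixes G :: "'a::euclidean_space \<Rightarrow> real"
  assumes "\<And>p. (G has_derivative (\<lambda>h. G' p \<bullet> h)) (at p)"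
  shows "\<exists>\<xi>\<in>closed_segment p q. G q - G p = G' \<xi> \<bullet> (q - p)"
proof -
  have "\<exists>z::real. z > 0 \<and> z < 1 \<and> G (p + 1 *\<^sub>R (q - p)) - G (p + 0 *\<^sub>R (q - p))
     = (1 - 0) * (G' (p + z *\<^sub>R (q - p)) \<bullet> (q - p))"
  proof (rule MVT2)
    fix z :: real
    have "((\<lambda>z. G (p + z *\<^sub>R (q - p))) has_derivative (\<lambda>h. G' (p + z *\<^sub>R (q - p)) \<bullet> (h *\<^sub>R (q - p)))) (at z)"
      by (rule has_derivative_compose[OF _ assms]) (auto intro!: derivative_eq_intros)
    then show "((\<lambda>z. G (p + z *\<^sub>R (q - p))) has_real_derivative (G' (p + z *\<^sub>R (q - p)) \<bullet> (q - p))) (at z)"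
      by (simp add: has_field_derivative_def mult.commute[of _ "_ \<bullet> _"])
  qed simp
  then obtain z where "0 < z" "z < 1" "G q - G p = G' (p + z *\<^sub>R (q - p)) \<bullet> (q - p)" by auto
  moreover have "p + z *\<^sub>R (q - p) \<in> closed_segment p q"
    using \<open>0 < z\<close> \<open>z < 1\<close> by (auto simp: closed_segment_def algebra_simps intro!: exI[of _ z])
  ultimately show ?thesis by blast
qed

text \<open>On a short interval the mean value theorem turns the increment of \<open>G\<close> along
  \<open>w\<close> into the integral of G' \<xi> \<bullet> w' with a fixed \<xi>, and continuity of
  G' makes the error at most e times the integral of |w'|. This bound is additive over adjacent
  intervals, so bisection extends it to all intervals, and e is arbitrary.\<close>

lemma primitive_compose:
  fixes w :: "real \<Rightarrow> 'a::euclidean_space" and G :: "'a \<Rightarrow> real"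
  assumes w: "primitive w w'" and G: "\<And>p. (G has_derivative (\<lambda>h. G' p \<bullet> h)) (at p)"
    and cont: "continuous_on UNIV G'"
  shows "primitive (\<lambda>x. G (w x)) (\<lambda>x. G' (w x) \<bullet> w' x)"
proof -
  have cw: "continuous_on UNIV w" by (rule primitive_continuous[OF w])
  have cGw: "continuous_on S (\<lambda>x. G' (w x))" for S
    using continuous_on_compose[OF continuous_on_subset[OF cw] continuous_on_subset[OF cont]]
    by (simp add: o_def)
  have abs: "(\<lambda>x. G' (w x) \<bullet> w' x) absolutely_integrable_on {s..t}" for s t
    by (rule absolutely_integrable_bounded_measurable_product[OF _ _ _ _ primitive_abs_integrable[OF w]])
      (auto intro!: continuous_imp_measurable_on_sets_lebesgue cGw compact_imp_bounded compact_continuous_image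
        simp: bilinear_conv_bounded_bilinear bounded_bilinear_inner)
  then have int: "(\<lambda>x. G' (w x) \<bullet> w' x) integrable_on {s..t}" for s t
    using set_lebesgue_integral_eq_integral(1) by blast
  have nint: "(\<lambda>x. norm (w' x)) integrable_on {s..t}" for s t
    using primitive_abs_integrable[OF w] by (simp add: absolutely_integrable_on_def)
  have est: "\<bar>G (w t) - G (w s) - integral {s..t} (\<lambda>x. G' (w x) \<bullet> w' x)\<bar>
     \<le> e * integral {s..t} (\<lambda>x. norm (w' x))" if "s \<le> t" "e > 0" for s t e
    using \<open>s \<le> t\<close>
  proof (rule Bolzano)
    fix x y z
    assume xy: "\<bar>G (w y) - G (w x) - integral {x..y} (\<lambda>x. G' (w x) \<bullet> w' x)\<bar>
     \<le> e * integral {x..y} (\<lambda>x. norm (w' x))" and yz: "\<bar>G (w z) - G (w y) - integral {y..z} (\<lambda>x. G' (w x) \<bullet> w' x)\<bar>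
     \<le> e * integral {y..z} (\<lambda>x. norm (w' x))" and "x \<le> y" "y \<le> z"
    have "integral {x..z} (\<lambda>x. G' (w x) \<bullet> w' x) =
      integral {x..y} (\<lambda>x. G' (w x) \<bullet> w' x) + integral {y..z} (\<lambda>x. G' (w x) \<bullet> w' x)"
      "e * integral {x..z} (\<lambda>x. norm (w' x)) = e * integral {x..y} (\<lambda>x. norm (w' x)) + e * integral {y..z} (\<lambda>x. norm (w' x))"
      using Henstock_Kurzweil_Integration.integral_combine[OF \<open>x \<le> y\<close> \<open>y \<le> z\<close> int]
        Henstock_Kurzweil_Integration.integral_combine[OF \<open>x \<le> y\<close> \<open>y \<le> z\<close> nint]
      by (simp_all flip: distrib_left)
    then show "\<bar>G (w z) - G (w x) - integral {x..z} (\<lambda>x. G' (w x) \<bullet> w' x)\<bar>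
     \<le> e * integral {x..z} (\<lambda>x. norm (w' x))"
      using xy yz by linarith
  next
    fix z
    have "isCont G' (w z)" using cont by (simp add: continuous_on_eq_continuous_at)
    then obtain d1 where d1: "d1 > 0" "\<And>\<xi>. dist \<xi> (w z) < d1 \<Longrightarrow> dist (G' \<xi>) (G' (w z)) < e / 2"
      using \<open>e > 0\<close> unfolding continuous_at_eps_delta by (meson half_gt_zero)
    have "isCont w z" using cw by (simp add: continuous_on_eq_continuous_at)
    then obtain d where d: "d > 0" "\<And>x. dist x z < d \<Longrightarrow> dist (w x) (w z) < d1"
      using d1(1) unfolding continuous_at_eps_delta by meson
    have "\<bar>G (w y) - G (w x) - integral {x..y} (\<lambda>x. G' (w x) \<bullet> w' x)\<bar>
     \<le> e * integral {x..y} (\<lambda>x. norm (w' x))" if "x \<le> z" "z \<le> y" "y - x < d" for x y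
    proof -
      obtain \<xi> where \<xi>: "\<xi> \<in> closed_segment (w x) (w y)" "G (w y) - G (w x) = G' \<xi> \<bullet> (w y - w x)"
        using gradient_mvt[OF G] by metis
      \<comment> \<open>The point \<xi> need not be a value of \<open>w\<close>; convexity of the
        ball keeps it close to \<open>w z\<close>.\<close>
      have "closed_segment (w x) (w y) \<subseteq> ball (w z) d1"
        using that d by (intro closed_segment_subset) (auto simp: dist_commute dist_real_def)
      then have "dist (G' \<xi>) (G' (w z)) < e / 2"
        using d1(2) \<xi>(1) by (force simp: dist_commute)
      moreover have "dist (G' (w u)) (G' (w z)) < e / 2" if "u \<in> {x..y}" for u
        using that \<open>x \<le> z\<close> \<open>z \<le> y\<close> \<open>y - x < d\<close> by (intro d1(2) d(2)) (auto simp: dist_real_def)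
      ultimately have close: "norm (G' \<xi> - G' (w u)) \<le> e" if "u \<in> {x..y}" for u
        using that dist_triangle_half_l[of "G' \<xi>" "G' (w z)" e "G' (w u)"] by (force simp: dist_norm)
      have "x \<le> y" using that by simp
      have "((\<lambda>u. G' \<xi> \<bullet> w' u) has_integral G' \<xi> \<bullet> (w y - w x)) {x..y}"
        using has_integral_linear[OF primitive_has_integral[OF w \<open>x \<le> y\<close>] bounded_linear_inner_right[of "G' \<xi>"]]
        by (simp add: o_def)
      from has_integral_diff[OF this integrable_integral[OF int]]
      have *: "((\<lambda>u. (G' \<xi> - G' (w u)) \<bullet> w' u) has_integral
          G (w y) - G (w x) - integral {x..y} (\<lambda>x. G' (w x) \<bullet> w' x)) {x..y}"
        by (simp add: \<xi>(2) inner_diff_left)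
      have "norm (integral {x..y} (\<lambda>u. (G' \<xi> - G' (w u)) \<bullet> w' u)) \<le> integral {x..y} (\<lambda>u. e * norm (w' u))"
      proof (rule integral_norm_bound_integral)
        show "(\<lambda>u. (G' \<xi> - G' (w u)) \<bullet> w' u) integrable_on {x..y}" using * by blast
        show "(\<lambda>u. e * norm (w' u)) integrable_on {x..y}"
          using integrable_cmul[OF nint, of e x y] by simp
        show "norm ((G' \<xi> - G' (w u)) \<bullet> w' u) \<le> e * norm (w' u)" if "u \<in> {x..y}" for u
          using close[OF that] Cauchy_Schwarz_ineq2[of "G' \<xi> - G' (w u)" "w' u"]
          by (simp add: mult_right_mono order_trans)
      qed
      then show ?thesis
        unfolding integral_unique[OF *] by simp
    qed
    then show "\<exists>d>0. \<forall>x y. x \<le> z \<and> z \<le> y \<and> y - x < d \<longrightarrow>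
        \<bar>G (w y) - G (w x) - integral {x..y} (\<lambda>x. G' (w x) \<bullet> w' x)\<bar> \<le> e * integral {x..y} (\<lambda>x. norm (w' x))"
      using d(1) by blast
  qed
  show ?thesis
    unfolding primitive_def
  proof (intro allI impI conjI abs)
    fix s t :: real assume "s \<le> t"
    define N where "N = integral {s..t} (\<lambda>x. norm (w' x))"
    have "N \<ge> 0" unfolding N_def by (intro integral_nonneg nint) simp
    have "\<bar>G (w t) - G (w s) - integral {s..t} (\<lambda>x. G' (w x) \<bullet> w' x)\<bar> \<le> 0 + e" if "e > 0" for e
    proof -
      \<comment> \<open>The denominator is \<open>N + 1\<close> because \<open>N\<close> may be
        0.\<close>
      have "\<bar>G (w t) - G (w s) - integral {s..t} (\<lambda>x. G' (w x) \<bullet> w' x)\<bar> \<le> (e / (N + 1)) * N"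
        unfolding N_def using est[OF \<open>s \<le> t\<close>, of "e / (N + 1)"] \<open>N \<ge> 0\<close> that by (simp add: N_def)
      also have "\<dots> \<le> e" using \<open>N \<ge> 0\<close> that by (simp add: field_simps)
      finally show ?thesis by simp
    qed
    then have "\<bar>G (w t) - G (w s) - integral {s..t} (\<lambda>x. G' (w x) \<bullet> w' x)\<bar> \<le> 0"
      by (rule field_le_epsilon)
    then show "((\<lambda>x. G' (w x) \<bullet> w' x) has_integral G (w t) - G (w s)) {s..t}"
      using integrable_integral[OF int, of s t] by (metis abs_le_zero_iff eq_iff_diff_eq_0)
  qed
qed

text \<open>The product rule is the chain rule for the map (p, q) to p \<bullet> q on pairs, whose
  gradient is (q, p).\<close>

lemma primitive_inner:
  fixes f g :: "real \<Rightarrow> 'a::euclidean_space"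
  assumes "primitive f f'" "primitive g g'"
  shows "primitive (\<lambda>x. f x \<bullet> g x) (\<lambda>x. f' x \<bullet> g x + f x \<bullet> g' x)"
proof -
  have "primitive (\<lambda>x. fst (f x, g x) \<bullet> snd (f x, g x))
     (\<lambda>x. (snd (f x, g x), fst (f x, g x)) \<bullet> (f' x, g' x))"
    by (rule primitive_compose[OF primitive_Pair[OF assms]])
      (auto intro!: derivative_eq_intros continuous_intros simp: inner_commute add.commute)
  then show ?thesis by (simp add: inner_commute add.commute)
qed

lemma primitive_const: "primitive (\<lambda>x. c) (\<lambda>x. 0)"
  by (rule primitive_C1) auto


section \<open>Test functions\<close>


text \<open>The smoothness clause of \<open>test_function\<close> cut off at order n, so that
  closure properties can be proved by induction on n.\<close>

definition smooth_upto :: "nat \<Rightarrow> (real \<Rightarrow> real) \<Rightarrow> bool" where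
  "smooth_upto n f \<longleftrightarrow> (\<forall>k\<le>n. \<forall>x. (deriv ^^ k) f differentiable (at x))"

lemma smooth_upto_0: "smooth_upto 0 f \<longleftrightarrow> (\<forall>x. f differentiable (at x))"
  by (simp add: smooth_upto_def)

lemma smooth_upto_Suc: "smooth_upto (Suc n) f \<longleftrightarrow> (\<forall>x. f differentiable (at x)) \<and> smooth_upto n (deriv f)"
proof -
  have "(\<forall>k\<le>Suc n. \<forall>x. (deriv ^^ k) f differentiable (at x)) \<longleftrightarrow>
        (\<forall>x. (deriv ^^ 0) f differentiable (at x)) \<and> (\<forall>k\<le>n. \<forall>x. (deriv ^^ Suc k) f differentiable (at x))"
    by (metis Suc_le_mono not0_implies_Suc le0)
  then show ?thesis
    by (simp add: smooth_upto_def funpow_swap1)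
qed

lemma smooth_upto_SucD: "smooth_upto (Suc n) f \<Longrightarrow> smooth_upto n f"
  by (simp add: smooth_upto_def)

lemma smooth_upto_differentiable: "smooth_upto n f \<Longrightarrow> f differentiable (at x)"
  by (cases n) (auto simp: smooth_upto_0 smooth_upto_Suc)

lemma differentiable_DERIV: "f differentiable (at x) \<Longrightarrow> (f has_real_derivative deriv f x) (at x)"
  by (metis DERIV_deriv_iff_real_differentiable)

lemma smooth_upto_add: "smooth_upto n f \<Longrightarrow> smooth_upto n g \<Longrightarrow> smooth_upto n (\<lambda>x. f x + g x)"
proof (induction n arbitrary: f g)
  case (Suc n)
  have "deriv (\<lambda>x. f x + g x) = (\<lambda>x. deriv f x + deriv g x)"
    using Suc.prems by (intro ext DERIV_imp_deriv DERIV_add differentiable_DERIV) (auto simp: smooth_upto_Suc)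
  then show ?case
    using Suc by (auto simp: smooth_upto_Suc)
qed (auto simp: smooth_upto_0)

lemma smooth_upto_mult: "smooth_upto n f \<Longrightarrow> smooth_upto n g \<Longrightarrow> smooth_upto n (\<lambda>x. f x * g x)"
proof (induction n arbitrary: f g)
  case (Suc n)
  have "deriv (\<lambda>x. f x * g x) = (\<lambda>x. deriv f x * g x + f x * deriv g x)"
    using Suc.prems
    by (intro ext DERIV_imp_deriv) (auto intro!: derivative_eq_intros differentiable_DERIV simp: smooth_upto_Suc)
  moreover have "smooth_upto n (\<lambda>x. deriv f x * g x + f x * deriv g x)"
    using Suc.prems smooth_upto_SucD by (intro smooth_upto_add Suc.IH) (auto simp: smooth_upto_Suc)
  ultimately show ?case
    using Suc.prems by (auto simp: smooth_upto_Suc)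
qed (auto simp: smooth_upto_0)

lemma smooth_upto_const: "smooth_upto n (\<lambda>x. c)"
  by (induction n arbitrary: c) (auto simp: smooth_upto_0 smooth_upto_Suc)

lemma smooth_upto_affine: "smooth_upto n f \<Longrightarrow> smooth_upto n (\<lambda>x. f (c * x + d))"
proof -
  have D: "((\<lambda>x. f (c * x + d)) has_real_derivative deriv f (c * x + d) * c) (at x)"
    if "smooth_upto n f" for n f x
  proof -
    have "((\<lambda>x. c * x + d) has_real_derivative c) (at x)"
      by (auto intro!: derivative_eq_intros)
    then show ?thesis
      by (rule DERIV_chain2[OF differentiable_DERIV[OF smooth_upto_differentiable[OF that]]])
  qed
  show "smooth_upto n f \<Longrightarrow> smooth_upto n (\<lambda>x. f (c * x + d))"
  proof (induction n arbitrary: f)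
    case 0
    then show ?case using D[OF 0] by (auto simp: smooth_upto_0 real_differentiable_def)
  next
    case (Suc n)
    have "deriv (\<lambda>x. f (c * x + d)) = (\<lambda>x. deriv f (c * x + d) * c)"
      using D[OF Suc.prems] by (intro ext DERIV_imp_deriv)
    moreover have "smooth_upto n (\<lambda>x. deriv f (c * x + d) * c)"
      using Suc by (intro smooth_upto_mult smooth_upto_const Suc.IH) (auto simp: smooth_upto_Suc)
    ultimately show ?case
      using D[OF Suc.prems] by (auto simp: smooth_upto_Suc real_differentiable_def)
  qed
qed

text \<open>The classical flat function exp(-1/x) times a polynomial in 1/x. The polynomial
  parameter closes the family under differentiation, which gives smoothness by induction.\<close>

definition flat_exp :: "real poly \<Rightarrow> real \<Rightarrow> real" where
  "flat_exp p x = (if x > 0 then poly p (inverse x) * exp (- inverse x) else 0)"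

lemma poly_times_exp_tendsto_0: "((\<lambda>y. poly p y * exp (- y)) \<longlongrightarrow> (0::real)) at_top"
proof -
  have "((\<lambda>y. \<Sum>i\<le>degree p. coeff p i * (y ^ i / exp y)) \<longlongrightarrow> (\<Sum>i\<le>degree p. coeff p i * 0)) at_top"
    by (intro tendsto_intros tendsto_power_div_exp_0)
  then show ?thesis
    by (simp add: poly_altdef sum_divide_distrib exp_minus field_simps)
qed

text \<open>With y = 1/x, the derivative of p(y) exp(-y) in x is y^2 (p - p')(y) exp(-y), and
  \<open>[:0, 0, 1:]\<close> is y^2. At 0 the right difference quotient tends to 0 because
  exponential decay beats every polynomial.\<close>

lemma DERIV_flat_exp:
  "(flat_exp p has_real_derivative flat_exp ([:0, 0, 1:] * (p - pderiv p)) x) (at x)"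
proof -
  consider "x > 0" | "x < 0" | "x = 0" by linarith
  then show ?thesis
  proof cases
    case 1
    have "((\<lambda>x. poly p (inverse x) * exp (- inverse x)) has_real_derivative
        flat_exp ([:0, 0, 1:] * (p - pderiv p)) x) (at x)"
      using 1 by (auto intro!: derivative_eq_intros DERIV_chain2[OF poly_DERIV]
          simp: flat_exp_def algebra_simps power2_eq_square)
    then show ?thesis
      by (rule has_field_derivative_transform_within_open[of _ _ _ "{0<..}"]) (use 1 in \<open>auto simp: flat_exp_def\<close>)
  next
    case 2
    have "((\<lambda>x. 0) has_real_derivative flat_exp ([:0, 0, 1:] * (p - pderiv p)) x) (at x)"
      using 2 by (auto simp: flat_exp_def)
    then show ?thesis
      by (rule has_field_derivative_transform_within_open[of _ _ _ "{..<0}"]) (use 2 in \<open>auto simp: flat_exp_def\<close>)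
  next
    case 3
    have "((\<lambda>h. (flat_exp p (0 + h) - flat_exp p 0) / h) \<longlongrightarrow> 0) (at 0)"
    proof (rule filterlim_split_at)
      show "((\<lambda>h. (flat_exp p (0 + h) - flat_exp p 0) / h) \<longlongrightarrow> 0) (at_left 0)"
        by (rule tendsto_eventually) (auto simp: eventually_at_filter flat_exp_def)
      \<comment> \<open>Dividing by h multiplies the polynomial in 1/h by its variable, hence
        \<open>pCons 0 p\<close>.\<close>
      have "((\<lambda>h. poly (pCons 0 p) (inverse h) * exp (- inverse h)) \<longlongrightarrow> (0::real)) (at_right 0)"
        by (rule filterlim_compose[OF poly_times_exp_tendsto_0 filterlim_inverse_at_top_right])
      then show "((\<lambda>h. (flat_exp p (0 + h) - flat_exp p 0) / h) \<longlongrightarrow> 0) (at_right 0)"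
        by (rule Lim_transform_eventually)
          (auto simp: eventually_at_filter flat_exp_def divide_inverse)
    qed
    then show ?thesis
      using 3 by (simp add: DERIV_def flat_exp_def)
  qed
qed

lemma smooth_upto_flat_exp: "smooth_upto n (flat_exp p)"
proof (induction n arbitrary: p)
  case 0
  then show ?case using DERIV_flat_exp by (auto simp: smooth_upto_0 real_differentiable_def)
next
  case (Suc n)
  have "deriv (flat_exp p) = flat_exp ([:0, 0, 1:] * (p - pderiv p))"
    using DERIV_flat_exp by (intro ext DERIV_imp_deriv)
  then show ?case
    using DERIV_flat_exp Suc by (auto simp: smooth_upto_Suc real_differentiable_def)
qed

text \<open>Inside the interval this is exp(-1/((n+1)(x - s))) times exp(-1/((n+1)(t - x))).
  Stretching the argument drives both factors to 1 there, while each bump stays smooth. The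
  arguments are written in the shape \<open>c * x + d\<close> of
  \<open>smooth_upto_affine\<close>.\<close>

definition bump :: "real \<Rightarrow> real \<Rightarrow> nat \<Rightarrow> real \<Rightarrow> real" where
  "bump s t n x = flat_exp 1 (real (Suc n) * x + (- real (Suc n) * s)) * flat_exp 1 ((- real (Suc n)) * x + real (Suc n) * t)"

lemma bump_eq_0: "x \<notin> {s<..<t} \<Longrightarrow> bump s t n x = 0"
proof -
  assume "x \<notin> {s<..<t}"
  then have "real (Suc n) * x \<le> real (Suc n) * s \<or> real (Suc n) * t \<le> real (Suc n) * x"
    by (auto intro: mult_left_mono simp del: of_nat_Suc)
  then show ?thesis
    by (auto simp: bump_def flat_exp_def simp del: of_nat_Suc)
qed

lemma bump_bounds: "0 \<le> bump s t n x" "bump s t n x \<le> 1"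
proof -
  have "0 \<le> flat_exp 1 y" "flat_exp 1 y \<le> 1" for y by (auto simp: flat_exp_def)
  then show "0 \<le> bump s t n x" "bump s t n x \<le> 1"
    unfolding bump_def by (auto intro: mult_le_one)
qed

lemma bump_tendsto: "(\<lambda>n. bump s t n x) \<longlonglongrightarrow> indicator {s<..<t} x"
proof (cases "x \<in> {s<..<t}")
  case True
  have *: "(\<lambda>n. flat_exp 1 (real (Suc n) * c)) \<longlonglongrightarrow> 1" if "c > 0" for c
  proof -
    have "(\<lambda>n. exp (- (inverse (real (Suc n)) * inverse c))) \<longlonglongrightarrow> exp (- (0 * inverse c))"
      by (intro tendsto_intros LIMSEQ_inverse_real_of_nat)
    then show ?thesis using that by (simp add: flat_exp_def del: of_nat_Suc)
  qed
  have "(\<lambda>n. flat_exp 1 (real (Suc n) * (x - s)) * flat_exp 1 (real (Suc n) * (t - x))) \<longlonglongrightarrow> 1 * 1"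
    using True by (intro tendsto_mult *) auto
  then show ?thesis using True by (simp add: bump_def algebra_simps del: of_nat_Suc)
qed (simp add: bump_eq_0)

lemma test_function_bump: "test_function (bump s t n)"
proof -
  have "smooth_upto k (bump s t n)" for k
    unfolding bump_def by (intro smooth_upto_mult smooth_upto_affine smooth_upto_flat_exp)
  moreover have "\<forall>x. \<bar>x\<bar> > max \<bar>s\<bar> \<bar>t\<bar> \<longrightarrow> bump s t n x = 0"
    by (auto intro!: bump_eq_0)
  ultimately show ?thesis
    unfolding test_function_def smooth_upto_def by blast
qed

lemma test_function_DERIV: "test_function \<phi> \<Longrightarrow> (\<phi> has_real_derivative deriv \<phi> x) (at x)"
  by (metis differentiable_DERIV funpow_0 test_function_def)

lemma test_function_continuous: "test_function \<phi> \<Longrightarrow> continuous_on S \<phi>"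
  by (meson DERIV_isCont continuous_at_imp_continuous_on test_function_DERIV)

lemma test_function_deriv:
  assumes "test_function \<phi>"
  shows "test_function (deriv \<phi>)"
  unfolding test_function_def
proof (intro conjI allI)
  show "(deriv ^^ n) (deriv \<phi>) differentiable at x" for n x
    using assms unfolding test_function_def by (metis funpow_Suc_right comp_apply)
  obtain R where R: "\<And>x. \<bar>x\<bar> > R \<Longrightarrow> \<phi> x = 0" using assms by (auto simp: test_function_def)
  have "deriv \<phi> x = 0" if "\<bar>x\<bar> > R" for x
  proof (rule DERIV_imp_deriv, rule has_field_derivative_transform_within_open[of "\<lambda>_. 0" _ _ "{x. \<bar>x\<bar> > R}"])
    show "open {x. \<bar>x\<bar> > R}" by (intro open_Collect_less continuous_intros)
  qed (use that R in auto)
  then show "\<exists>R. \<forall>x. \<bar>x\<bar> > R \<longrightarrow> deriv \<phi> x = 0" by blast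
qed


section \<open>The lemma of du Bois-Reymond\<close>


text \<open>Needed for \<open>density_zero\<close>. A countable cover by sets of finite measure for
  \<open>lborel\<close> also serves its completion.\<close>

lemma sigma_finite_lebesgue: "sigma_finite_measure (lebesgue :: 'a::euclidean_space measure)"
proof -
  obtain A :: "'a set set" where "countable A" "A \<subseteq> sets lborel" "\<Union> A = UNIV" "\<forall>a\<in>A. emeasure lborel a \<noteq> \<infinity>"
    using sigma_finite_lborel[where 'a = 'a] unfolding sigma_finite_measure_def by auto
  then show ?thesis
    unfolding sigma_finite_measure_def
    by (intro exI[of _ A]) (auto simp: subset_iff)
qed

lemma set_integrable_locally:
  fixes g :: "real \<Rightarrow> 'a::euclidean_space"
  assumes "locally_integrable g" "S \<in> sets lebesgue" "S \<subseteq> {s..t}"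
  shows "set_integrable lebesgue S g"
  using set_integrable_subset[of lebesgue "{s..t}" g S] assms unfolding locally_integrable_def by auto

text \<open>The bumps converge to the indicator of an open interval, so all interval
  integrals of \<open>g\<close> vanish, and intervals generate the Borel sets.\<close>

lemma set_integral_interval_eq_0:
  fixes g :: "real \<Rightarrow> 'a::euclidean_space"
  assumes loc: "locally_integrable g"
    and zero: "\<And>\<phi>. test_function \<phi> \<Longrightarrow> (LINT x|lebesgue. \<phi> x *\<^sub>R g x) = 0"
  shows "(LINT x:{s<..<t}|lebesgue. g x) = 0"
proof -
  have int: "integrable lebesgue (\<lambda>x. indicator {s..t} x *\<^sub>R g x)"
    using loc unfolding locally_integrable_def set_integrable_def by blast
  then have meas: "(\<lambda>x. indicator {s..t} x *\<^sub>R g x) \<in> borel_measurable lebesgue" by simp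
  \<comment> \<open>The bump vanishes off the interval, so \<open>g\<close> may be truncated to
    \<open>{s..t}\<close>; the truncation is integrable and serves as the dominating
    function.\<close>
  have b: "bump s t n x *\<^sub>R g x = bump s t n x *\<^sub>R (indicator {s..t} x *\<^sub>R g x)" for n x
    by (cases "x \<in> {s<..<t}") (auto simp: indicator_def bump_eq_0)
  have bm: "bump s t n \<in> borel_measurable lebesgue" for n
    using borel_measurable_continuous_onI[OF test_function_continuous[OF test_function_bump]]
    by (simp add: measurable_completion)
  have "(\<lambda>n. LINT x|lebesgue. bump s t n x *\<^sub>R g x) \<longlonglongrightarrow> (LINT x|lebesgue. indicator {s<..<t} x *\<^sub>R g x)"
  proof (rule integral_dominated_convergence[where w = "\<lambda>x. norm (indicator {s..t} x *\<^sub>R g x)"])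
    show "(\<lambda>x. bump s t n x *\<^sub>R g x) \<in> borel_measurable lebesgue" for n
      by (subst b) (intro borel_measurable_scaleR bm meas)
    have "indicator {s<..<t} x *\<^sub>R g x = indicat_real {s<..<t} x *\<^sub>R (indicator {s..t} x *\<^sub>R g x)" for x
      by (auto simp: indicator_def)
    then show "(\<lambda>x. indicat_real {s<..<t} x *\<^sub>R g x) \<in> borel_measurable lebesgue"
      using meas by (metis (no_types, lifting) ext borel_measurable_indicator borel_measurable_scaleR greaterThanLessThan_borel sets_completionI_sets sets_lborel)
    show "integrable lebesgue (\<lambda>x. norm (indicat_real {s..t} x *\<^sub>R g x))"
      by (rule integrable_norm[OF int])
    show "AE x in lebesgue. (\<lambda>n. bump s t n x *\<^sub>R g x) \<longlonglongrightarrow> indicat_real {s<..<t} x *\<^sub>R g x"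
      by (intro AE_I2 tendsto_scaleR bump_tendsto tendsto_const)
    show "AE x in lebesgue. norm (bump s t n x *\<^sub>R g x) \<le> norm (indicat_real {s..t} x *\<^sub>R g x)" for n
    proof (rule AE_I2)
      fix x
      have "bump s t n x * norm (indicat_real {s..t} x *\<^sub>R g x) \<le> 1 * norm (indicat_real {s..t} x *\<^sub>R g x)"
        by (rule mult_right_mono[OF bump_bounds(2)]) simp
      then show "norm (bump s t n x *\<^sub>R g x) \<le> norm (indicat_real {s..t} x *\<^sub>R g x)"
        by (subst b) (simp add: bump_bounds)
    qed
  qed
  then have "(\<lambda>n. 0) \<longlonglongrightarrow> (LINT x|lebesgue. indicat_real {s<..<t} x *\<^sub>R g x)"
    by (simp add: zero[OF test_function_bump])
  then show ?thesis
    unfolding set_lebesgue_integral_def by (metis LIMSEQ_const_iff)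
qed

text \<open>Truncation to a bounded interval makes the function integrable on the line.
  \<open>density_zero\<close> then asks for zero integrals over all Lebesgue sets: intervals give
  the Borel sets by a Dynkin argument, and a Lebesgue set differs from a Borel set by a null
  set.\<close>

lemma du_bois_reymond:
  fixes g :: "real \<Rightarrow> 'a::euclidean_space"
  assumes loc: "locally_integrable g"
    and zero: "\<And>\<phi>. test_function \<phi> \<Longrightarrow> (LINT x|lebesgue. \<phi> x *\<^sub>R g x) = 0"
  shows "AE x in lebesgue. g x = 0"
proof -
  interpret sigma_finite_measure "lebesgue :: real measure" by (rule sigma_finite_lebesgue)
  have "AE x in lebesgue. indicat_real {-real N<..<real N} x *\<^sub>R g x = 0" for N :: nat
  proof -
    define h where "h = (\<lambda>x. indicat_real {-real N<..<real N} x *\<^sub>R g x)"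
    have "set_integrable lebesgue {-real N<..<real N} g"
      by (rule set_integrable_locally[OF loc, of _ "-real N" "real N"]) auto
    then have inth: "integrable lebesgue h"
      by (simp add: h_def set_integrable_def)
    have inth': "set_integrable lebesgue A h" if "A \<in> sets lebesgue" for A
      using inth that by (simp add: set_integrable_def integrable_mult_indicator)
    have int0: "(LINT x:{s<..<t}|lebesgue. h x) = 0" for s t
    proof -
      have "(LINT x:{s<..<t}|lebesgue. h x) = (LINT x:{max s (-real N)<..<min t (real N)}|lebesgue. g x)"
        unfolding set_lebesgue_integral_def h_def
        by (rule Bochner_Integration.integral_cong) (auto simp: indicator_def)
      then show ?thesis using set_integral_interval_eq_0[OF assms] by simp
    qed
    \<comment> \<open>The complement step of the Dynkin argument subtracts from the integral over
      the whole line.\<close>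
    have tot: "(LINT x:UNIV|lebesgue. h x) = 0"
    proof -
      have "(LINT x:UNIV|lebesgue. h x) = (LINT x:{-real N<..<real N}|lebesgue. h x)"
        unfolding set_lebesgue_integral_def h_def
        by (rule Bochner_Integration.integral_cong) (auto simp: indicator_def)
      then show ?thesis using int0 by simp
    qed
    have borel: "(LINT x:A|lebesgue. h x) = 0" if "A \<in> sets (borel :: real measure)" for A
    proof -
      let ?G = "range (\<lambda>(a, b). box a b :: real set)"
      have gen: "sigma_sets UNIV ?G = sets (borel :: real measure)"
        by (simp add: borel_eq_box)
      have "Int_stable ?G"
      proof (rule Int_stableI, safe)
        fix a b c d :: real
        have "box a b \<inter> box c d = (case (max a c, min b d) of (a, b) \<Rightarrow> box a b)"
          by (auto simp: box_real)
        then show "box a b \<inter> box c d \<in> ?G" by blast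
      qed
      have "A \<in> sigma_sets UNIV ?G" using that gen by simp
      from \<open>Int_stable ?G\<close> subset_UNIV[of ?G, folded Pow_UNIV] this show ?thesis
      proof (induction rule: sigma_sets_induct_disjoint)
        case (basic A)
        then show ?case using int0 by (auto simp: box_real)
      next
        case (compl A)
        then have A: "A \<in> sets lebesgue" using gen by (metis sets_completionI_sets sets_lborel)
        have "(LINT x:A \<union> (UNIV - A)|lebesgue. h x) = (LINT x:A|lebesgue. h x) + (LINT x:UNIV - A|lebesgue. h x)"
          using A by (intro set_integral_Un inth') auto
        then show ?case using compl(2) tot by simp
      next
        case (union A)
        then have A: "A i \<in> sets lebesgue" for i
          using gen by (metis UNIV_I image_subset_iff sets_completionI_sets sets_lborel)
        have "(LINT x:(\<Union>i. A i)|lebesgue. h x) = (\<Sum>i. LINT x:A i|lebesgue. h x)"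
          using union(1) A by (intro lebesgue_integral_countable_add inth') (auto simp: disjoint_family_on_def)
        then show ?case using union(3) by simp
      qed (auto simp: set_lebesgue_integral_def)
    qed
    have "(LINT x:A|lebesgue. h x) = 0" if "A \<in> sets lebesgue" for A
    proof -
      obtain S N N' where A: "A = S \<union> N" "N \<subseteq> N'" "N' \<in> null_sets lborel" "S \<in> sets lborel"
        using \<open>A \<in> sets lebesgue\<close> by (rule sets_completionE)
      have "AE x in lebesgue. x \<notin> N'"
        using A(3) by (intro AE_not_in null_sets_completionI)
      then have "AE x in lebesgue. x \<in> A \<longleftrightarrow> x \<in> S"
        by eventually_elim (use A in auto)
      then have "AE x in lebesgue. indicat_real A x *\<^sub>R h x = indicat_real S x *\<^sub>R h x"
        by eventually_elim (auto simp: indicator_def)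
      moreover have "set_integrable lebesgue A h" "set_integrable lebesgue S h"
        using A(4) that by (auto intro!: inth')
      ultimately have "(LINT x:A|lebesgue. h x) = (LINT x:S|lebesgue. h x)"
        unfolding set_lebesgue_integral_def set_integrable_def
        by (intro integral_cong_AE) auto
      then show ?thesis using borel A(4) by simp
    qed
    from density_zero[OF inth this] show ?thesis by (simp add: h_def)
  qed
  then have "AE x in lebesgue. \<forall>N. indicat_real {-real N<..<real N} x *\<^sub>R g x = 0"
    unfolding AE_all_countable by blast
  then show ?thesis
  proof eventually_elim
    case (elim x)
    obtain N :: nat where "\<bar>x\<bar> < real N" using reals_Archimedean2 by blast
    then have "indicat_real {-real N<..<real N} x = 1" by (auto simp: indicator_def)
    then show ?case using elim[rule_format, of N] by simp
  qed
qed

text \<open>The set where two continuous functions differ is open, and a nonempty open set is not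
  negligible.\<close>

lemma continuous_AE_eq:
  fixes f g :: "real \<Rightarrow> 'a::euclidean_space"
  assumes "continuous_on UNIV f" "continuous_on UNIV g" "AE x in lebesgue. f x = g x"
  shows "f = g"
proof -
  have op: "open {x. f x \<noteq> g x}" using assms by (intro open_Collect_neq)
  have "negligible {x. f x \<noteq> g x}"
    using assms(3) op by (simp add: negligible_iff_null_sets AE_iff_null_sets lborelD)
  then have "{x. f x \<noteq> g x} = {}"
    using op open_not_negligible by blast
  then show ?thesis by auto
qed


section \<open>Weak derivatives and primitives\<close>


text \<open>A continuous factor with bounded support makes a locally integrable function integrable.
  The second claim rewrites the Lebesgue integrals of \<open>has_weak_derivative\<close> as gauge
  integrals over \<open>{-R..R}\<close>, the form in which \<open>primitive\<close> is
  stated.\<close>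

lemma test_function_integrable:
  fixes g :: "real \<Rightarrow> 'a::euclidean_space"
  assumes "continuous_on UNIV \<phi>" "\<And>x. \<bar>x\<bar> > R \<Longrightarrow> \<phi> x = 0" "locally_integrable g"
  shows "integrable lebesgue (\<lambda>x. \<phi> x *\<^sub>R g x)"
    and "((\<lambda>x. \<phi> x *\<^sub>R g x) has_integral (LINT x|lebesgue. \<phi> x *\<^sub>R g x)) {-R..R}"
proof -
  have *: "(\<lambda>x. \<phi> x *\<^sub>R g x) absolutely_integrable_on {-R..R}"
    by (rule absolutely_integrable_bounded_measurable_product)
      (use assms in \<open>auto intro!: continuous_imp_measurable_on_sets_lebesgue compact_imp_bounded
        compact_continuous_image continuous_on_subset[OF assms(1)]
        simp: bilinear_conv_bounded_bilinear bounded_bilinear_scaleR locally_integrable_def\<close>)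
  have eq: "indicator {-R..R} x *\<^sub>R (\<phi> x *\<^sub>R g x) = \<phi> x *\<^sub>R g x" for x
    by (cases "\<bar>x\<bar> > R") (auto simp: indicator_def abs_le_iff not_less assms(2))
  show "integrable lebesgue (\<lambda>x. \<phi> x *\<^sub>R g x)"
    using * unfolding set_integrable_def eq .
  show "((\<lambda>x. \<phi> x *\<^sub>R g x) has_integral (LINT x|lebesgue. \<phi> x *\<^sub>R g x)) {-R..R}"
    using set_lebesgue_integral_eq_integral[OF *] unfolding set_lebesgue_integral_def eq
    by (metis integrable_integral)
qed

text \<open>One radius serves \<phi> and its derivative. The sign \<open>\<ge>\<close>, bought by
  adding 1, makes both vanish at -R and R themselves, as boundary terms require.\<close>

lemma test_function_support:
  assumes "test_function \<phi>"
  shows "\<exists>R>0. \<forall>x. \<bar>x\<bar> \<ge> R \<longrightarrow> \<phi> x = 0 \<and> deriv \<phi> x = 0"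
proof -
  obtain R R' where "\<forall>x. \<bar>x\<bar> > R \<longrightarrow> \<phi> x = 0" "\<forall>x. \<bar>x\<bar> > R' \<longrightarrow> deriv \<phi> x = 0"
    using assms test_function_deriv[OF assms] unfolding test_function_def by blast
  then show ?thesis by (intro exI[of _ "max 1 (max R R' + 1)"]) auto
qed

lemma locally_integrable_continuous:
  fixes f :: "real \<Rightarrow> 'a::euclidean_space"
  shows "continuous_on UNIV f \<Longrightarrow> locally_integrable f"
  unfolding locally_integrable_def
  by (intro allI absolutely_integrable_continuous_real) (auto intro: continuous_on_subset)

lemma primitive_locally_integrable:
  assumes "primitive f g" shows "locally_integrable f" "locally_integrable g"
  using locally_integrable_continuous[OF primitive_continuous[OF assms]] primitive_abs_integrable[OF assms]
  by (auto simp: locally_integrable_def)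

text \<open>The product \<phi> f is a primitive of \<phi>' f + \<phi> g and vanishes at both ends of
  \<open>{-R..R}\<close>.\<close>

lemma primitive_imp_has_weak_derivative:
  fixes f g :: "real \<Rightarrow> 'a::euclidean_space"
  assumes fg: "primitive f g"
  shows "has_weak_derivative f g"
  unfolding has_weak_derivative_def
proof (intro conjI allI impI primitive_locally_integrable[OF fg])
  fix \<phi> assume \<phi>: "test_function \<phi>"
  obtain R where R: "R > 0" "\<And>x. \<bar>x\<bar> \<ge> R \<Longrightarrow> \<phi> x = 0" "\<And>x. \<bar>x\<bar> \<ge> R \<Longrightarrow> deriv \<phi> x = 0"
    using test_function_support[OF \<phi>] by blast
  have i1: "((\<lambda>x. \<phi> x *\<^sub>R g x) has_integral (LINT x|lebesgue. \<phi> x *\<^sub>R g x)) {-R..R}"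
    by (rule test_function_integrable[OF test_function_continuous[OF \<phi>] _ primitive_locally_integrable(2)[OF fg]])
      (simp add: R)
  have i2: "((\<lambda>x. deriv \<phi> x *\<^sub>R f x) has_integral (LINT x|lebesgue. deriv \<phi> x *\<^sub>R f x)) {-R..R}"
    by (rule test_function_integrable[OF test_function_continuous[OF test_function_deriv[OF \<phi>]] _ primitive_locally_integrable(1)[OF fg]])
      (simp add: R)
  have "(LINT x|lebesgue. deriv \<phi> x *\<^sub>R f x) + (LINT x|lebesgue. \<phi> x *\<^sub>R g x) = 0"
  proof (rule euclidean_eqI)
    \<comment> \<open>The product rule is stated for inner products, so the vector identity is
      tested against each basis vector, with \<phi> b as the other factor.\<close>
    fix b :: 'a assume "b \<in> Basis"
    have P: "primitive \<phi> (deriv \<phi>)"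
      using test_function_DERIV[OF \<phi>] test_function_continuous[OF test_function_deriv[OF \<phi>]]
      by (intro primitive_C1) (auto simp: has_real_derivative_iff_has_vector_derivative)
    have "primitive (\<lambda>x. (\<phi> x *\<^sub>R b) \<bullet> f x) (\<lambda>x. (deriv \<phi> x *\<^sub>R b) \<bullet> f x + (\<phi> x *\<^sub>R b) \<bullet> g x)"
      by (rule primitive_inner[OF primitive_bounded_linear[OF P bounded_linear_scaleR_left] fg])
    from primitive_has_integral[OF this, of "-R" R]
    have i3: "((\<lambda>x. (deriv \<phi> x *\<^sub>R b) \<bullet> f x + (\<phi> x *\<^sub>R b) \<bullet> g x) has_integral 0) {-R..R}"
      using R by simp
    have i4: "((\<lambda>x. (deriv \<phi> x *\<^sub>R b) \<bullet> f x + (\<phi> x *\<^sub>R b) \<bullet> g x) has_integral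
        ((LINT x|lebesgue. deriv \<phi> x *\<^sub>R f x) + (LINT x|lebesgue. \<phi> x *\<^sub>R g x)) \<bullet> b) {-R..R}"
      using has_integral_linear[OF has_integral_add[OF i2 i1] bounded_linear_inner_left[of b]]
      by (simp add: o_def inner_add_left inner_commute[of b])
    show "((LINT x|lebesgue. deriv \<phi> x *\<^sub>R f x) + (LINT x|lebesgue. \<phi> x *\<^sub>R g x)) \<bullet> b = 0 \<bullet> b"
      using has_integral_unique[OF i4 i3] by simp
  qed
  then show "(LINT x|lebesgue. deriv \<phi> x *\<^sub>R f x) = - (LINT x|lebesgue. \<phi> x *\<^sub>R g x)"
    by (simp add: eq_neg_iff_add_eq_0)
qed

lemma test_function_add_scale:
  assumes "test_function f" "test_function g"
  shows "test_function (\<lambda>x. f x + c * g x)"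
proof -
  have "smooth_upto n f" "smooth_upto n g" for n
    using assms by (auto simp: test_function_def smooth_upto_def)
  then have *: "smooth_upto n (\<lambda>x. f x + c * g x)" for n
    by (intro smooth_upto_add smooth_upto_mult smooth_upto_const)
  obtain R R' where "\<And>x. \<bar>x\<bar> > R \<Longrightarrow> f x = 0" "\<And>x. \<bar>x\<bar> > R' \<Longrightarrow> g x = 0"
    using assms unfolding test_function_def by blast
  then have "\<forall>x. \<bar>x\<bar> > max R R' \<longrightarrow> f x + c * g x = 0" by auto
  with * show ?thesis unfolding test_function_def smooth_upto_def by blast
qed

lemma primitive_has_vector_derivative:
  assumes "primitive f g" "continuous_on UNIV g"
  shows "(f has_vector_derivative g x) (at x)"
proof -
  have "((\<lambda>y. integral {x - 1..y} g) has_vector_derivative g x) (at x within {x - 1..x + 1})"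
    using assms(2) by (intro integral_has_vector_derivative) (auto intro: continuous_on_subset)
  then have D: "((\<lambda>y. f (x - 1) + integral {x - 1..y} g) has_vector_derivative g x) (at x within {x - 1..x + 1})"
    by (auto intro!: derivative_eq_intros)
  have "f y = f (x - 1) + integral {x - 1..y} g" if "y \<in> {x - 1..x + 1}" for y
    using integral_unique[OF primitive_has_integral[OF assms(1), of "x - 1" y]] that by simp
  from has_vector_derivative_transform[OF _ this D]
  have "(f has_vector_derivative g x) (at x within {x - 1..x + 1})" by simp
  moreover have "at x within {x - 1..x + 1} = at x" by (rule at_within_Icc_at) auto
  ultimately show ?thesis by metis
qed

text \<open>Normalised to vanish at -R, the primitive is 0 to the left of the support and equals the
  total integral to the right of it; zero mean therefore gives bounded support.\<close>

lemma test_function_antiderivative: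
  assumes \<psi>: "test_function \<psi>" and zero: "(LINT x|lebesgue. \<psi> x) = 0"
  shows "\<exists>\<phi>. test_function \<phi> \<and> deriv \<phi> = \<psi>"
proof -
  obtain R where R: "R > 0" "\<And>x. \<bar>x\<bar> \<ge> R \<Longrightarrow> \<psi> x = 0"
    using test_function_support[OF \<psi>] by blast
  have cont: "continuous_on UNIV \<psi>" by (rule test_function_continuous[OF \<psi>])
  obtain \<Phi> where \<Phi>: "primitive \<Phi> \<psi>"
    using primitive_exists[OF locally_integrable_continuous[OF cont]] by blast
  define \<phi> where "\<phi> = (\<lambda>x. \<Phi> x - \<Phi> (-R))"
  have D: "(\<phi> has_real_derivative \<psi> x) (at x)" for x
    using primitive_has_vector_derivative[OF \<Phi> cont]
    unfolding \<phi>_def has_real_derivative_iff_has_vector_derivative by (auto intro!: derivative_eq_intros)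
  then have deriv: "deriv \<phi> = \<psi>" by (intro ext DERIV_imp_deriv)
  have const: "\<Phi> s = \<Phi> t" if "s \<le> t" "\<And>x. x \<in> {s..t} \<Longrightarrow> \<psi> x = 0" for s t
  proof -
    have "(\<psi> has_integral 0) {s..t}" using that(2) by (rule has_integral_is_0)
    then have "\<Phi> t - \<Phi> s = 0" by (rule has_integral_unique[OF primitive_has_integral[OF \<Phi> \<open>s \<le> t\<close>]])
    then show ?thesis by simp
  qed
  have i0: "(\<psi> has_integral 0) {-R..R}"
    using test_function_integrable(2)[OF cont _ locally_integrable_continuous[of "\<lambda>_. 1 :: real"], of R] R zero
    by simp
  have "\<Phi> R - \<Phi> (-R) = 0"
    by (rule has_integral_unique[OF primitive_has_integral[OF \<Phi>] i0]) (use R in simp)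
  then have "\<phi> x = 0" if "\<bar>x\<bar> > R" for x
    using const[of R x] const[of x "-R"] that R by (cases "x \<ge> 0") (auto simp: \<phi>_def)
  moreover have "(deriv ^^ n) \<phi> differentiable (at x)" for n x
  proof (cases n)
    case 0
    then show ?thesis using D by (auto simp: real_differentiable_def)
  next
    case (Suc m)
    then have "(deriv ^^ n) \<phi> = (deriv ^^ m) \<psi>" by (simp add: funpow_swap1 deriv)
    then show ?thesis using \<psi> by (simp add: test_function_def)
  qed
  ultimately have "test_function \<phi>" unfolding test_function_def by blast
  with deriv show ?thesis by blast
qed

text \<open>Subtracting (I / J) times a fixed bump of integral J from a test function \<psi> of
  integral I leaves the derivative of a test function. Hence h acts on \<psi> like the constant c,
  the bump-weighted mean of h, and every test function annihilates h - c.\<close>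

lemma has_weak_derivative_0_imp_const:
  fixes h :: "real \<Rightarrow> 'a::euclidean_space"
  assumes loc: "locally_integrable h"
    and zero: "\<And>\<phi>. test_function \<phi> \<Longrightarrow> (LINT x|lebesgue. deriv \<phi> x *\<^sub>R h x) = 0"
  shows "\<exists>c. AE x in lebesgue. h x = c"
proof -
  have int: "integrable lebesgue (\<lambda>x. \<phi> x *\<^sub>R g x)"
    if \<phi>: "test_function \<phi>" and g: "locally_integrable g" for \<phi> and g :: "real \<Rightarrow> 'c::euclidean_space"
  proof -
    obtain R where R: "R > 0" "\<And>x. \<bar>x\<bar> \<ge> R \<Longrightarrow> \<phi> x = 0"
      using test_function_support[OF \<phi>] by blast
    show ?thesis
      by (rule test_function_integrable(1)[OF test_function_continuous[OF \<phi>] _ g, of R]) (simp add: R)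
  qed
  have one: "locally_integrable (\<lambda>_. c)" for c :: "'c::euclidean_space"
    by (rule locally_integrable_continuous) simp
  have int1: "integrable lebesgue \<phi>" if "test_function \<phi>" for \<phi>
    using int[OF that one[of "1 :: real"]] by simp
  define J where "J = (LINT x|lebesgue. bump 0 1 0 x)"
  \<comment> \<open>A continuous nonnegative bump of integral 0 would vanish identically, but this
    one is positive at 1/2.\<close>
  have "J \<noteq> 0"
  proof
    assume "J = 0"
    then have "AE x in lebesgue. bump 0 1 0 x = 0"
      unfolding J_def using integral_nonneg_eq_0_iff_AE[OF int1[OF test_function_bump]] bump_bounds(1) by blast
    moreover have "continuous_on UNIV (bump 0 1 0)" by (rule test_function_continuous[OF test_function_bump])
    ultimately have "bump 0 1 0 = (\<lambda>_. 0)" by (intro continuous_AE_eq) auto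
    then have "bump 0 1 0 (1/2) = 0" by (rule fun_cong)
    then show False by (simp add: bump_def flat_exp_def)
  qed
  define c where "c = (1 / J) *\<^sub>R (LINT x|lebesgue. bump 0 1 0 x *\<^sub>R h x)"
  have loc': "locally_integrable (\<lambda>x. h x - c)"
    using loc one[of c] unfolding locally_integrable_def by (intro allI set_integral_diff) blast+
  have "(LINT x|lebesgue. \<psi> x *\<^sub>R (h x - c)) = 0" if \<psi>: "test_function \<psi>" for \<psi>
  proof -
    define I where "I = (LINT x|lebesgue. \<psi> x)"
    have t: "test_function (\<lambda>x. \<psi> x + (- I / J) * bump 0 1 0 x)"
      by (intro test_function_add_scale \<psi> test_function_bump)
    have "(LINT x|lebesgue. \<psi> x + (- I / J) * bump 0 1 0 x) = I + (- I / J) * J"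
      unfolding I_def J_def
      by (simp only: Bochner_Integration.integral_add[OF int1[OF \<psi>] integrable_mult_right[OF int1[OF test_function_bump]]]
          integral_mult_right_zero)
    also have "\<dots> = 0" using \<open>J \<noteq> 0\<close> by simp
    finally obtain \<phi> where "test_function \<phi>" "deriv \<phi> = (\<lambda>x. \<psi> x + (- I / J) * bump 0 1 0 x)"
      using test_function_antiderivative[OF t] by auto
    then have "0 = (LINT x|lebesgue. (\<psi> x + (- I / J) * bump 0 1 0 x) *\<^sub>R h x)"
      using zero by metis
    also have "\<dots> = (LINT x|lebesgue. \<psi> x *\<^sub>R h x + (- I / J) *\<^sub>R (bump 0 1 0 x *\<^sub>R h x))"
      by (simp add: scaleR_left_diff_distrib)
    also have "\<dots> = (LINT x|lebesgue. \<psi> x *\<^sub>R h x) + (- I / J) *\<^sub>R (LINT x|lebesgue. bump 0 1 0 x *\<^sub>R h x)"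
      by (simp only: Bochner_Integration.integral_add[OF int[OF \<psi> loc]
            integrable_scaleR_right[OF int[OF test_function_bump loc]]] integral_scaleR_right)
    also have "\<dots> = (LINT x|lebesgue. \<psi> x *\<^sub>R h x) - I *\<^sub>R c"
      using \<open>J \<noteq> 0\<close> by (simp add: c_def)
    also have "\<dots> = (LINT x|lebesgue. \<psi> x *\<^sub>R (h x - c))"
      unfolding I_def scaleR_diff_right
      by (simp only: Bochner_Integration.integral_diff[OF int[OF \<psi> loc] int[OF \<psi> one]]
          integral_scaleR_left[OF int1[OF \<psi>]])
    finally show ?thesis by simp
  qed
  from du_bois_reymond[OF loc' this] show ?thesis by auto
qed

text \<open>Subtracting a primitive of g from f leaves a function with weak derivative 0, which is
  constant a.e.\<close>

lemma has_weak_derivative_imp_primitive: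
  fixes f g :: "real \<Rightarrow> 'a::euclidean_space"
  assumes fg: "has_weak_derivative f g"
  shows "\<exists>f0. primitive f0 g \<and> (AE x in lebesgue. f x = f0 x)"
proof -
  have loc: "locally_integrable f" "locally_integrable g" using fg by (auto simp: has_weak_derivative_def)
  obtain G where G: "primitive G g" using primitive_exists[OF loc(2)] by blast
  note wG = primitive_imp_has_weak_derivative[OF G]
  have locG: "locally_integrable G" by (rule primitive_locally_integrable[OF G])
  have "locally_integrable (\<lambda>x. f x - G x)"
    using loc(1) locG unfolding locally_integrable_def by (intro allI set_integral_diff) blast+
  moreover have "(LINT x|lebesgue. deriv \<phi> x *\<^sub>R (f x - G x)) = 0" if \<phi>: "test_function \<phi>" for \<phi>
  proof -
    obtain R where R: "R > 0" "\<And>x. \<bar>x\<bar> \<ge> R \<Longrightarrow> deriv \<phi> x = 0"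
      using test_function_support[OF \<phi>] by blast
    have "integrable lebesgue (\<lambda>x. deriv \<phi> x *\<^sub>R f x)" "integrable lebesgue (\<lambda>x. deriv \<phi> x *\<^sub>R G x)"
      using R(2) by (auto intro!: test_function_integrable(1)[of _ R] loc locG
          test_function_continuous test_function_deriv \<phi>)
    then show ?thesis
      using fg wG \<phi> by (simp add: scaleR_diff_right has_weak_derivative_def)
  qed
  ultimately obtain c where c: "AE x in lebesgue. f x - G x = c"
    using has_weak_derivative_0_imp_const by blast
  have "primitive (\<lambda>x. G x + c) (\<lambda>x. g x + 0)" by (intro primitive_add G primitive_const)
  moreover have "AE x in lebesgue. f x = G x + c"
    using c by eventually_elim (auto simp: algebra_simps)
  ultimately show ?thesis by auto
qed

lemma has_weak_derivative_unique:
  fixes f g :: "real \<Rightarrow> 'a::euclidean_space"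
  assumes "has_weak_derivative f g" "has_weak_derivative f g'"
  shows "AE x in lebesgue. g x = g' x"
proof -
  have loc: "locally_integrable g" "locally_integrable g'" using assms by (auto simp: has_weak_derivative_def)
  have "AE x in lebesgue. g x - g' x = 0"
  proof (rule du_bois_reymond)
    show "locally_integrable (\<lambda>x. g x - g' x)"
      using loc unfolding locally_integrable_def by (intro allI set_integral_diff) blast+
    fix \<phi> assume \<phi>: "test_function \<phi>"
    obtain R where R: "R > 0" "\<And>x. \<bar>x\<bar> \<ge> R \<Longrightarrow> \<phi> x = 0"
      using test_function_support[OF \<phi>] by blast
    have "integrable lebesgue (\<lambda>x. \<phi> x *\<^sub>R g x)" "integrable lebesgue (\<lambda>x. \<phi> x *\<^sub>R g' x)"
      using R(2) by (auto intro!: test_function_integrable(1)[of _ R] loc test_function_continuous \<phi>)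
    then show "(LINT x|lebesgue. \<phi> x *\<^sub>R (g x - g' x)) = 0"
      using assms \<phi> by (simp add: scaleR_diff_right has_weak_derivative_def)
  qed
  then show ?thesis by simp
qed

lemma AE_imp_negligible:
  assumes "AE x in lebesgue. P x"
  shows "\<exists>N. negligible N \<and> (\<forall>x. x \<notin> N \<longrightarrow> P x)"
proof -
  obtain N where "N \<in> null_sets lebesgue" "{x. \<not> P x} \<subseteq> N"
    using assms by (auto simp: eventually_ae_filter)
  then show ?thesis by (auto simp: negligible_iff_null_sets)
qed

lemma locally_integrable_cong_AE:
  fixes f g :: "real \<Rightarrow> 'a::euclidean_space"
  assumes "locally_integrable f" "AE x in lebesgue. f x = g x"
  shows "locally_integrable g"
proof -
  obtain N where "negligible N" "\<And>x. x \<notin> N \<Longrightarrow> f x = g x"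
    using AE_imp_negligible[OF assms(2)] by blast
  then show ?thesis
    using assms(1) absolutely_integrable_spike[where f = f and g = g and S = N] unfolding locally_integrable_def by (metis DiffD2)
qed

lemma has_weak_derivative_cong_AE:
  fixes f g :: "real \<Rightarrow> 'a::euclidean_space"
  assumes fg: "has_weak_derivative f g" and ae: "AE x in lebesgue. f x = f' x"
  shows "has_weak_derivative f' g"
  unfolding has_weak_derivative_def
proof (intro conjI allI impI)
  show loc: "locally_integrable f'"
    using fg locally_integrable_cong_AE[OF _ ae] by (simp add: has_weak_derivative_def)
  show "locally_integrable g" using fg by (simp add: has_weak_derivative_def)
  fix \<phi> assume \<phi>: "test_function \<phi>"
  obtain R where R: "R > 0" "\<And>x. \<bar>x\<bar> \<ge> R \<Longrightarrow> deriv \<phi> x = 0"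
    using test_function_support[OF \<phi>] by blast
  have "locally_integrable f" using fg by (simp add: has_weak_derivative_def)
  then have "integrable lebesgue (\<lambda>x. deriv \<phi> x *\<^sub>R f x)" "integrable lebesgue (\<lambda>x. deriv \<phi> x *\<^sub>R f' x)"
    using R(2) by (auto intro!: test_function_integrable(1)[of _ R] loc test_function_continuous
        test_function_deriv \<phi>)
  then have "(LINT x|lebesgue. deriv \<phi> x *\<^sub>R f' x) = (LINT x|lebesgue. deriv \<phi> x *\<^sub>R f x)"
    using ae by (intro integral_cong_AE) (auto elim!: eventually_mono)
  then show "(LINT x|lebesgue. deriv \<phi> x *\<^sub>R f' x) = - (LINT x|lebesgue. \<phi> x *\<^sub>R g x)"
    using fg \<phi> by (simp add: has_weak_derivative_def)
qed

lemma weak_deriv_AE_eq: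
  assumes "has_weak_derivative f g"
  shows "has_weak_derivative f (weak_deriv f)" "AE x in lebesgue. weak_deriv f x = g x"
proof -
  show 1: "has_weak_derivative f (weak_deriv f)"
    unfolding weak_deriv_def by (rule someI[of "has_weak_derivative f", OF assms])
  show "AE x in lebesgue. weak_deriv f x = g x"
    by (rule has_weak_derivative_unique[OF 1 assms])
qed


section \<open>Sobolev functions on the line\<close>


lemma L2_on_UNIV_iff:
  "L2_on UNIV f \<longleftrightarrow> f \<in> borel_measurable lebesgue \<and> integrable lebesgue (\<lambda>x. (norm (f x))\<^sup>2)"
  by (simp add: L2_on_def set_borel_measurable_def set_integrable_def)

lemma L2_cong_AE:
  assumes "L2_on UNIV f" "AE x in lebesgue. f x = g x"
  shows "L2_on UNIV g"
proof -
  have m: "f \<in> borel_measurable lebesgue" and i: "integrable lebesgue (\<lambda>x. (norm (f x))\<^sup>2)"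
    using assms(1) by (auto simp: L2_on_UNIV_iff)
  have m': "g \<in> borel_measurable lebesgue" by (rule borel_measurable_AE[OF m assms(2)])
  have "AE x in lebesgue. (norm (f x))\<^sup>2 = (norm (g x))\<^sup>2"
    using assms(2) by eventually_elim simp
  then have "integrable lebesgue (\<lambda>x. (norm (g x))\<^sup>2)"
    using m m' by (intro integrable_cong_AE_imp[OF i]) (auto intro!: borel_measurable_power borel_measurable_norm elim: eventually_mono)
  with m' show ?thesis by (simp add: L2_on_UNIV_iff)
qed

lemma L2_dominated:
  fixes f :: "real \<Rightarrow> 'a::euclidean_space" and g :: "real \<Rightarrow> 'b::euclidean_space"
  assumes f: "L2_on UNIV f" and m: "g \<in> borel_measurable lebesgue" and le: "\<And>x. norm (g x) \<le> C * norm (f x)"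
  shows "L2_on UNIV g"
  unfolding L2_on_UNIV_iff
proof
  have i: "integrable lebesgue (\<lambda>x. C\<^sup>2 * (norm (f x))\<^sup>2)"
    using f by (auto simp: L2_on_UNIV_iff)
  have "(norm (g x))\<^sup>2 \<le> C\<^sup>2 * (norm (f x))\<^sup>2" for x
    using power_mono[OF le[of x] norm_ge_zero, of 2] by (simp add: power_mult_distrib)
  then show "integrable lebesgue (\<lambda>x. (norm (g x))\<^sup>2)"
    using m by (intro Bochner_Integration.integrable_bound[OF i]) (auto intro!: borel_measurable_power borel_measurable_norm)
qed (rule m)

lemma L2_bounded_linear:
  fixes f :: "real \<Rightarrow> 'a::euclidean_space" and T :: "'a \<Rightarrow> 'b::euclidean_space"
  assumes f: "L2_on UNIV f" and T: "bounded_linear T"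
  shows "L2_on UNIV (\<lambda>x. T (f x))"
proof -
  obtain C where "\<And>x. norm (T x) \<le> C * norm x"
    using bounded_linear.bounded[OF T] by (metis mult.commute)
  moreover have "(\<lambda>x. T (f x)) \<in> borel_measurable lebesgue"
    using f T by (intro measurable_compose[of f _ borel T] borel_measurable_continuous_onI linear_continuous_on)
      (auto simp: L2_on_UNIV_iff)
  ultimately show ?thesis by (intro L2_dominated[OF f])
qed

lemma L2_inner_integrable:
  fixes f g :: "real \<Rightarrow> 'a::euclidean_space"
  assumes f: "L2_on UNIV f" and g: "L2_on UNIV g"
  shows "integrable lebesgue (\<lambda>x. f x \<bullet> g x)"
proof -
  have i: "integrable lebesgue (\<lambda>x. (norm (f x))\<^sup>2 + (norm (g x))\<^sup>2)"
    using f g by (auto simp: L2_on_UNIV_iff)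
  have le: "\<bar>f x \<bullet> g x\<bar> \<le> (norm (f x))\<^sup>2 + (norm (g x))\<^sup>2" for x
  proof -
    have "\<bar>f x \<bullet> g x\<bar> \<le> norm (f x) * norm (g x)" by (rule Cauchy_Schwarz_ineq2)
    also have "\<dots> \<le> (norm (f x))\<^sup>2 + (norm (g x))\<^sup>2"
      using sum_squares_bound[of "norm (f x)" "norm (g x)"] mult_nonneg_nonneg[OF norm_ge_zero norm_ge_zero, of "f x" "g x"]
      by linarith
    finally show ?thesis .
  qed
  have m: "(\<lambda>x. f x \<bullet> g x) \<in> borel_measurable lebesgue"
    using f g by (intro borel_measurable_inner) (simp_all add: L2_on_UNIV_iff)
  show ?thesis
  proof (rule Bochner_Integration.integrable_bound[OF i m], rule AE_I2)
    show "norm (f x \<bullet> g x) \<le> norm ((norm (f x))\<^sup>2 + (norm (g x))\<^sup>2)" for x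
      using le[of x] unfolding real_norm_def by linarith
  qed
qed

section \<open>Decay at infinity and integration by parts on the line\<close>

lemma integrable_not_bounded_below:
  fixes h :: "real \<Rightarrow> real"
  assumes h: "integrable lebesgue h" and "c > 0"
  shows "\<not> (\<forall>n::nat. \<exists>s. \<forall>y\<in>{s..s + real n}. c \<le> \<bar>h y\<bar>)"
proof
  assume *: "\<forall>n::nat. \<exists>s. \<forall>y\<in>{s..s + real n}. c \<le> \<bar>h y\<bar>"
  have "c * real n \<le> (LINT x|lebesgue. \<bar>h x\<bar>)" for n :: nat
  proof -
    obtain s where s: "\<And>y. y \<in> {s..s + real n} \<Longrightarrow> c \<le> \<bar>h y\<bar>" using * by blast
    have "c * real n = (LINT x|lebesgue. c * indicat_real {s..s + real n} x)"
      by simp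
    also have "\<dots> \<le> (LINT x|lebesgue. \<bar>h x\<bar>)"
    proof (rule integral_mono)
      show "integrable lebesgue (\<lambda>x. c * indicat_real {s..s + real n} x)"
        by (intro integrable_mult_right) (simp add: integrable_indicator_iff)
      show "integrable lebesgue (\<lambda>x. \<bar>h x\<bar>)" using h by simp
      show "c * indicat_real {s..s + real n} x \<le> \<bar>h x\<bar>" for x
        using s[of x] by (auto simp: indicator_def)
    qed
    finally show ?thesis .
  qed
  moreover obtain n :: nat where "(LINT x|lebesgue. \<bar>h x\<bar>) < c * real n"
    using reals_Archimedean3[OF \<open>c > 0\<close>] by (metis mult.commute)
  ultimately show False by (meson not_le)
qed

text \<open>Integrability of \<open>h'\<close> gives limits of \<open>h\<close> at both ends. A
  nonzero limit would keep |h| above a positive constant on arbitrarily long intervals, against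
  integrability of \<open>h\<close>. The integral of \<open>h'\<close> is the difference of the two
  limits.\<close>

lemma integrable_primitive_vanishes:
  fixes h h' :: "real \<Rightarrow> real"
  assumes p: "primitive h h'" and h: "integrable lebesgue h" and h': "integrable lebesgue h'"
  shows "(h \<longlongrightarrow> 0) at_top" "(h \<longlongrightarrow> 0) at_bot" "(LINT x|lebesgue. h' x) = 0"
proof -
  have set_int: "set_integrable lebesgue S h'" if "S \<in> sets lebesgue" for S
    unfolding set_integrable_def by (rule integrable_mult_indicator[OF that h'])
  have ftc: "(LINT x:{s..t}|lebesgue. h' x) = h t - h s" if "s \<le> t" for s t
    using set_lebesgue_integral_eq_integral(2)[OF primitive_abs_integrable[OF p]]
      integral_unique[OF primitive_has_integral[OF p that]] by metis
  define A where "A = (LINT x:{0..}|lebesgue. h' x)"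
  define B where "B = (LINT x:{..0}|lebesgue. h' x)"
  have "((\<lambda>y. h 0 + (LINT x:{0..y}|lebesgue. h' x)) \<longlongrightarrow> h 0 + A) at_top"
    unfolding A_def by (intro tendsto_intros tendsto_set_lebesgue_integral_at_top set_int) auto
  then have top: "(h \<longlongrightarrow> h 0 + A) at_top"
    by (rule Lim_transform_eventually) (auto simp: ftc intro: eventually_at_top_linorderI[of 0])
  have "((\<lambda>y. h 0 - (LINT x:{y..0}|lebesgue. h' x)) \<longlongrightarrow> h 0 - B) at_bot"
    unfolding B_def by (intro tendsto_intros tendsto_set_lebesgue_integral_at_bot set_int) auto
  then have bot: "(h \<longlongrightarrow> h 0 - B) at_bot"
    by (rule Lim_transform_eventually) (auto simp: ftc intro: eventually_at_bot_linorderI[of 0])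
  have half: "\<bar>L\<bar> / 2 \<le> \<bar>z\<bar>" if "dist z L < \<bar>L\<bar> / 2" for z L :: real
    using that unfolding dist_real_def by linarith
  have LT: "h 0 + A = 0"
  proof (rule ccontr)
    define L where "L = h 0 + A"
    assume "h 0 + A \<noteq> 0"
    then have "\<bar>L\<bar> / 2 > 0" by (simp add: L_def)
    then obtain M where M: "\<And>y. y \<ge> M \<Longrightarrow> dist (h y) L < \<bar>L\<bar> / 2"
      using tendstoD[OF top[folded L_def]] unfolding eventually_at_top_linorder by blast
    have "\<forall>n::nat. \<exists>s. \<forall>y\<in>{s..s + real n}. \<bar>L\<bar> / 2 \<le> \<bar>h y\<bar>"
      by (intro allI exI[of _ M] ballI half M) simp
    then show False using integrable_not_bounded_below[OF h \<open>\<bar>L\<bar> / 2 > 0\<close>] by blast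
  qed
  have LB: "h 0 - B = 0"
  proof (rule ccontr)
    define L where "L = h 0 - B"
    assume "h 0 - B \<noteq> 0"
    then have "\<bar>L\<bar> / 2 > 0" by (simp add: L_def)
    then obtain M where M: "\<And>y. y \<le> M \<Longrightarrow> dist (h y) L < \<bar>L\<bar> / 2"
      using tendstoD[OF bot[folded L_def]] unfolding eventually_at_bot_linorder by blast
    have "\<exists>s. \<forall>y\<in>{s..s + real n}. \<bar>L\<bar> / 2 \<le> \<bar>h y\<bar>" for n :: nat
      by (intro exI[of _ "M - real n"] ballI half M) simp
    then show False using integrable_not_bounded_below[OF h \<open>\<bar>L\<bar> / 2 > 0\<close>] by blast
  qed
  show "(h \<longlongrightarrow> 0) at_top" "(h \<longlongrightarrow> 0) at_bot" using top bot LT LB by simp_all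
  \<comment> \<open>\<open>B\<close> is taken over \<open>{..0}\<close>; removing the point 0 makes
    the two half-lines disjoint.\<close>
  have "B = (LINT x:{..<0}|lebesgue. h' x)"
  proof -
    have "AE x in lebesgue. x \<noteq> (0::real)" by (rule AE_completion) (rule AE_lborel_singleton)
    then show ?thesis
      unfolding B_def set_lebesgue_integral_def
      by (intro integral_cong_AE borel_measurable_integrable integrable_mult_indicator h')
        (auto elim!: eventually_mono simp: indicator_def)
  qed
  moreover have "(LINT x:{..<0} \<union> {0..}|lebesgue. h' x) = (LINT x:{..<0}|lebesgue. h' x) + A"
    unfolding A_def by (intro set_integral_Un set_int) auto
  moreover have "{..<0} \<union> {0..} = (UNIV :: real set)" by auto
  ultimately have "(LINT x:UNIV|lebesgue. h' x) = A + B" by simp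
  then show "(LINT x|lebesgue. h' x) = 0"
    using LT LB by (simp add: set_lebesgue_integral_def)
qed

text \<open>The decay lemma is applied to |f|^2, whose derivative 2 f \<bullet> f' is integrable as
  a product of L^2 functions.\<close>

lemma L2_primitive_vanishes:
  fixes f f' :: "real \<Rightarrow> 'a::euclidean_space"
  assumes "primitive f f'" "L2_on UNIV f" "L2_on UNIV f'"
  shows "(f \<longlongrightarrow> 0) at_top" "(f \<longlongrightarrow> 0) at_bot"
proof -
  note v = integrable_primitive_vanishes[OF primitive_inner[OF assms(1,1)] L2_inner_integrable[OF assms(2,2)]
      Bochner_Integration.integrable_add[OF L2_inner_integrable[OF assms(3,2)] L2_inner_integrable[OF assms(2,3)]]]
  have "((\<lambda>x. sqrt (f x \<bullet> f x)) \<longlongrightarrow> sqrt 0) at_top" "((\<lambda>x. sqrt (f x \<bullet> f x)) \<longlongrightarrow> sqrt 0) at_bot"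
    by (intro tendsto_real_sqrt v)+
  then show "(f \<longlongrightarrow> 0) at_top" "(f \<longlongrightarrow> 0) at_bot"
    by (simp_all add: tendsto_norm_zero_iff flip: norm_eq_sqrt_inner)
qed

lemma L2_integration_by_parts:
  fixes f f' g g' :: "real \<Rightarrow> 'a::euclidean_space"
  assumes "primitive f f'" "L2_on UNIV f" "L2_on UNIV f'" "primitive g g'" "L2_on UNIV g" "L2_on UNIV g'"
  shows "(LINT x|lebesgue. f' x \<bullet> g x) = - (LINT x|lebesgue. f x \<bullet> g' x)"
proof -
  note i = L2_inner_integrable[OF assms(3,5)] L2_inner_integrable[OF assms(2,6)]
  have "(LINT x|lebesgue. f' x \<bullet> g x + f x \<bullet> g' x) = 0"
    by (rule integrable_primitive_vanishes(3)[OF primitive_inner[OF assms(1,4)] L2_inner_integrable[OF assms(2,5)]])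
      (intro Bochner_Integration.integrable_add i)
  then show ?thesis using i by simp
qed

lemma locally_integrable_measurable:
  fixes f :: "real \<Rightarrow> 'a::euclidean_space"
  assumes "locally_integrable f"
  shows "f \<in> borel_measurable lebesgue"
proof (rule borel_measurable_LIMSEQ_metric)
  show "(\<lambda>x. indicat_real {- real n..real n} x *\<^sub>R f x) \<in> borel_measurable lebesgue" for n
    using assms borel_measurable_integrable unfolding locally_integrable_def set_integrable_def by blast
  fix x :: real
  obtain N :: nat where "\<bar>x\<bar> < real N" using reals_Archimedean2 by blast
  then have "\<forall>n\<ge>N. indicat_real {- real n..real n} x *\<^sub>R f x = f x"
    by (auto simp: indicator_def)
  then show "(\<lambda>n. indicat_real {- real n..real n} x *\<^sub>R f x) \<longlonglongrightarrow> f x"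
    by (intro tendsto_eventually) (auto simp: eventually_sequentially)
qed

lemma primitive_measurable:
  assumes "primitive f g" shows "f \<in> borel_measurable lebesgue" "g \<in> borel_measurable lebesgue"
  using primitive_locally_integrable[OF assms] by (auto intro: locally_integrable_measurable)

text \<open>\<open>f0\<close> and \<open>f1\<close> are the continuous representatives of f and of
  its weak derivative. Since \<open>weak_deriv\<close> is a choice, it agrees with the given
  derivatives only a.e., and uniqueness is applied at both levels.\<close>

lemma H2_representative:
  fixes f :: "real \<Rightarrow> 'a::euclidean_space"
  assumes "H2 f"
  shows "\<exists>f0 f1 f2. primitive f0 f1 \<and> primitive f1 f2 \<and> L2_on UNIV f0 \<and> L2_on UNIV f1 \<and> L2_on UNIV f2 \<and>
     (AE x in lebesgue. f x = f0 x) \<and> (AE x in lebesgue. weak_deriv (weak_deriv f) x = f2 x)"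
proof -
  obtain g h where f: "L2_on UNIV f" "has_weak_derivative f g" "L2_on UNIV g" "has_weak_derivative g h" "L2_on UNIV h"
    using assms unfolding H2_def by blast
  obtain f0 where f0: "primitive f0 g" "AE x in lebesgue. f x = f0 x"
    using has_weak_derivative_imp_primitive[OF f(2)] by blast
  obtain f1 where f1: "primitive f1 h" "AE x in lebesgue. g x = f1 x"
    using has_weak_derivative_imp_primitive[OF f(4)] by blast
  have "AE x in lebesgue. g x = weak_deriv f x"
    using weak_deriv_AE_eq(2)[OF f(2)] by eventually_elim simp
  then have "AE x in lebesgue. weak_deriv (weak_deriv f) x = h x"
    by (intro weak_deriv_AE_eq(2) has_weak_derivative_cong_AE[OF f(4)])
  moreover have "primitive f0 f1" by (rule primitive_cong_AE[OF f0(1) f1(2)])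
  ultimately show ?thesis
    using f0 f1 f L2_cong_AE by blast
qed


section \<open>The energy functional\<close>


definition sqv :: "real ^ 2 \<Rightarrow> real ^ 2" where
  "sqv v = vector [(v $ 1)\<^sup>2, (v $ 2)\<^sup>2]"

lemma sqv_nth [simp]: "sqv v $ 1 = (v $ 1)\<^sup>2" "sqv v $ 2 = (v $ 2)\<^sup>2"
  by (simp_all add: sqv_def)

lemma norm_vec2: "(norm (v :: real ^ 2))\<^sup>2 = (v $ 1)\<^sup>2 + (v $ 2)\<^sup>2"
  by (simp add: power2_norm_eq_inner inner_vec_def sum_2) (simp add: power2_eq_square)

lemma vec2_eq_axis: "vector [s, t] = s *\<^sub>R axis 1 1 + t *\<^sub>R (axis 2 1 :: real ^ 2)"
  by (simp add: vec_eq_iff forall_2 axis_def)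

lemma continuous_on_vec2:
  "continuous_on S f \<Longrightarrow> continuous_on S g \<Longrightarrow> continuous_on S (\<lambda>x. vector [f x, g x] :: real ^ 2)"
  unfolding vec2_eq_axis by (intro continuous_intros)

lemma continuous_on_sqv: "continuous_on S f \<Longrightarrow> continuous_on S (\<lambda>x. sqv (f x))"
  unfolding sqv_def by (intro continuous_on_vec2 continuous_intros)

lemma primitive_vec2:
  assumes "primitive f f'" "primitive g g'"
  shows "primitive (\<lambda>x. vector [f x, g x] :: real ^ 2) (\<lambda>x. vector [f' x, g' x])"
  unfolding vec2_eq_axis
  by (intro primitive_add primitive_bounded_linear[OF assms(1)] primitive_bounded_linear[OF assms(2)] bounded_linear_scaleR_left)

lemma bounded_linear_cvec: "bounded_linear cvec"
proof (rule linear_conv_bounded_linear[THEN iffD1])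
  show "linear cvec"
    by (rule linearI) (auto simp: cvec_def vec_eq_iff complex_eq_iff)
qed

lemma L2_on_subset:
  fixes f :: "real \<Rightarrow> 'a::euclidean_space"
  assumes "L2_on UNIV f" "S \<in> sets lebesgue" shows "L2_on S f"
proof -
  have m: "f \<in> borel_measurable lebesgue" and i: "integrable lebesgue (\<lambda>x. (norm (f x))\<^sup>2)"
    using assms(1) by (auto simp: L2_on_UNIV_iff)
  show ?thesis
    unfolding L2_on_def set_borel_measurable_def set_integrable_def
    using integrable_mult_indicator[OF assms(2) i] assms(2)
    by (auto intro!: borel_measurable_scaleR m)
qed

lemma L2_loc_continuous:
  fixes f :: "real \<Rightarrow> 'a::euclidean_space"
  assumes "continuous_on UNIV f" shows "L2_loc f"
  unfolding L2_loc_def L2_on_def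
proof (intro allI conjI)
  fix s t :: real
  have "f absolutely_integrable_on {s..t}" "(\<lambda>x. (norm (f x))\<^sup>2) absolutely_integrable_on {s..t}"
    by (intro absolutely_integrable_continuous_real continuous_intros continuous_on_subset[OF assms]; simp)+
  then show "set_borel_measurable lebesgue {s..t} f" "set_integrable lebesgue {s..t} (\<lambda>x. (norm (f x))\<^sup>2)"
    unfolding set_borel_measurable_def set_integrable_def by auto
qed

locale minimizer_setting =
  fixes W :: "complex ^ 2 \<Rightarrow> real" and F :: "real ^ 2 \<Rightarrow> real"
    and a b :: real and U :: "real \<Rightarrow> real ^ 2"
  assumes adm: "admissible_potential W F a b" and min: "minimizer_in_X W a b U"
begin

lemma W_cvec: "W (cvec v) = F (sqv v)"
proof -
  have "W (cvec v) = F (vector [(cmod (cvec v $ 1))\<^sup>2, (cmod (cvec v $ 2))\<^sup>2])"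
    using adm unfolding admissible_potential_def by blast
  then show ?thesis by (simp add: cvec_def sqv_def)
qed

lemma F_sqv_nonneg: "0 \<le> F (sqv v)"
  using adm unfolding admissible_potential_def W_cvec[symmetric] by blast

lemma C3: "C_k 3 F"
  using adm unfolding admissible_potential_def by blast

lemma F_continuous: "continuous_on S F"
  using C3 continuous_on_subset[of UNIV F S] by (simp add: numeral_3_eq_3)

lemma F_endpoints: "F (sqv (vector [a, 0])) = 0" "F (sqv (vector [0, b])) = 0"
proof -
  have "a > 0" "b > 0" and *: "\<And>\<Psi>. (cmod (\<Psi> $ 1), cmod (\<Psi> $ 2)) = (a, 0) \<or> (cmod (\<Psi> $ 1), cmod (\<Psi> $ 2)) = (0, b) \<Longrightarrow> W \<Psi> = 0"
    using adm unfolding admissible_potential_def by blast+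
  then show "F (sqv (vector [a, 0])) = 0" "F (sqv (vector [0, b])) = 0"
    unfolding W_cvec[symmetric] by (auto intro!: * simp: cvec_def)
qed

text \<open>Twice the energy density. The derivative is a separate argument because
  \<open>primitive\<close> determines it only up to a null set.\<close>

definition edens :: "(real \<Rightarrow> real ^ 2) \<Rightarrow> (real \<Rightarrow> real ^ 2) \<Rightarrow> real \<Rightarrow> real" where
  "edens V V' x = (norm (V' x))\<^sup>2 + F (sqv (V x))"

lemma edens_nonneg: "0 \<le> edens V V' x"
  by (simp add: edens_def F_sqv_nonneg)

lemma edens_measurable: "primitive V V' \<Longrightarrow> edens V V' \<in> borel_measurable lebesgue"
proof -
  assume V: "primitive V V'"
  have "continuous_on UNIV (\<lambda>x. F (sqv (V x)))"
    using continuous_on_compose2[OF F_continuous[of UNIV] continuous_on_sqv[OF primitive_continuous[OF V]]] by simp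
  then have "(\<lambda>x. F (sqv (V x))) \<in> borel_measurable lebesgue"
    by (intro measurable_completion) (simp add: borel_measurable_continuous_onI)
  then show ?thesis
    unfolding edens_def
    using primitive_measurable(2)[OF V] by measurable
qed

lemma energy_eq:
  assumes "primitive V V'"
  shows "energy W (cvec \<circ> V) = (\<integral>\<^sup>+x. ennreal (edens V V' x) \<partial>lebesgue) / 2"
proof -
  have "primitive (cvec \<circ> V) (\<lambda>x. cvec (V' x))"
    using primitive_bounded_linear[OF assms bounded_linear_cvec] by (simp add: o_def)
  then have "AE x in lebesgue. weak_deriv (cvec \<circ> V) x = cvec (V' x)"
    by (intro weak_deriv_AE_eq(2) primitive_imp_has_weak_derivative)
  then have "AE x in lebesgue. ennreal ((cmod (weak_deriv (cvec \<circ> V) x $ 1))\<^sup>2 + (cmod (weak_deriv (cvec \<circ> V) x $ 2))\<^sup>2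
      + W ((cvec \<circ> V) x)) = ennreal (edens V V' x)"
    by eventually_elim (simp add: edens_def W_cvec norm_vec2, simp add: cvec_def)
  then show ?thesis
    unfolding energy_def by (simp add: nn_integral_cong_AE)
qed

text \<open>Since \<open>F\<close> is nonnegative on squares, the energy density dominates |V'|^2,
  which puts \<open>V'\<close> in L^2.\<close>

lemma competitor_in_X:
  assumes V: "primitive V V'" and lim: "(V \<longlongrightarrow> vector [a, 0]) at_top" "(V \<longlongrightarrow> vector [0, b]) at_bot"
    and int: "integrable lebesgue (edens V V')"
  shows "V \<in> X a b"
proof -
  have "L2_on UNIV V'"
    unfolding L2_on_UNIV_iff
  proof
    show m: "V' \<in> borel_measurable lebesgue" by (rule primitive_measurable[OF V])
    show "integrable lebesgue (\<lambda>x. (norm (V' x))\<^sup>2)"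
    proof (rule Bochner_Integration.integrable_bound[OF int], goal_cases)
      case 1
      show ?case using m by measurable
      case 2
      show ?case using F_sqv_nonneg by (intro AE_I2) (simp add: edens_def)
    qed
  qed
  then have "L2_loc V'" unfolding L2_loc_def by (auto intro: L2_on_subset)
  then have "H1_loc V"
    unfolding H1_loc_def
    using L2_loc_continuous[OF primitive_continuous[OF V]] primitive_imp_has_weak_derivative[OF V] by blast
  then show ?thesis
    unfolding X_def using lim primitive_continuous[OF V] by simp
qed

lemma U_limits: "(U \<longlongrightarrow> vector [a, 0]) at_top" "(U \<longlongrightarrow> vector [0, b]) at_bot"
  and U_continuous: "continuous_on S U"
  using min continuous_on_subset[of UNIV U S] by (auto simp: minimizer_in_X_def X_def)

text \<open>The elements of \<open>X\<close> are continuous, so the primitive that agrees with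
  \<open>U\<close> a.e. is \<open>U\<close> itself.\<close>

lemma U_primitive_exists: "\<exists>U'. primitive U U'"
proof -
  obtain g where "has_weak_derivative U g"
    using min unfolding minimizer_in_X_def X_def H1_loc_def by blast
  then obtain f0 where f0: "primitive f0 g" "AE x in lebesgue. U x = f0 x"
    using has_weak_derivative_imp_primitive by blast
  have "U = f0" by (rule continuous_AE_eq[OF U_continuous primitive_continuous[OF f0(1)] f0(2)])
  with f0 show ?thesis by blast
qed

definition U' where "U' = (SOME g. primitive U g)"

lemma U_primitive: "primitive U U'"
  unfolding U'_def using U_primitive_exists by (rule someI_ex)

lemma energy_U_le: "V \<in> X a b \<Longrightarrow> energy W (cvec \<circ> U) \<le> energy W (cvec \<circ> V)"
  using min unfolding minimizer_in_X_def by (auto intro: INF_lower)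

lemma energy_integrable:
  assumes "primitive V V'" "integrable lebesgue (edens V V')"
  shows "energy W (cvec \<circ> V) = ennreal ((LINT x|lebesgue. edens V V' x) / 2)"
  using energy_eq[OF assms(1)] nn_integral_eq_integral[OF assms(2)] edens_nonneg
  by (simp add: ennreal_divide_numeral Bochner_Integration.integral_nonneg)

text \<open>Its purpose is to show that the minimizer has finite energy, so that energies can be
  subtracted. The path runs linearly from (0, b) to (a, 0) on \<open>{0..1}\<close> and rests at a
  zero of the potential elsewhere, so its density lives on \<open>{0..1}\<close>.\<close>

lemma finite_energy_competitor: "\<exists>V V'. primitive V V' \<and> V \<in> X a b \<and> integrable lebesgue (edens V V')"
proof -
  let ?i = "indicat_real {0..1::real}"
  have iabs: "?i absolutely_integrable_on {s..t}" for s t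
    unfolding set_integrable_def
    by (rule integrable_mult_indicator) (auto simp: integrable_indicator_iff)
  then obtain G where G: "primitive G ?i"
    using primitive_exists[of ?i] unfolding locally_integrable_def by blast
  \<comment> \<open>A primitive of the indicator of \<open>{0..1}\<close>: the ramp that is 0 up to
    0 and 1 from 1 on.\<close>
  define c where "c = (\<lambda>x. G x - G 0)"
  have c: "primitive c ?i"
    using primitive_add[OF G primitive_const[of "- G 0"]] by (simp add: c_def)
  have lo: "c x = 0" if "x \<le> 0" for x
  proof -
    have "(?i has_integral 0) {x..0}"
      by (rule has_integral_spike_finite[OF _ _ has_integral_0, of "{0}"]) auto
    from has_integral_unique[OF primitive_has_integral[OF G that] this] show ?thesis by (simp add: c_def)
  qed
  have "(?i has_integral 1) {0..1}"
    by (rule has_integral_eq[OF _ has_integral_const_real[of 1 0 1, simplified]]) auto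
  from has_integral_unique[OF primitive_has_integral[OF G] this] have one: "c 1 = 1" by (simp add: c_def)
  have hi: "c x = 1" if "x \<ge> 1" for x
  proof -
    have "(?i has_integral 0) {1..x}"
      by (rule has_integral_spike_finite[OF _ _ has_integral_0, of "{1}"]) auto
    from has_integral_unique[OF primitive_has_integral[OF G that] this] one show ?thesis by (simp add: c_def)
  qed
  define V where "V = (\<lambda>x. vector [a * c x, b * c x * (-1) + b] :: real ^ 2)"
  define V' where "V' = (\<lambda>x. vector [a * ?i x, b * ?i x * (-1) + 0] :: real ^ 2)"
  have V: "primitive V V'"
    unfolding V_def V'_def
    by (intro primitive_vec2 primitive_add primitive_const primitive_bounded_linear[OF c]
        bounded_linear_mult_right bounded_linear_mult_const)
  have cont: "continuous_on {0..1} (\<lambda>x. a\<^sup>2 + b\<^sup>2 + F (sqv (V x)))"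
    using continuous_on_compose2[OF F_continuous[of UNIV] continuous_on_sqv[OF primitive_continuous[OF V]]]
    by (intro continuous_intros) (auto intro: continuous_on_subset)
  have "edens V V' x = ?i x *\<^sub>R (a\<^sup>2 + b\<^sup>2 + F (sqv (V x)))" for x
  proof (cases "x \<in> {0..1}")
    case True
    then show ?thesis by (simp add: edens_def norm_vec2 V'_def)
  next
    case False
    then have "V x = vector [a, 0] \<or> V x = vector [0, b]"
      using lo[of x] hi[of x] by (auto simp: V_def)
    then show ?thesis using False F_endpoints by (auto simp: edens_def norm_vec2 V'_def)
  qed
  then have int: "integrable lebesgue (edens V V')"
    using absolutely_integrable_continuous_real[OF cont] unfolding set_integrable_def by presburger
  have "V \<in> X a b"
  proof (rule competitor_in_X[OF V _ _ int])
    show "(V \<longlongrightarrow> vector [a, 0]) at_top"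
      by (rule tendsto_eventually) (auto simp: V_def hi eventually_at_top_linorder intro!: exI[of _ 1])
    show "(V \<longlongrightarrow> vector [0, b]) at_bot"
      by (rule tendsto_eventually) (auto simp: V_def lo eventually_at_bot_linorder intro!: exI[of _ 0])
  qed
  with V int show ?thesis by blast
qed

lemma edens_U_integrable: "integrable lebesgue (edens U U')"
proof -
  obtain V V' where V: "primitive V V'" "V \<in> X a b" "integrable lebesgue (edens V V')"
    using finite_energy_competitor by blast
  have "(\<integral>\<^sup>+x. ennreal (edens U U' x) \<partial>lebesgue) / 2 < \<infinity>"
    using energy_U_le[OF V(2)] unfolding energy_eq[OF U_primitive] energy_integrable[OF V(1,3)]
    by (simp add: order.strict_trans1)
  then have "(\<integral>\<^sup>+x. ennreal (edens U U' x) \<partial>lebesgue) < \<infinity>"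
    by (metis ennreal_top_divide infinity_ennreal_def less_top top_neq_numeral ennreal_numeral_less_top)
  then show ?thesis
    by (intro integrableI_nonneg edens_measurable U_primitive AE_I2 edens_nonneg)
qed

lemma U_minimal:
  assumes "primitive V V'" "(V \<longlongrightarrow> vector [a, 0]) at_top" "(V \<longlongrightarrow> vector [0, b]) at_bot"
    "integrable lebesgue (edens V V')"
  shows "(LINT x|lebesgue. edens U U' x) \<le> (LINT x|lebesgue. edens V V' x)"
proof -
  have "ennreal ((LINT x|lebesgue. edens U U' x) / 2) \<le> ennreal ((LINT x|lebesgue. edens V V' x) / 2)"
    using energy_U_le[OF competitor_in_X[OF assms]]
    unfolding energy_integrable[OF U_primitive edens_U_integrable] energy_integrable[OF assms(1,4)] .
  moreover have "0 \<le> (LINT x|lebesgue. edens V V' x)"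
    by (intro Bochner_Integration.integral_nonneg edens_nonneg)
  ultimately show ?thesis by simp
qed

end


section \<open>Regularised norms and Taylor expansions\<close>


text \<open>The norm is regularised to \<open>sqrt (\<delta>\<^sup>2 + |p|\<^sup>2)\<close>, which is differentiable; the value \<open>x / 0 = 0\<close> is the
  pointwise limit of the derivatives where \<open>w\<close> vanishes.\<close>

lemma primitive_norm:
  fixes w w' :: "real \<Rightarrow> 'a::euclidean_space"
  assumes w: "primitive w w'"
  shows "primitive (\<lambda>x. norm (w x)) (\<lambda>x. (w x \<bullet> w' x) / norm (w x))"
proof -
  define d where "d = (\<lambda>k. (inverse (real (Suc k)))\<^sup>2)"
  have d: "d k > 0" for k by (simp add: d_def)
  have pos: "d k + p \<bullet> p > 0" for k and p :: 'a
    using d[of k] inner_ge_zero[of p] by linarith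
  have lim: "d \<longlonglongrightarrow> 0"
    unfolding d_def using tendsto_power[OF LIMSEQ_inverse_real_of_nat, of 2] by simp
  have P: "primitive (\<lambda>x. sqrt (d k + w x \<bullet> w x)) (\<lambda>x. (w x /\<^sub>R sqrt (d k + w x \<bullet> w x)) \<bullet> w' x)" for k
  proof (rule primitive_compose[OF w])
    show "((\<lambda>p. sqrt (d k + p \<bullet> p)) has_derivative (\<lambda>h. (p /\<^sub>R sqrt (d k + p \<bullet> p)) \<bullet> h)) (at p)" for p :: 'a
      using pos[of k p] by (auto intro!: derivative_eq_intros simp: inner_commute field_simps)
    show "continuous_on UNIV (\<lambda>p::'a. p /\<^sub>R sqrt (d k + p \<bullet> p))"
      using pos[of k] by (intro continuous_intros) (auto simp: less_imp_neq[THEN not_sym])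
  qed
  have bound: "norm ((w x /\<^sub>R sqrt (d k + w x \<bullet> w x)) \<bullet> w' x) \<le> norm (w' x)" for k x
  proof -
    have "norm (w x) \<le> sqrt (d k + w x \<bullet> w x)"
      unfolding norm_eq_sqrt_inner using d[of k] by simp
    then have "norm (w x /\<^sub>R sqrt (d k + w x \<bullet> w x)) \<le> 1"
      using pos[of k "w x"] by (simp add: field_simps)
    then show ?thesis
      using Cauchy_Schwarz_ineq2[of "w x /\<^sub>R sqrt (d k + w x \<bullet> w x)" "w' x"]
        mult_right_mono[of "norm (w x /\<^sub>R sqrt (d k + w x \<bullet> w x))" 1 "norm (w' x)"] by simp
  qed
  have conv: "(\<lambda>k. (w x /\<^sub>R sqrt (d k + w x \<bullet> w x)) \<bullet> w' x) \<longlonglongrightarrow> (w x \<bullet> w' x) / norm (w x)" for x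
  proof (cases "w x = 0")
    case False
    have "(\<lambda>k. (w x /\<^sub>R sqrt (d k + w x \<bullet> w x)) \<bullet> w' x) \<longlonglongrightarrow> (w x /\<^sub>R sqrt (0 + w x \<bullet> w x)) \<bullet> w' x"
      using False by (intro tendsto_intros lim) auto
    then show ?thesis by (simp add: norm_eq_sqrt_inner divide_inverse mult.commute)
  qed simp
  show ?thesis
    unfolding primitive_def
  proof (intro allI impI conjI)
    fix s t :: real assume "s \<le> t"
    have nint: "(\<lambda>x. norm (w' x)) integrable_on {s..t}"
      using primitive_abs_integrable[OF w] by (simp add: absolutely_integrable_on_def)
    show hi: "((\<lambda>x. (w x \<bullet> w' x) / norm (w x)) has_integral (norm (w t) - norm (w s))) {s..t}"
    proof (rule has_integral_dominated_convergence[OF primitive_has_integral[OF P \<open>s \<le> t\<close>] nint])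
      have "(\<lambda>k. sqrt (d k + w t \<bullet> w t) - sqrt (d k + w s \<bullet> w s)) \<longlonglongrightarrow> sqrt (0 + w t \<bullet> w t) - sqrt (0 + w s \<bullet> w s)"
        by (intro tendsto_intros lim)
      then show "(\<lambda>k. sqrt (d k + w t \<bullet> w t) - sqrt (d k + w s \<bullet> w s)) \<longlonglongrightarrow> norm (w t) - norm (w s)"
        by (simp add: norm_eq_sqrt_inner)
    qed (use bound conv in auto)
    show "(\<lambda>x. (w x \<bullet> w' x) / norm (w x)) absolutely_integrable_on {s..t}"
    proof (rule absolutely_integrable_integrable_bound[OF _ _ nint])
      show "norm ((w x \<bullet> w' x) / norm (w x)) \<le> norm (w' x)" for x
        by (rule LIMSEQ_le_const2[OF tendsto_norm[OF conv]]) (use bound in auto)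
    qed (use hi in blast)
  qed
qed

lemma bounded_range_of_limits:
  fixes f :: "real \<Rightarrow> 'a::euclidean_space"
  assumes cont: "continuous_on UNIV f" and lim: "(f \<longlongrightarrow> l) at_top" "(f \<longlongrightarrow> m) at_bot"
  shows "\<exists>M>0. \<forall>x. norm (f x) \<le> M"
proof -
  obtain R where R: "\<And>x. x \<ge> R \<Longrightarrow> dist (f x) l < 1"
    using tendstoD[OF lim(1), of 1] unfolding eventually_at_top_linorder by auto
  obtain S where S: "\<And>x. x \<le> S \<Longrightarrow> dist (f x) m < 1"
    using tendstoD[OF lim(2), of 1] unfolding eventually_at_bot_linorder by auto
  have "bounded (f ` {S..R})"
    by (intro compact_imp_bounded compact_continuous_image continuous_on_subset[OF cont]) auto
  then have "bounded (f ` {S..R} \<union> ball l 1 \<union> ball m 1)" by simp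
  moreover have "range f \<subseteq> f ` {S..R} \<union> ball l 1 \<union> ball m 1"
  proof safe
    fix x assume "f x \<notin> ball m 1" "f x \<notin> ball l 1"
    then have "S < x" "x < R" using R[of x] S[of x] by (force simp: dist_commute)+
    then show "f x \<in> f ` {S..R}" by simp
  qed
  ultimately have "bounded (range f)" by (rule bounded_subset)
  then show ?thesis unfolding bounded_pos by auto
qed

text \<open>Uniform continuity on the ball of radius \<open>M + 1\<close>: q may leave the ball of
  radius \<open>M\<close> by less than 1, hence \<open>min d 1\<close>.\<close>

lemma uniform_near_ball:
  fixes f :: "'a::euclidean_space \<Rightarrow> real"
  assumes "continuous_on UNIV f" "\<eta> > 0"
  shows "\<exists>\<delta>>0. \<forall>p\<in>cball 0 M. \<forall>q. dist q p < \<delta> \<longrightarrow> \<bar>f q - f p\<bar> \<le> \<eta>"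
proof -
  have "uniformly_continuous_on (cball 0 (M + 1)) f"
    by (intro compact_uniformly_continuous continuous_on_subset[OF assms(1)]) auto
  then obtain d where d: "d > 0" "\<And>p q. p \<in> cball 0 (M + 1) \<Longrightarrow> q \<in> cball 0 (M + 1) \<Longrightarrow> dist q p < d \<Longrightarrow> dist (f q) (f p) < \<eta>"
    using \<open>\<eta> > 0\<close> unfolding uniformly_continuous_on_def by metis
  have "\<bar>f q - f p\<bar> \<le> \<eta>" if "p \<in> cball 0 M" "dist q p < min d 1" for p q
  proof -
    have "norm q \<le> norm p + dist q p" by (metis dist_norm norm_triangle_sub add.commute)
    then have "q \<in> cball 0 (M + 1)" "p \<in> cball 0 (M + 1)" using that by auto
    then show ?thesis using d(2)[of p q] that by (simp add: dist_real_def)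
  qed
  then show ?thesis using d(1) by (intro exI[of _ "min d 1"]) auto
qed

section \<open>Taylor expansions with remainders uniform on balls\<close>

lemma C_k_continuous: "C_k k f \<Longrightarrow> continuous_on UNIV f"
  by (cases k) auto

lemma C_k_partial: "C_k (Suc k) f \<Longrightarrow> C_k k (partial i f)"
  by simp

lemma DERIV_partial:
  assumes "C_k (Suc k) f"
  shows "((\<lambda>t. f (p + t *\<^sub>R axis i 1)) has_real_derivative partial i f (p + t *\<^sub>R axis i 1)) (at t)"
proof -
  define q where "q = p + t *\<^sub>R axis i 1"
  have "((\<lambda>s. f (q + s *\<^sub>R axis i 1)) has_real_derivative partial i f q) (at 0)"
    unfolding partial_def by (rule differentiable_DERIV) (use assms in simp)
  moreover have "((\<lambda>s. f (q + s *\<^sub>R axis i 1)) has_real_derivative D) (at 0) \<longleftrightarrow>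
      ((\<lambda>s. f (p + s *\<^sub>R axis i 1)) has_real_derivative D) (at t)" for D
    using DERIV_shift[of "\<lambda>s. f (p + s *\<^sub>R axis i 1)" D 0 t] by (simp add: q_def algebra_simps)
  ultimately show ?thesis by (simp add: q_def)
qed

lemma taylor1_axis:
  assumes "C_k (Suc k) f"
  shows "\<exists>s. \<bar>s\<bar> \<le> \<bar>h\<bar> \<and> f (p + h *\<^sub>R axis i 1) = f p + h * partial i f (p + s *\<^sub>R axis i 1)"
proof -
  define D where "D = (\<lambda>m::nat. if m = 0 then (\<lambda>t. f (p + t *\<^sub>R axis i 1)) else (\<lambda>t. partial i f (p + t *\<^sub>R axis i 1)))"
  have "\<exists>t. \<bar>t\<bar> \<le> \<bar>h\<bar> \<and> f (p + h *\<^sub>R axis i 1) = (\<Sum>m<1. D m 0 / fact m * h ^ m) + D 1 t / fact 1 * h ^ 1"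
    by (rule Maclaurin_bi_le) (use DERIV_partial[OF assms] in \<open>auto simp: D_def\<close>)
  then show ?thesis by (auto simp: D_def mult.commute)
qed

lemma taylor2_axis:
  assumes "C_k (Suc (Suc k)) f"
  shows "\<exists>s. \<bar>s\<bar> \<le> \<bar>h\<bar> \<and> f (p + h *\<^sub>R axis i 1) = f p + h * partial i f p
      + h\<^sup>2 / 2 * partial i (partial i f) (p + s *\<^sub>R axis i 1)"
proof -
  define D where "D = (\<lambda>m::nat. if m = 0 then (\<lambda>t. f (p + t *\<^sub>R axis i 1)) else
     if m = 1 then (\<lambda>t. partial i f (p + t *\<^sub>R axis i 1)) else (\<lambda>t. partial i (partial i f) (p + t *\<^sub>R axis i 1)))"
  have "\<exists>t. \<bar>t\<bar> \<le> \<bar>h\<bar> \<and> f (p + h *\<^sub>R axis i 1) = (\<Sum>m<2. D m 0 / fact m * h ^ m) + D 2 t / fact 2 * h ^ 2"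
    by (rule Maclaurin_bi_le)
      (use DERIV_partial[OF assms] DERIV_partial[OF C_k_partial[OF assms]] in \<open>auto simp: D_def less_2_cases_iff\<close>)
  then show ?thesis by (auto simp: D_def mult.commute numeral_2_eq_2)
qed

lemma vec2_decompose: "(h :: real ^ 2) = (h $ 1) *\<^sub>R axis 1 1 + (h $ 2) *\<^sub>R axis 2 1"
  by (simp add: vec_eq_iff forall_2 axis_def)

text \<open>Keeps the intermediate points of the axis-wise Taylor formulas within the radius of
  uniform continuity.\<close>

lemma dist_axis_path:
  fixes p h :: "real ^ 2"
  assumes "\<bar>s\<bar> \<le> \<bar>h $ 1\<bar>" "\<bar>t\<bar> \<le> \<bar>h $ 2\<bar>"
  shows "dist (p + s *\<^sub>R axis 1 1 + t *\<^sub>R axis 2 1) p \<le> \<bar>h $ 1\<bar> + \<bar>h $ 2\<bar>"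
proof -
  have "dist (p + s *\<^sub>R axis 1 1 + t *\<^sub>R axis 2 1) p = norm (s *\<^sub>R axis 1 1 + t *\<^sub>R axis 2 1 :: real ^ 2)"
    by (simp add: dist_norm algebra_simps)
  also have "\<dots> \<le> \<bar>s\<bar> + \<bar>t\<bar>"
    using norm_triangle_ineq[of "s *\<^sub>R axis 1 1 :: real ^ 2" "t *\<^sub>R axis 2 1"] by (simp add: norm_axis_1)
  finally show ?thesis using assms by linarith
qed

text \<open>Along one axis after the other, the mean value theorem evaluates a partial derivative at
  a nearby point, where it is within \<eta> of its value at p. The radius is the same for all p in
  the ball, which makes the remainder uniform along \<open>U\<close>.\<close>

lemma first_order_expansion:
  fixes f :: "real ^ 2 \<Rightarrow> real"
  assumes f: "C_k (Suc 0) f" and "\<eta> > 0"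
  shows "\<exists>\<delta>>0. \<forall>p\<in>cball 0 M. \<forall>h. \<bar>h $ 1\<bar> + \<bar>h $ 2\<bar> < \<delta> \<longrightarrow>
    \<bar>f (p + h) - f p - (partial 1 f p * h $ 1 + partial 2 f p * h $ 2)\<bar> \<le> \<eta> * (\<bar>h $ 1\<bar> + \<bar>h $ 2\<bar>)"
proof -
  have cont: "continuous_on UNIV (partial i f)" for i
    by (rule C_k_continuous[OF C_k_partial[OF f]])
  obtain d1 where d1: "d1 > 0" "\<And>p q. p \<in> cball 0 M \<Longrightarrow> dist q p < d1 \<Longrightarrow> \<bar>partial 1 f q - partial 1 f p\<bar> \<le> \<eta>"
    using uniform_near_ball[OF cont \<open>\<eta> > 0\<close>] by metis
  obtain d2 where d2: "d2 > 0" "\<And>p q. p \<in> cball 0 M \<Longrightarrow> dist q p < d2 \<Longrightarrow> \<bar>partial 2 f q - partial 2 f p\<bar> \<le> \<eta>"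
    using uniform_near_ball[OF cont \<open>\<eta> > 0\<close>] by metis
  have "\<bar>f (p + h) - f p - (partial 1 f p * h $ 1 + partial 2 f p * h $ 2)\<bar> \<le> \<eta> * (\<bar>h $ 1\<bar> + \<bar>h $ 2\<bar>)"
    if p: "p \<in> cball 0 M" and h: "\<bar>h $ 1\<bar> + \<bar>h $ 2\<bar> < min d1 d2" for p h
  proof -
    obtain s where s: "\<bar>s\<bar> \<le> \<bar>h $ 1\<bar>" "f (p + h $ 1 *\<^sub>R axis 1 1) = f p + h $ 1 * partial 1 f (p + s *\<^sub>R axis 1 1)"
      using taylor1_axis[OF f] by blast
    obtain t where t: "\<bar>t\<bar> \<le> \<bar>h $ 2\<bar>" "f ((p + h $ 1 *\<^sub>R axis 1 1) + h $ 2 *\<^sub>R axis 2 1)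
        = f (p + h $ 1 *\<^sub>R axis 1 1) + h $ 2 * partial 2 f ((p + h $ 1 *\<^sub>R axis 1 1) + t *\<^sub>R axis 2 1)"
      using taylor1_axis[OF f] by blast
    have ph: "(p + h $ 1 *\<^sub>R axis 1 1) + h $ 2 *\<^sub>R axis 2 1 = p + h"
      using vec2_decompose[of h] by (simp add: add.assoc)
    have e1: "\<bar>partial 1 f (p + s *\<^sub>R axis 1 1) - partial 1 f p\<bar> \<le> \<eta>"
      using dist_axis_path[OF s(1), of 0 p] h by (intro d1(2) p) simp
    have e2: "\<bar>partial 2 f (p + h $ 1 *\<^sub>R axis 1 1 + t *\<^sub>R axis 2 1) - partial 2 f p\<bar> \<le> \<eta>"
      using dist_axis_path[OF order_refl t(1), of p] h by (intro d2(2) p) linarith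
    have "f (p + h) - f p - (partial 1 f p * h $ 1 + partial 2 f p * h $ 2) =
       (partial 1 f (p + s *\<^sub>R axis 1 1) - partial 1 f p) * h $ 1
       + (partial 2 f (p + h $ 1 *\<^sub>R axis 1 1 + t *\<^sub>R axis 2 1) - partial 2 f p) * h $ 2"
      using s(2) t(2) unfolding ph by (simp add: algebra_simps)
    also have "\<bar>\<dots>\<bar> \<le> \<eta> * \<bar>h $ 1\<bar> + \<eta> * \<bar>h $ 2\<bar>"
      using mult_right_mono[OF e1, of "\<bar>h $ 1\<bar>"] mult_right_mono[OF e2, of "\<bar>h $ 2\<bar>"]
      by (intro order_trans[OF abs_triangle_ineq]) (simp add: abs_mult)
    finally show ?thesis by (simp add: distrib_left)
  qed
  then show ?thesis using d1(1) d2(1) by (intro exI[of _ "min d1 d2"]) auto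
qed

text \<open>Expanding along the first axis and then along the second produces the mixed derivative in one
  order only, so that its symmetry is not needed.\<close>

lemma second_order_expansion:
  fixes f :: "real ^ 2 \<Rightarrow> real"
  assumes f: "C_k (Suc (Suc 0)) f" and "\<eta> > 0"
  shows "\<exists>\<delta>>0. \<forall>p\<in>cball 0 M. \<forall>h. \<bar>h $ 1\<bar> + \<bar>h $ 2\<bar> < \<delta> \<longrightarrow>
    \<bar>f (p + h) - f p - (partial 1 f p * h $ 1 + partial 2 f p * h $ 2)
      - (partial 1 (partial 1 f) p * (h $ 1)\<^sup>2 / 2 + partial 1 (partial 2 f) p * (h $ 1 * h $ 2)
         + partial 2 (partial 2 f) p * (h $ 2)\<^sup>2 / 2)\<bar> \<le> \<eta> * (\<bar>h $ 1\<bar> + \<bar>h $ 2\<bar>)\<^sup>2"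
proof -
  have cont: "continuous_on UNIV (partial i (partial j f))" for i j
    by (rule C_k_continuous[OF C_k_partial[OF C_k_partial[OF f]]])
  obtain d1 where d1: "d1 > 0" "\<And>p q. p \<in> cball 0 M \<Longrightarrow> dist q p < d1 \<Longrightarrow> \<bar>partial 1 (partial 1 f) q - partial 1 (partial 1 f) p\<bar> \<le> \<eta>"
    using uniform_near_ball[OF cont \<open>\<eta> > 0\<close>] by metis
  obtain d2 where d2: "d2 > 0" "\<And>p q. p \<in> cball 0 M \<Longrightarrow> dist q p < d2 \<Longrightarrow> \<bar>partial 2 (partial 2 f) q - partial 2 (partial 2 f) p\<bar> \<le> \<eta>"
    using uniform_near_ball[OF cont \<open>\<eta> > 0\<close>] by metis
  obtain d3 where d3: "d3 > 0" "\<And>p q. p \<in> cball 0 M \<Longrightarrow> dist q p < d3 \<Longrightarrow> \<bar>partial 1 (partial 2 f) q - partial 1 (partial 2 f) p\<bar> \<le> \<eta>"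
    using uniform_near_ball[OF cont \<open>\<eta> > 0\<close>] by metis
  have "\<bar>f (p + h) - f p - (partial 1 f p * h $ 1 + partial 2 f p * h $ 2)
      - (partial 1 (partial 1 f) p * (h $ 1)\<^sup>2 / 2 + partial 1 (partial 2 f) p * (h $ 1 * h $ 2)
         + partial 2 (partial 2 f) p * (h $ 2)\<^sup>2 / 2)\<bar> \<le> \<eta> * (\<bar>h $ 1\<bar> + \<bar>h $ 2\<bar>)\<^sup>2"
    if p: "p \<in> cball 0 M" and h: "\<bar>h $ 1\<bar> + \<bar>h $ 2\<bar> < min (min d1 d2) d3" for p h
  proof -
    let ?p1 = "p + h $ 1 *\<^sub>R axis 1 1"
    obtain s where s: "\<bar>s\<bar> \<le> \<bar>h $ 1\<bar>" "f ?p1 = f p + h $ 1 * partial 1 f p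
        + (h $ 1)\<^sup>2 / 2 * partial 1 (partial 1 f) (p + s *\<^sub>R axis 1 1)"
      using taylor2_axis[OF f] by blast
    obtain t where t: "\<bar>t\<bar> \<le> \<bar>h $ 2\<bar>" "f (?p1 + h $ 2 *\<^sub>R axis 2 1) = f ?p1 + h $ 2 * partial 2 f ?p1
        + (h $ 2)\<^sup>2 / 2 * partial 2 (partial 2 f) (?p1 + t *\<^sub>R axis 2 1)"
      using taylor2_axis[OF f] by blast
    obtain r where r: "\<bar>r\<bar> \<le> \<bar>h $ 1\<bar>" "partial 2 f ?p1 = partial 2 f p + h $ 1 * partial 1 (partial 2 f) (p + r *\<^sub>R axis 1 1)"
      using taylor1_axis[OF C_k_partial[OF f]] by blast
    have ph: "?p1 + h $ 2 *\<^sub>R axis 2 1 = p + h"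
      using vec2_decompose[of h] by (simp add: add.assoc)
    define E1 where "E1 = partial 1 (partial 1 f) (p + s *\<^sub>R axis 1 1) - partial 1 (partial 1 f) p"
    define E2 where "E2 = partial 2 (partial 2 f) (?p1 + t *\<^sub>R axis 2 1) - partial 2 (partial 2 f) p"
    define E3 where "E3 = partial 1 (partial 2 f) (p + r *\<^sub>R axis 1 1) - partial 1 (partial 2 f) p"
    have e1: "\<bar>E1\<bar> \<le> \<eta>"
      unfolding E1_def using dist_axis_path[OF s(1), of 0 p] h by (intro d1(2) p) simp
    have e2: "\<bar>E2\<bar> \<le> \<eta>"
      unfolding E2_def using dist_axis_path[OF order_refl t(1), of p] h by (intro d2(2) p) linarith
    have e3: "\<bar>E3\<bar> \<le> \<eta>"
      unfolding E3_def using dist_axis_path[OF r(1), of 0 p] h by (intro d3(2) p) simp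
    have "f (p + h) - f p - (partial 1 f p * h $ 1 + partial 2 f p * h $ 2)
      - (partial 1 (partial 1 f) p * (h $ 1)\<^sup>2 / 2 + partial 1 (partial 2 f) p * (h $ 1 * h $ 2)
         + partial 2 (partial 2 f) p * (h $ 2)\<^sup>2 / 2) = E1 * ((h $ 1)\<^sup>2 / 2) + E2 * ((h $ 2)\<^sup>2 / 2) + E3 * (h $ 1 * h $ 2)"
      using s(2) t(2) r(2) unfolding ph E1_def E2_def E3_def by (simp add: algebra_simps)
    also have "\<bar>\<dots>\<bar> \<le> \<bar>E1 * ((h $ 1)\<^sup>2 / 2)\<bar> + \<bar>E2 * ((h $ 2)\<^sup>2 / 2)\<bar> + \<bar>E3 * (h $ 1 * h $ 2)\<bar>"
      by linarith
    also have "\<dots> = \<bar>E1\<bar> * ((h $ 1)\<^sup>2 / 2) + \<bar>E2\<bar> * ((h $ 2)\<^sup>2 / 2) + \<bar>E3\<bar> * (\<bar>h $ 1\<bar> * \<bar>h $ 2\<bar>)"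
      by (simp add: abs_mult)
    also have "\<dots> \<le> \<eta> * ((h $ 1)\<^sup>2 / 2) + \<eta> * ((h $ 2)\<^sup>2 / 2) + \<eta> * (\<bar>h $ 1\<bar> * \<bar>h $ 2\<bar>)"
      using e1 e2 e3 by (intro add_mono mult_right_mono) auto
    also have "\<dots> = \<eta> * (\<bar>h $ 1\<bar> + \<bar>h $ 2\<bar>)\<^sup>2 / 2"
      by (simp add: power2_sum field_simps)
    also have "\<dots> \<le> \<eta> * (\<bar>h $ 1\<bar> + \<bar>h $ 2\<bar>)\<^sup>2"
      using \<open>\<eta> > 0\<close> by simp
    finally show ?thesis .
  qed
  then show ?thesis using d1(1) d2(1) d3(1) by (intro exI[of _ "min (min d1 d2) d3"]) auto
qed


section \<open>Second variation of the energy\<close>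


definition bounded_coeff :: "(real \<Rightarrow> real) \<Rightarrow> bool" where
  "bounded_coeff q \<longleftrightarrow> continuous_on UNIV q \<and> (\<exists>B. \<forall>x. \<bar>q x\<bar> \<le> B)"

text \<open>The density of the quadratic form of -d^2/dx^2 plus the symmetric matrix with entries
  \<open>q11\<close>, \<open>q12\<close>, \<open>q22\<close>, after one integration by parts, so
  that it makes sense on H^1.\<close>

definition qform :: "(real \<Rightarrow> real) \<Rightarrow> (real \<Rightarrow> real) \<Rightarrow> (real \<Rightarrow> real) \<Rightarrow> (real \<Rightarrow> real ^ 2) \<Rightarrow> (real \<Rightarrow> real ^ 2) \<Rightarrow> real \<Rightarrow> real" where
  "qform q11 q12 q22 \<phi> \<phi>' x = (norm (\<phi>' x))\<^sup>2 + q11 x * (\<phi> x $ 1)\<^sup>2 + 2 * q12 x * (\<phi> x $ 1 * \<phi> x $ 2) + q22 x * (\<phi> x $ 2)\<^sup>2"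

definition nonneg_form :: "(real \<Rightarrow> real) \<Rightarrow> (real \<Rightarrow> real) \<Rightarrow> (real \<Rightarrow> real) \<Rightarrow> bool" where
  "nonneg_form q11 q12 q22 \<longleftrightarrow> (\<forall>\<phi> \<phi>'. primitive \<phi> \<phi>' \<and> L2_on UNIV \<phi> \<and> L2_on UNIV \<phi>' \<longrightarrow>
     0 \<le> (LINT x|lebesgue. qform q11 q12 q22 \<phi> \<phi>' x))"

lemma bounded_coeff_const: "bounded_coeff (\<lambda>x. c)"
  by (auto simp: bounded_coeff_def)

lemma bounded_coeff_measurable: "bounded_coeff q \<Longrightarrow> q \<in> borel_measurable lebesgue"
  unfolding bounded_coeff_def by (intro measurable_completion) (simp add: borel_measurable_continuous_onI)

lemma bounded_coeff_mult:
  assumes "bounded_coeff p" "bounded_coeff q" shows "bounded_coeff (\<lambda>x. p x * q x)"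
proof -
  obtain B C where "\<And>x. \<bar>p x\<bar> \<le> B" "\<And>x. \<bar>q x\<bar> \<le> C" using assms by (auto simp: bounded_coeff_def)
  then have "\<bar>p x * q x\<bar> \<le> B * C" for x
    unfolding abs_mult by (meson abs_ge_zero mult_mono order_trans)
  then show ?thesis using assms by (auto simp: bounded_coeff_def intro!: continuous_intros)
qed

lemma bounded_coeff_add:
  assumes "bounded_coeff p" "bounded_coeff q" shows "bounded_coeff (\<lambda>x. p x + q x)"
proof -
  obtain B C where "\<And>x. \<bar>p x\<bar> \<le> B" "\<And>x. \<bar>q x\<bar> \<le> C" using assms by (auto simp: bounded_coeff_def)
  then have "\<bar>p x + q x\<bar> \<le> B + C" for x
    by (meson abs_triangle_ineq add_mono order_trans)
  then show ?thesis using assms by (auto simp: bounded_coeff_def intro!: continuous_intros)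
qed

lemma integrable_bounded_coeff_mult:
  fixes f :: "real \<Rightarrow> real"
  assumes q: "bounded_coeff q" and f: "integrable lebesgue f"
  shows "integrable lebesgue (\<lambda>x. q x * f x)"
proof -
  obtain B where B: "\<And>x. \<bar>q x\<bar> \<le> B" using q by (auto simp: bounded_coeff_def)
  have i: "integrable lebesgue (\<lambda>x. B * \<bar>f x\<bar>)" using f by simp
  have m: "(\<lambda>x. q x * f x) \<in> borel_measurable lebesgue"
    by (rule borel_measurable_times[OF bounded_coeff_measurable[OF q] borel_measurable_integrable[OF f]])
  show ?thesis
  proof (rule Bochner_Integration.integrable_bound[OF i m], rule AE_I2)
    fix x
    have "\<bar>q x * f x\<bar> \<le> B * \<bar>f x\<bar>" unfolding abs_mult by (rule mult_right_mono[OF B]) simp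
    then show "norm (q x * f x) \<le> norm (B * \<bar>f x\<bar>)" by simp
  qed
qed

lemma L2_component_product_integrable:
  fixes \<phi> :: "real \<Rightarrow> real ^ 2"
  assumes "L2_on UNIV \<phi>"
  shows "integrable lebesgue (\<lambda>x. \<phi> x $ i * \<phi> x $ j)"
  using L2_inner_integrable[OF L2_bounded_linear[OF assms bounded_linear_vec_nth[of i]]
      L2_bounded_linear[OF assms bounded_linear_vec_nth[of j]]] by simp

lemma qform_integrable:
  assumes "bounded_coeff q11" "bounded_coeff q12" "bounded_coeff q22" "L2_on UNIV \<phi>" "L2_on UNIV \<phi>'"
  shows "integrable lebesgue (qform q11 q12 q22 \<phi> \<phi>')"
proof -
  have "integrable lebesgue (\<lambda>x. (norm (\<phi>' x))\<^sup>2)" using assms(5) by (simp add: L2_on_UNIV_iff)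
  moreover have "integrable lebesgue (\<lambda>x. q11 x * (\<phi> x $ 1 * \<phi> x $ 1))"
    "integrable lebesgue (\<lambda>x. (2 * q12 x) * (\<phi> x $ 1 * \<phi> x $ 2))"
    "integrable lebesgue (\<lambda>x. q22 x * (\<phi> x $ 2 * \<phi> x $ 2))"
    by (intro integrable_bounded_coeff_mult bounded_coeff_mult bounded_coeff_const assms
        L2_component_product_integrable)+
  ultimately show ?thesis
    unfolding qform_def power2_eq_square[of "_ $ _"] by (intro Bochner_Integration.integrable_add)
qed

text \<open>Removes the Taylor error \<eta> r after integration. Taking \<eta> = e / (R + 1) makes
  the error at most e and allows \<open>R\<close> to be 0.\<close>

lemma integral_nonneg_perturbed:
  fixes q r :: "real \<Rightarrow> real"
  assumes q: "integrable lebesgue q" and r: "integrable lebesgue r" and nn: "\<And>x. 0 \<le> r x"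
    and ge: "\<And>\<eta>. \<eta> > 0 \<Longrightarrow> 0 \<le> (LINT x|lebesgue. q x + \<eta> * r x)"
  shows "0 \<le> (LINT x|lebesgue. q x)"
proof -
  define R where "R = (LINT x|lebesgue. r x)"
  have "R \<ge> 0" unfolding R_def using nn by (intro Bochner_Integration.integral_nonneg)
  have "0 \<le> (LINT x|lebesgue. q x) + e" if "e > 0" for e
  proof -
    have "0 \<le> (LINT x|lebesgue. q x) + e / (R + 1) * R"
      using ge[of "e / (R + 1)"] q r \<open>R \<ge> 0\<close> that by (simp add: R_def)
    also have "e / (R + 1) * R \<le> e" using \<open>R \<ge> 0\<close> that by (simp add: field_simps)
    finally show ?thesis by simp
  qed
  then show ?thesis by (rule field_le_epsilon)
qed

lemma tendsto_vec2:
  "(f \<longlongrightarrow> l) G \<Longrightarrow> (g \<longlongrightarrow> m) G \<Longrightarrow> ((\<lambda>x. vector [f x, g x] :: real ^ 2) \<longlongrightarrow> vector [l, m]) G"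
  unfolding vec2_eq_axis by (intro tendsto_intros)

lemma primitive_vec_nth: "primitive f f' \<Longrightarrow> primitive (\<lambda>x. f x $ i :: real) (\<lambda>x. f' x $ i)"
  by (rule primitive_bounded_linear[OF _ bounded_linear_vec_nth])

text \<open>By Cauchy-Schwarz, the derivative of |w| is at most |w'| in size: the modulus does not
  increase the kinetic energy. At w = 0 the quotient is 0 by convention.\<close>

lemma power2_inner_div_norm_le: "((w \<bullet> v) / norm w)\<^sup>2 \<le> (norm v)\<^sup>2"
proof -
  have "\<bar>(w \<bullet> v) / norm w\<bar> \<le> norm v"
    using Cauchy_Schwarz_ineq2[of w v] by (cases "w = 0") (auto simp: abs_divide field_simps)
  then show ?thesis by (metis abs_le_square_iff abs_norm_cancel)
qed

section \<open>Nonnegativity of the forms of L_- and L_+\<close>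

context minimizer_setting
begin

lemma U_bounded: "\<exists>M>0. \<forall>x. norm (U x) \<le> M"
  by (rule bounded_range_of_limits[OF U_continuous U_limits])

lemma sqv_U_bounded: "\<exists>M. \<forall>x. sqv (U x) \<in> cball 0 M"
proof -
  have t: "((\<lambda>x. sqv (U x)) \<longlongrightarrow> sqv l) G" if "(U \<longlongrightarrow> l) G" for l G
    unfolding sqv_def by (intro tendsto_vec2 tendsto_power tendsto_vec_nth that)
  have "\<exists>M>0. \<forall>x. norm (sqv (U x)) \<le> M"
    by (rule bounded_range_of_limits[OF continuous_on_sqv[OF U_continuous] t[OF U_limits(1)] t[OF U_limits(2)]])
  then show ?thesis by auto
qed

lemma bounded_coeff_along_U:
  assumes "continuous_on UNIV G" shows "bounded_coeff (\<lambda>x. G (sqv (U x)))"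
proof -
  obtain M where M: "\<And>x. sqv (U x) \<in> cball 0 M" using sqv_U_bounded by blast
  have "bounded (G ` cball 0 M)"
    by (intro compact_imp_bounded compact_continuous_image continuous_on_subset[OF assms]) auto
  then obtain B where "\<forall>y\<in>G ` cball 0 M. norm y \<le> B"
    unfolding bounded_iff by blast
  then have "\<bar>G (sqv (U x))\<bar> \<le> B" for x using M[of x] by auto
  moreover have "continuous_on UNIV (\<lambda>x. G (sqv (U x)))"
    using continuous_on_compose2[OF assms continuous_on_sqv[OF U_continuous[of UNIV]]] by simp
  ultimately show ?thesis by (auto simp: bounded_coeff_def)
qed

lemma bounded_coeff_U: "bounded_coeff (\<lambda>x. U x $ i)"
proof -
  obtain M where "\<And>x. norm (U x) \<le> M" using U_bounded by blast
  then have "\<bar>U x $ i\<bar> \<le> M" for x using component_le_norm_cart order_trans by blast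
  then show ?thesis using U_continuous by (auto simp: bounded_coeff_def intro!: continuous_intros)
qed

lemma C_k_F: "C_k (Suc (Suc 0)) F" "C_k (Suc 0) F"
  using C3 by (auto simp: numeral_3_eq_3)

lemma bounded_coeff_partial: "bounded_coeff (\<lambda>x. partial i F (sqv (U x)))"
  by (rule bounded_coeff_along_U[OF C_k_continuous[OF C_k_partial[OF C_k_F(1)]]])

lemma bounded_coeff_partial2: "bounded_coeff (\<lambda>x. partial i (partial j F) (sqv (U x)))"
  by (rule bounded_coeff_along_U[OF C_k_continuous[OF C_k_partial[OF C_k_partial[OF C_k_F(1)]]]])

text \<open>The competitor is the modulus of \<open>U + i e \<phi>\<close>: passing to the modulus does not increase the energy, so
  the minimality of \<open>U\<close> extends to imaginary perturbations.\<close>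

lemma nonneg_form_minus:
  "nonneg_form (\<lambda>x. partial 1 F (sqv (U x))) (\<lambda>_. 0) (\<lambda>x. partial 2 F (sqv (U x)))"
  unfolding nonneg_form_def
proof (intro allI impI, elim conjE)
  fix \<phi> \<phi>' :: "real \<Rightarrow> real ^ 2"
  assume \<phi>: "primitive \<phi> \<phi>'" "L2_on UNIV \<phi>" "L2_on UNIV \<phi>'"
  let ?q = "qform (\<lambda>x. partial 1 F (sqv (U x))) (\<lambda>_. 0) (\<lambda>x. partial 2 F (sqv (U x))) \<phi> \<phi>'"
  have q: "integrable lebesgue ?q"
    by (intro qform_integrable bounded_coeff_partial bounded_coeff_const \<phi>)
  have n: "integrable lebesgue (\<lambda>x. (norm (\<phi> x))\<^sup>2)" using \<phi>(2) by (simp add: L2_on_UNIV_iff)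
  note \<phi>_lim = L2_primitive_vanishes[OF \<phi>]
  obtain N where N: "N > 0" "\<And>x. norm (\<phi> x) \<le> N"
    using bounded_range_of_limits[OF primitive_continuous[OF \<phi>(1)] \<phi>_lim] by blast
  obtain M where M: "\<And>x. sqv (U x) \<in> cball 0 M" using sqv_U_bounded by blast
  have "0 \<le> (LINT x|lebesgue. ?q x + \<eta> * (norm (\<phi> x))\<^sup>2)" if "\<eta> > 0" for \<eta>
  proof -
    obtain \<delta> where \<delta>: "\<delta> > 0" "\<And>p h. p \<in> cball 0 M \<Longrightarrow> \<bar>h $ 1\<bar> + \<bar>h $ 2\<bar> < \<delta> \<Longrightarrow>
      \<bar>F (p + h) - F p - (partial 1 F p * h $ 1 + partial 2 F p * h $ 2)\<bar> \<le> \<eta> * (\<bar>h $ 1\<bar> + \<bar>h $ 2\<bar>)"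
      using first_order_expansion[OF C_k_F(2) \<open>\<eta> > 0\<close>, of M] by blast
    \<comment> \<open>The increment of the squares has l^1 size at most
      \<open>e\<^sup>2 * N\<^sup>2\<close>, which has to stay below \<delta>;
      \<open>e \<le> 1\<close> reduces the square of e to e.\<close>
    define e where "e = min 1 (\<delta> / (N\<^sup>2 + 1))"
    have e: "e > 0" "e \<le> 1" using \<delta>(1) by (auto simp: e_def add_nonneg_pos)
    have eN: "e\<^sup>2 * N\<^sup>2 < \<delta>"
    proof -
      have "e\<^sup>2 * N\<^sup>2 \<le> e * N\<^sup>2" using e by (intro mult_right_mono) (auto simp: power2_eq_square)
      also have "\<dots> < e * (N\<^sup>2 + 1)" using e by simp
      also have "\<dots> \<le> \<delta> / (N\<^sup>2 + 1) * (N\<^sup>2 + 1)" by (intro mult_right_mono) (auto simp: e_def)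
      also have "\<dots> = \<delta>" by (simp add: add_nonneg_eq_0_iff)
      finally show ?thesis .
    qed
    \<comment> \<open>The pair is the complex number U_j + i e \<phi>_j in real coordinates, and its
      norm is the modulus.\<close>
    define w where "w = (\<lambda>i x. (U x $ i, (e *\<^sub>R \<phi> x) $ i))"
    define w' where "w' = (\<lambda>i x. (U' x $ i, (e *\<^sub>R \<phi>' x) $ i))"
    have w: "primitive (w i) (w' i)" for i
      unfolding w_def w'_def by (intro primitive_Pair primitive_vec_nth U_primitive primitive_scaleR \<phi>)
    define V where "V = (\<lambda>x. vector [norm (w 1 x), norm (w 2 x)] :: real ^ 2)"
    define V' where "V' = (\<lambda>x. vector [(w 1 x \<bullet> w' 1 x) / norm (w 1 x), (w 2 x \<bullet> w' 2 x) / norm (w 2 x)] :: real ^ 2)"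
    have V: "primitive V V'"
      unfolding V_def V'_def by (intro primitive_vec2 primitive_norm w)
    have Vlim: "(V \<longlongrightarrow> vector [norm (l $ 1), norm (l $ 2)]) G" if "(U \<longlongrightarrow> l) G" "(\<phi> \<longlongrightarrow> 0) G" for l G
    proof -
      have "((\<lambda>x. norm (w i x)) \<longlongrightarrow> norm (l $ i, (e *\<^sub>R (0 :: real ^ 2)) $ i)) G" for i
        unfolding w_def by (intro tendsto_norm tendsto_Pair tendsto_vec_nth tendsto_scaleR tendsto_const that)
      then have "((\<lambda>x. norm (w i x)) \<longlongrightarrow> norm (l $ i)) G" for i by simp
      then show ?thesis unfolding V_def by (intro tendsto_vec2)
    qed
    \<comment> \<open>The moduli tend to (|a|, 0) and (0, |b|); positivity identifies these with the
      wells.\<close>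
    have ab: "a > 0" "b > 0" using adm unfolding admissible_potential_def by blast+
    \<comment> \<open>The increment is exactly of order e^2, so the linear term of \<open>F\<close>
      already gives the potential part of the form.\<close>
    have sqvV: "sqv (V x) = sqv (U x) + e\<^sup>2 *\<^sub>R sqv (\<phi> x)" for x
      by (simp add: vec_eq_iff forall_2 V_def w_def norm_Pair power_mult_distrib)
    have V'le: "(norm (V' x))\<^sup>2 \<le> (norm (U' x))\<^sup>2 + e\<^sup>2 * (norm (\<phi>' x))\<^sup>2" for x
    proof -
      have "(norm (V' x))\<^sup>2 \<le> (norm (w' 1 x))\<^sup>2 + (norm (w' 2 x))\<^sup>2"
        unfolding norm_vec2 V'_def using power2_inner_div_norm_le[of "w 1 x" "w' 1 x"] power2_inner_div_norm_le[of "w 2 x" "w' 2 x"]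
        by simp
      also have "\<dots> = (norm (U' x))\<^sup>2 + e\<^sup>2 * (norm (\<phi>' x))\<^sup>2"
        by (simp add: norm_vec2 w'_def norm_Pair power_mult_distrib distrib_left)
      finally show ?thesis .
    qed
    have le: "edens V V' x \<le> edens U U' x + e\<^sup>2 * (?q x + \<eta> * (norm (\<phi> x))\<^sup>2)" for x
    proof -
      define h where "h = e\<^sup>2 *\<^sub>R sqv (\<phi> x)"
      have h: "\<bar>h $ 1\<bar> + \<bar>h $ 2\<bar> = e\<^sup>2 * (norm (\<phi> x))\<^sup>2"
        by (simp add: h_def norm_vec2 abs_mult distrib_left)
      also have "\<dots> \<le> e\<^sup>2 * N\<^sup>2" using N by (intro mult_left_mono power_mono) auto
      finally have "\<bar>h $ 1\<bar> + \<bar>h $ 2\<bar> < \<delta>" using eN by simp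
      from \<delta>(2)[OF M[of x] this] have "F (sqv (U x) + h) \<le> F (sqv (U x))
        + (partial 1 F (sqv (U x)) * h $ 1 + partial 2 F (sqv (U x)) * h $ 2) + \<eta> * (e\<^sup>2 * (norm (\<phi> x))\<^sup>2)"
        unfolding h by linarith
      then show ?thesis
        using V'le[of x] by (simp add: edens_def sqvV qform_def h_def algebra_simps)
    qed
    have rhs: "integrable lebesgue (\<lambda>x. edens U U' x + e\<^sup>2 * (?q x + \<eta> * (norm (\<phi> x))\<^sup>2))"
      using edens_U_integrable q n by (intro Bochner_Integration.integrable_add integrable_mult_right)
    have int: "integrable lebesgue (edens V V')"
    proof (rule Bochner_Integration.integrable_bound[OF rhs edens_measurable[OF V]], rule AE_I2)
      fix x
      show "norm (edens V V' x) \<le> norm (edens U U' x + e\<^sup>2 * (?q x + \<eta> * (norm (\<phi> x))\<^sup>2))"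
        using le[of x] edens_nonneg[of V V' x] unfolding real_norm_def by linarith
    qed
    have "(LINT x|lebesgue. edens U U' x) \<le> (LINT x|lebesgue. edens V V' x)"
      using Vlim[OF U_limits(1) \<phi>_lim(1)] Vlim[OF U_limits(2) \<phi>_lim(2)] ab
      by (intro U_minimal[OF V _ _ int]) simp_all
    also have "\<dots> \<le> (LINT x|lebesgue. edens U U' x + e\<^sup>2 * (?q x + \<eta> * (norm (\<phi> x))\<^sup>2))"
      by (rule integral_mono[OF int rhs le])
    also have "\<dots> = (LINT x|lebesgue. edens U U' x) + e\<^sup>2 * (LINT x|lebesgue. ?q x + \<eta> * (norm (\<phi> x))\<^sup>2)"
      using edens_U_integrable q n by (subst Bochner_Integration.integral_add) simp_all
    finally have "0 \<le> e\<^sup>2 * (LINT x|lebesgue. ?q x + \<eta> * (norm (\<phi> x))\<^sup>2)" by simp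
    then show ?thesis using e(1) by (simp add: zero_le_mult_iff)
  qed
  from integral_nonneg_perturbed[OF q n _ this] show "0 \<le> (LINT x|lebesgue. ?q x)" by simp
qed

end


text \<open>Here h_j is the increment (u_j + \<sigma> e f_j)^2 - u_j^2 for a sign \<sigma>. The
  first bound brings it inside the Taylor radius; the second turns a remainder quadratic in the
  increment into one of size e^2 |f|^2.\<close>

lemma second_difference_bound:
  fixes M N e \<sigma> u1 u2 f1 f2 :: real
  defines "h1 \<equiv> \<lambda>\<sigma>. \<sigma> * (2 * e * u1 * f1) + e\<^sup>2 * f1\<^sup>2" and "h2 \<equiv> \<lambda>\<sigma>. \<sigma> * (2 * e * u2 * f2) + e\<^sup>2 * f2\<^sup>2"
  assumes e: "0 < e" "e \<le> 1" and u: "\<bar>u1\<bar> \<le> M" "\<bar>u2\<bar> \<le> M" and f: "\<bar>f1\<bar> \<le> N" "\<bar>f2\<bar> \<le> N"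
    and \<sigma>: "\<bar>\<sigma>\<bar> = 1"
  shows "\<bar>h1 \<sigma>\<bar> + \<bar>h2 \<sigma>\<bar> \<le> e * ((2 * M + N) * (\<bar>f1\<bar> + \<bar>f2\<bar>))"
    and "(\<bar>h1 \<sigma>\<bar> + \<bar>h2 \<sigma>\<bar>)\<^sup>2 \<le> e\<^sup>2 * (2 * (2 * M + N)\<^sup>2 * (f1\<^sup>2 + f2\<^sup>2))"
proof -
  have *: "\<bar>\<sigma> * (2 * e * v * g) + e\<^sup>2 * g\<^sup>2\<bar> \<le> e * ((2 * M + N) * \<bar>g\<bar>)" if "\<bar>v\<bar> \<le> M" "\<bar>g\<bar> \<le> N" for v g :: real
  proof -
    have "e\<^sup>2 * g\<^sup>2 = (e * \<bar>g\<bar>) * (e * \<bar>g\<bar>)" by (simp add: power2_eq_square abs_mult_self_eq ac_simps flip: abs_mult)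
    also have "\<dots> \<le> (e * \<bar>g\<bar>) * (1 * N)" using e that by (intro mult_left_mono mult_mono) auto
    finally have 1: "e\<^sup>2 * g\<^sup>2 \<le> e * N * \<bar>g\<bar>" by (simp add: ac_simps)
    have "\<bar>\<sigma> * (2 * e * v * g)\<bar> = (2 * e * \<bar>g\<bar>) * \<bar>v\<bar>" using \<sigma> e by (simp add: abs_mult ac_simps)
    also have "\<dots> \<le> (2 * e * \<bar>g\<bar>) * M" using e that by (intro mult_left_mono) auto
    finally have 2: "\<bar>\<sigma> * (2 * e * v * g)\<bar> \<le> 2 * e * M * \<bar>g\<bar>" by (simp add: ac_simps)
    have "\<bar>\<sigma> * (2 * e * v * g) + e\<^sup>2 * g\<^sup>2\<bar> \<le> \<bar>\<sigma> * (2 * e * v * g)\<bar> + e\<^sup>2 * g\<^sup>2"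
      using abs_triangle_ineq[of "\<sigma> * (2 * e * v * g)" "e\<^sup>2 * g\<^sup>2"] by simp
    also have "\<dots> \<le> 2 * e * M * \<bar>g\<bar> + e * N * \<bar>g\<bar>" using 1 2 by linarith
    finally show ?thesis by (simp add: algebra_simps)
  qed
  show 1: "\<bar>h1 \<sigma>\<bar> + \<bar>h2 \<sigma>\<bar> \<le> e * ((2 * M + N) * (\<bar>f1\<bar> + \<bar>f2\<bar>))"
    using *[OF u(1) f(1)] *[OF u(2) f(2)] unfolding h1_def h2_def by (simp add: algebra_simps)
  have "(\<bar>h1 \<sigma>\<bar> + \<bar>h2 \<sigma>\<bar>)\<^sup>2 \<le> (e * ((2 * M + N) * (\<bar>f1\<bar> + \<bar>f2\<bar>)))\<^sup>2"
    by (rule power_mono[OF 1]) simp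
  also have "\<dots> = (e\<^sup>2 * (2 * M + N)\<^sup>2) * (\<bar>f1\<bar> + \<bar>f2\<bar>)\<^sup>2" by (simp add: power_mult_distrib)
  also have "\<dots> \<le> (e\<^sup>2 * (2 * M + N)\<^sup>2) * (2 * (f1\<^sup>2 + f2\<^sup>2))"
  proof (rule mult_left_mono)
    show "(\<bar>f1\<bar> + \<bar>f2\<bar>)\<^sup>2 \<le> 2 * (f1\<^sup>2 + f2\<^sup>2)"
      using sum_squares_bound[of "\<bar>f1\<bar>" "\<bar>f2\<bar>"] by (simp add: power2_sum)
  qed (rule mult_nonneg_nonneg; rule zero_le_power2)
  finally show "(\<bar>h1 \<sigma>\<bar> + \<bar>h2 \<sigma>\<bar>)\<^sup>2 \<le> e\<^sup>2 * (2 * (2 * M + N)\<^sup>2 * (f1\<^sup>2 + f2\<^sup>2))"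
    by (simp only: mult.assoc mult.commute mult.left_commute)
qed

text \<open>The left side is the Hessian of \<open>F\<close> on the e^2-parts of the increments,
  which survives in the second difference. One factor |f|^2 is bounded by \<open>N\<^sup>2\<close>
  and one factor e is traded for \<eta>.\<close>

lemma quartic_remainder_bound:
  fixes A B C D N e \<eta> f1 f2 :: real
  assumes "\<bar>A\<bar> \<le> D" "\<bar>B\<bar> \<le> D" "\<bar>C\<bar> \<le> D" "f1\<^sup>2 + f2\<^sup>2 \<le> N\<^sup>2" "0 \<le> e" "e \<le> 1" "e * (D * N\<^sup>2) \<le> \<eta>"
  shows "e ^ 4 * (A * f1 ^ 4 + 2 * B * (f1\<^sup>2 * f2\<^sup>2) + C * f2 ^ 4) \<le> e\<^sup>2 * (\<eta> * (f1\<^sup>2 + f2\<^sup>2))"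
proof -
  define n where "n = f1\<^sup>2 + f2\<^sup>2"
  have n: "0 \<le> n" "n \<le> N\<^sup>2" using assms by (auto simp: n_def)
  have "D \<ge> 0" using assms(1) by linarith
  have "A * f1 ^ 4 + 2 * B * (f1\<^sup>2 * f2\<^sup>2) + C * f2 ^ 4 \<le> D * f1 ^ 4 + 2 * D * (f1\<^sup>2 * f2\<^sup>2) + D * f2 ^ 4"
    using assms by (intro add_mono mult_right_mono) auto
  also have "\<dots> = D * n * n" by (simp add: n_def power2_eq_square power4_eq_xxxx algebra_simps)
  also have "\<dots> \<le> D * N\<^sup>2 * n" using n \<open>D \<ge> 0\<close> by (intro mult_right_mono mult_left_mono) auto
  finally have "e ^ 4 * (A * f1 ^ 4 + 2 * B * (f1\<^sup>2 * f2\<^sup>2) + C * f2 ^ 4) \<le> e ^ 4 * (D * N\<^sup>2 * n)"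
    by (rule mult_left_mono) (use assms in simp)
  also have "\<dots> = (e\<^sup>2 * n) * (e * (e * (D * N\<^sup>2)))" by (simp add: power2_eq_square power4_eq_xxxx)
  also have "\<dots> \<le> (e\<^sup>2 * n) * \<eta>"
  proof (rule mult_left_mono)
    have "e * (e * (D * N\<^sup>2)) \<le> 1 * (e * (D * N\<^sup>2))" using assms \<open>D \<ge> 0\<close> by (intro mult_right_mono) auto
    then show "e * (e * (D * N\<^sup>2)) \<le> \<eta>" using assms(7) by linarith
  qed (use n in simp)
  finally show ?thesis by (simp add: n_def ac_simps)
qed

context minimizer_setting
begin

text \<open>The energies of U + e \<phi> and U - e \<phi> are added. The squares move by 2 \<sigma>
  e U_j \<phi>_j + e^2 \<phi>_j^2, so terms odd in \<sigma> cancel. At order e^2 the linear term of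
  \<open>F\<close> gives the first derivatives in the coefficients, and its Hessian on the 2 e U_j
  \<phi>_j gives the second derivatives.\<close>

lemma nonneg_form_plus:
  "nonneg_form (\<lambda>x. partial 1 F (sqv (U x)) + 2 * partial 1 (partial 1 F) (sqv (U x)) * (U x $ 1)\<^sup>2)
     (\<lambda>x. 2 * partial 1 (partial 2 F) (sqv (U x)) * U x $ 1 * U x $ 2)
     (\<lambda>x. partial 2 F (sqv (U x)) + 2 * partial 2 (partial 2 F) (sqv (U x)) * (U x $ 2)\<^sup>2)"
  (is "nonneg_form ?q11 ?q12 ?q22")
  unfolding nonneg_form_def
proof (intro allI impI, elim conjE)
  fix \<phi> \<phi>' :: "real \<Rightarrow> real ^ 2"
  assume \<phi>: "primitive \<phi> \<phi>'" "L2_on UNIV \<phi>" "L2_on UNIV \<phi>'"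
  let ?q = "qform ?q11 ?q12 ?q22 \<phi> \<phi>'"
  have q: "integrable lebesgue ?q"
    \<comment> \<open>Squares of \<open>U\<close> are unfolded into products to which
      \<open>bounded_coeff_mult\<close> applies.\<close>
    by (intro qform_integrable bounded_coeff_add bounded_coeff_mult bounded_coeff_partial bounded_coeff_partial2
        bounded_coeff_U bounded_coeff_const \<phi> | simp only: power2_eq_square)+
  have n: "integrable lebesgue (\<lambda>x. (norm (\<phi> x))\<^sup>2)" using \<phi>(2) by (simp add: L2_on_UNIV_iff)
  note \<phi>_lim = L2_primitive_vanishes[OF \<phi>]
  obtain N where N: "N > 0" "\<And>x. norm (\<phi> x) \<le> N"
    using bounded_range_of_limits[OF primitive_continuous[OF \<phi>(1)] \<phi>_lim] by blast
  obtain M where M: "M > 0" "\<And>x. norm (U x) \<le> M" using U_bounded by blast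
  obtain M' where M': "\<And>x. sqv (U x) \<in> cball 0 M'" using sqv_U_bounded by blast
  obtain D1 where D1: "\<forall>x. \<bar>partial 1 (partial 1 F) (sqv (U x))\<bar> \<le> D1"
    using bounded_coeff_partial2[of 1 1] unfolding bounded_coeff_def by blast
  obtain D2 where D2: "\<forall>x. \<bar>partial 1 (partial 2 F) (sqv (U x))\<bar> \<le> D2"
    using bounded_coeff_partial2[of 1 2] unfolding bounded_coeff_def by blast
  obtain D3 where D3: "\<forall>x. \<bar>partial 2 (partial 2 F) (sqv (U x))\<bar> \<le> D3"
    using bounded_coeff_partial2[of 2 2] unfolding bounded_coeff_def by blast
  define D where "D = max 0 (max D1 (max D2 D3))"
  have D: "D \<ge> 0" "\<bar>partial 1 (partial 1 F) (sqv (U x))\<bar> \<le> D"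
    "\<bar>partial 1 (partial 2 F) (sqv (U x))\<bar> \<le> D" "\<bar>partial 2 (partial 2 F) (sqv (U x))\<bar> \<le> D" for x
    using D1 D2 D3 by (simp_all add: D_def le_max_iff_disj)
  \<comment> \<open>Each of the two Taylor remainders contributes
    \<open>2 * (2 * M + N)\<^sup>2\<close>, and the quartic terms contribute 1.\<close>
  define K where "K = 1 + 4 * (2 * M + N)\<^sup>2"
  have "0 \<le> (LINT x|lebesgue. 2 * ?q x + \<eta> * (K * (norm (\<phi> x))\<^sup>2))" if "\<eta> > 0" for \<eta>
  proof -
    define rem where "rem = (\<lambda>p h. F (p + h) - F p - (partial 1 F p * h $ 1 + partial 2 F p * h $ 2)
      - (partial 1 (partial 1 F) p * (h $ 1)\<^sup>2 / 2 + partial 1 (partial 2 F) p * (h $ 1 * h $ 2)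
         + partial 2 (partial 2 F) p * (h $ 2)\<^sup>2 / 2))"
    obtain \<delta> where \<delta>: "\<delta> > 0" "\<And>p h. p \<in> cball 0 M' \<Longrightarrow> \<bar>h $ 1\<bar> + \<bar>h $ 2\<bar> < \<delta> \<Longrightarrow>
      \<bar>rem p h\<bar> \<le> \<eta> * (\<bar>h $ 1\<bar> + \<bar>h $ 2\<bar>)\<^sup>2"
      using second_order_expansion[OF C_k_F(1) \<open>\<eta> > 0\<close>, of M'] unfolding rem_def by blast
    \<comment> \<open>e times \<open>P\<close> bounds the l^1 size of the increments.\<close>
    define P where "P = (2 * M + N) * (N + N)"
    have P: "P \<ge> 0" using M(1) N(1) by (simp add: P_def)
    \<comment> \<open>The second entry absorbs the quartic terms into \<eta>, the third keeps the
      increments inside the Taylor radius; adding 1 excludes division by 0.\<close>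
    define e where "e = min 1 (min (\<eta> / (D * N\<^sup>2 + 1)) (\<delta> / (P + 1)))"
    have DN: "D * N\<^sup>2 \<ge> 0" using D(1) by simp
    have e: "e > 0" "e \<le> 1" using \<delta>(1) \<open>\<eta> > 0\<close> P DN by (auto simp: e_def)
    have eD: "e * (D * N\<^sup>2) \<le> \<eta>"
    proof -
      have "e * (D * N\<^sup>2) \<le> \<eta> / (D * N\<^sup>2 + 1) * (D * N\<^sup>2 + 1)"
        using e DN \<open>\<eta> > 0\<close> by (intro mult_mono) (auto simp: e_def)
      then show ?thesis using DN by (simp add: add_nonneg_eq_0_iff)
    qed
    have eP: "e * P < \<delta>"
    proof -
      have "e * P < e * (P + 1)" using e by simp
      also have "\<dots> \<le> \<delta> / (P + 1) * (P + 1)" using P by (intro mult_right_mono) (auto simp: e_def)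
      also have "\<dots> = \<delta>" using P by (simp add: add_nonneg_eq_0_iff)
      finally show ?thesis .
    qed
    define V where "V = (\<lambda>\<sigma> x. U x + (\<sigma> * e) *\<^sub>R \<phi> x)"
    define V' where "V' = (\<lambda>\<sigma> x. U' x + (\<sigma> * e) *\<^sub>R \<phi>' x)"
    have V: "primitive (V \<sigma>) (V' \<sigma>)" for \<sigma>
      unfolding V_def V'_def by (intro primitive_add primitive_scaleR U_primitive \<phi>)
    have Vlim: "(V \<sigma> \<longlongrightarrow> l) G" if "(U \<longlongrightarrow> l) G" "(\<phi> \<longlongrightarrow> 0) G" for l G \<sigma>
      unfolding V_def using tendsto_add[OF that(1) tendsto_scaleR[OF tendsto_const that(2)]] by simp
    have le: "edens (V 1) (V' 1) x + edens (V (-1)) (V' (-1)) x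
        \<le> 2 * edens U U' x + e\<^sup>2 * (2 * ?q x + \<eta> * (K * (norm (\<phi> x))\<^sup>2))" for x
    proof -
      define p where "p = sqv (U x)"
      define u1 where "u1 = U x $ 1"
      define u2 where "u2 = U x $ 2"
      define f1 where "f1 = \<phi> x $ 1"
      define f2 where "f2 = \<phi> x $ 2"
      define A where "A = partial 1 (partial 1 F) p"
      define B where "B = partial 1 (partial 2 F) p"
      define C where "C = partial 2 (partial 2 F) p"
      define h where "h = (\<lambda>\<sigma>. vector [\<sigma> * (2 * e * u1 * f1) + e\<^sup>2 * f1\<^sup>2, \<sigma> * (2 * e * u2 * f2) + e\<^sup>2 * f2\<^sup>2] :: real ^ 2)"
      have u: "\<bar>u1\<bar> \<le> M" "\<bar>u2\<bar> \<le> M" and f: "\<bar>f1\<bar> \<le> N" "\<bar>f2\<bar> \<le> N"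
        using M(2) N(2) component_le_norm_cart order_trans unfolding u1_def u2_def f1_def f2_def by blast+
      have nf: "f1\<^sup>2 + f2\<^sup>2 = (norm (\<phi> x))\<^sup>2" by (simp add: f1_def f2_def norm_vec2)
      have sqvV: "sqv (V \<sigma> x) = p + h \<sigma>" if "\<bar>\<sigma>\<bar> = 1" for \<sigma>
      proof -
        have "\<sigma>\<^sup>2 = 1" using that by (metis power2_abs one_power2)
        then show ?thesis
          by (simp add: vec_eq_iff forall_2 p_def h_def V_def u1_def u2_def f1_def f2_def power2_sum power_mult_distrib algebra_simps)
      qed
      have r: "\<bar>rem p (h \<sigma>)\<bar> \<le> \<eta> * (e\<^sup>2 * (2 * (2 * M + N)\<^sup>2 * (f1\<^sup>2 + f2\<^sup>2)))" if \<sigma>: "\<bar>\<sigma>\<bar> = 1" for \<sigma>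
      proof -
        note b = second_difference_bound[OF e u f \<sigma>]
        have "e * ((2 * M + N) * (\<bar>f1\<bar> + \<bar>f2\<bar>)) \<le> e * P"
          unfolding P_def using e M(1) N(1) f by (intro mult_left_mono add_mono) auto
        then have "\<bar>h \<sigma> $ 1\<bar> + \<bar>h \<sigma> $ 2\<bar> < \<delta>" using b(1) eP by (simp add: h_def)
        from \<delta>(2)[OF _ this, of p] have "\<bar>rem p (h \<sigma>)\<bar> \<le> \<eta> * (\<bar>h \<sigma> $ 1\<bar> + \<bar>h \<sigma> $ 2\<bar>)\<^sup>2"
          using M' by (simp add: p_def)
        also have "\<dots> \<le> \<eta> * (e\<^sup>2 * (2 * (2 * M + N)\<^sup>2 * (f1\<^sup>2 + f2\<^sup>2)))"
          using b(2) \<open>\<eta> > 0\<close> by (intro mult_left_mono) (simp_all add: h_def)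
        finally show ?thesis .
      qed
      have "f1\<^sup>2 + f2\<^sup>2 \<le> N\<^sup>2" unfolding nf using N(2) by (intro power_mono) auto
      then have q4: "e ^ 4 * (A * f1 ^ 4 + 2 * B * (f1\<^sup>2 * f2\<^sup>2) + C * f2 ^ 4) \<le> e\<^sup>2 * (\<eta> * (f1\<^sup>2 + f2\<^sup>2))"
        using D e eD by (intro quartic_remainder_bound[where D = D and N = N]) (auto simp: A_def B_def C_def p_def)
      \<comment> \<open>Sum of the two Taylor formulas: the order e^2 is twice the potential part of
        the form, and the order e^4 comes from the Hessian on the squares of \<phi>.\<close>
      have "F (p + h 1) + F (p + h (-1)) - 2 * F p = rem p (h 1) + rem p (h (-1))
          + e\<^sup>2 * (2 * ((partial 1 F p + 2 * A * u1\<^sup>2) * f1\<^sup>2 + 2 * (2 * B * u1 * u2) * (f1 * f2) + (partial 2 F p + 2 * C * u2\<^sup>2) * f2\<^sup>2))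
          + e ^ 4 * (A * f1 ^ 4 + 2 * B * (f1\<^sup>2 * f2\<^sup>2) + C * f2 ^ 4)"
        unfolding rem_def A_def[symmetric] B_def[symmetric] C_def[symmetric]
        by (simp add: h_def power2_eq_square power4_eq_xxxx field_simps)
      also have "\<dots> \<le> e\<^sup>2 * (2 * ((partial 1 F p + 2 * A * u1\<^sup>2) * f1\<^sup>2 + 2 * (2 * B * u1 * u2) * (f1 * f2) + (partial 2 F p + 2 * C * u2\<^sup>2) * f2\<^sup>2))
          + 2 * (\<eta> * (e\<^sup>2 * (2 * (2 * M + N)\<^sup>2 * (f1\<^sup>2 + f2\<^sup>2)))) + e\<^sup>2 * (\<eta> * (f1\<^sup>2 + f2\<^sup>2))"
        using r[of 1] r[of "-1"] q4 by (simp add: abs_le_iff)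
      finally have pot: "F (p + h 1) + F (p + h (-1)) - 2 * F p
        \<le> e\<^sup>2 * (2 * ((partial 1 F p + 2 * A * u1\<^sup>2) * f1\<^sup>2 + 2 * (2 * B * u1 * u2) * (f1 * f2) + (partial 2 F p + 2 * C * u2\<^sup>2) * f2\<^sup>2)
          + \<eta> * (K * (norm (\<phi> x))\<^sup>2))"
        unfolding nf K_def by (simp add: algebra_simps)
      have kin: "(norm (V' 1 x))\<^sup>2 + (norm (V' (-1) x))\<^sup>2 = 2 * (norm (U' x))\<^sup>2 + e\<^sup>2 * (2 * (norm (\<phi>' x))\<^sup>2)"
        unfolding V'_def norm_vec2 by (simp add: power2_eq_square algebra_simps)
      have "edens (V 1) (V' 1) x + edens (V (-1)) (V' (-1)) x
        = 2 * edens U U' x + e\<^sup>2 * (2 * (norm (\<phi>' x))\<^sup>2) + (F (p + h 1) + F (p + h (-1)) - 2 * F p)"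
        using kin by (simp add: edens_def sqvV flip: p_def)
      also have "\<dots> \<le> 2 * edens U U' x + e\<^sup>2 * (2 * (norm (\<phi>' x))\<^sup>2) +
         e\<^sup>2 * (2 * ((partial 1 F p + 2 * A * u1\<^sup>2) * f1\<^sup>2 + 2 * (2 * B * u1 * u2) * (f1 * f2) + (partial 2 F p + 2 * C * u2\<^sup>2) * f2\<^sup>2)
          + \<eta> * (K * (norm (\<phi> x))\<^sup>2))"
        using pot by linarith
      also have "\<dots> = 2 * edens U U' x + e\<^sup>2 * (2 * ?q x + \<eta> * (K * (norm (\<phi> x))\<^sup>2))"
        unfolding qform_def A_def B_def C_def p_def u1_def u2_def f1_def f2_def by (simp add: distrib_left)
      finally show ?thesis .
    qed
    have rhs: "integrable lebesgue (\<lambda>x. 2 * edens U U' x + e\<^sup>2 * (2 * ?q x + \<eta> * (K * (norm (\<phi> x))\<^sup>2)))"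
      using edens_U_integrable q n by (intro Bochner_Integration.integrable_add integrable_mult_right)
    \<comment> \<open>The integrable bound is on the sum of the two densities; both are nonnegative,
      so it dominates each.\<close>
    have int: "integrable lebesgue (edens (V \<sigma>) (V' \<sigma>))" if "\<sigma> = 1 \<or> \<sigma> = -1" for \<sigma>
    proof (rule Bochner_Integration.integrable_bound[OF rhs edens_measurable[OF V]], rule AE_I2)
      fix x
      show "norm (edens (V \<sigma>) (V' \<sigma>) x) \<le> norm (2 * edens U U' x + e\<^sup>2 * (2 * ?q x + \<eta> * (K * (norm (\<phi> x))\<^sup>2)))"
        using le[of x] edens_nonneg[of "V 1" "V' 1" x] edens_nonneg[of "V (-1)" "V' (-1)" x] that
        unfolding real_norm_def by (elim disjE) simp_all
    qed
    have min: "(LINT x|lebesgue. edens U U' x) \<le> (LINT x|lebesgue. edens (V \<sigma>) (V' \<sigma>) x)" if "\<sigma> = 1 \<or> \<sigma> = -1" for \<sigma>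
      by (rule U_minimal[OF V Vlim[OF U_limits(1) \<phi>_lim(1)] Vlim[OF U_limits(2) \<phi>_lim(2)] int[OF that]])
    have "2 * (LINT x|lebesgue. edens U U' x) \<le> (LINT x|lebesgue. edens (V 1) (V' 1) x) + (LINT x|lebesgue. edens (V (-1)) (V' (-1)) x)"
      using min[of 1] min[of "-1"] by simp
    also have "\<dots> = (LINT x|lebesgue. edens (V 1) (V' 1) x + edens (V (-1)) (V' (-1)) x)"
      using int by (simp add: Bochner_Integration.integral_add)
    also have "\<dots> \<le> (LINT x|lebesgue. 2 * edens U U' x + e\<^sup>2 * (2 * ?q x + \<eta> * (K * (norm (\<phi> x))\<^sup>2)))"
      using int by (intro integral_mono rhs le Bochner_Integration.integrable_add) auto
    also have "\<dots> = 2 * (LINT x|lebesgue. edens U U' x) + e\<^sup>2 * (LINT x|lebesgue. 2 * ?q x + \<eta> * (K * (norm (\<phi> x))\<^sup>2))"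
      using edens_U_integrable q n by (subst Bochner_Integration.integral_add) simp_all
    finally have "0 \<le> e\<^sup>2 * (LINT x|lebesgue. 2 * ?q x + \<eta> * (K * (norm (\<phi> x))\<^sup>2))" by simp
    then show ?thesis using e(1) by (simp add: zero_le_mult_iff)
  qed
  moreover have "0 \<le> K" by (simp add: K_def)
  ultimately have "0 \<le> (LINT x|lebesgue. 2 * ?q x)"
    using q n by (intro integral_nonneg_perturbed[of "\<lambda>x. 2 * ?q x" "\<lambda>x. K * (norm (\<phi> x))\<^sup>2"]) simp_all
  then show "0 \<le> (LINT x|lebesgue. ?q x)" by simp
qed

end


section \<open>Spectral stability\<close>


definition H1_pair :: "(real \<Rightarrow> 'a::euclidean_space) \<Rightarrow> (real \<Rightarrow> 'a) \<Rightarrow> bool" where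
  "H1_pair f f' \<longleftrightarrow> primitive f f' \<and> L2_on UNIV f \<and> L2_on UNIV f'"

lemma H1_pair_bounded_linear:
  fixes T :: "'a::euclidean_space \<Rightarrow> 'b::euclidean_space"
  shows "H1_pair f f' \<Longrightarrow> bounded_linear T \<Longrightarrow> H1_pair (\<lambda>x. T (f x)) (\<lambda>x. T (f' x))"
  by (simp add: H1_pair_def primitive_bounded_linear L2_bounded_linear)

lemma L2_add:
  fixes f g :: "real \<Rightarrow> 'a::euclidean_space"
  assumes "L2_on UNIV f" "L2_on UNIV g"
  shows "L2_on UNIV (\<lambda>x. f x + g x)"
proof -
  have "(norm (f x + g x))\<^sup>2 = f x \<bullet> f x + f x \<bullet> g x + (g x \<bullet> f x + g x \<bullet> g x)" for x
    by (simp add: power2_norm_eq_inner inner_add_left inner_add_right)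
  moreover have "integrable lebesgue (\<lambda>x. f x \<bullet> f x + f x \<bullet> g x + (g x \<bullet> f x + g x \<bullet> g x))"
    by (intro Bochner_Integration.integrable_add L2_inner_integrable assms)
  moreover have "(\<lambda>x. f x + g x) \<in> borel_measurable lebesgue"
    using assms by (intro borel_measurable_add) (simp_all add: L2_on_UNIV_iff)
  ultimately show ?thesis
    by (simp add: L2_on_UNIV_iff)
qed

lemma H1_pair_add:
  "H1_pair f f' \<Longrightarrow> H1_pair g g' \<Longrightarrow> H1_pair (\<lambda>x. f x + g x) (\<lambda>x. f' x + g' x)"
  by (simp add: H1_pair_def primitive_add L2_add)

lemma H1_pair_scaleR: "H1_pair f f' \<Longrightarrow> H1_pair (\<lambda>x. c *\<^sub>R f x) (\<lambda>x. c *\<^sub>R f' x)"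
  by (rule H1_pair_bounded_linear[OF _ bounded_linear_scaleR_right])

lemma bounded_linear_complex_scale: "bounded_linear (\<lambda>z :: complex ^ 2. \<mu> *s z)"
proof (rule linear_conv_bounded_linear[THEN iffD1])
  show "linear (\<lambda>z :: complex ^ 2. \<mu> *s z)"
    by (rule linearI) (simp_all add: vec_eq_iff algebra_simps)
qed

text \<open>The inner product here is the real part of the Hermitian one. Splitting \<mu> expresses
  a pairing with \<open>\<mu> *s z\<close> through z \<bullet> w and (i z) \<bullet> w.\<close>

lemma complex_scale_eq: "\<mu> *s (z :: complex ^ 2) = Re \<mu> *\<^sub>R z + Im \<mu> *\<^sub>R (\<i> *s z)"
  by (auto simp: vec_eq_iff complex_eq_iff)

lemma inner_complex2: "(z :: complex ^ 2) \<bullet> w = Re (z $ 1) * Re (w $ 1) + Im (z $ 1) * Im (w $ 1)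
    + (Re (z $ 2) * Re (w $ 2) + Im (z $ 2) * Im (w $ 2))"
  by (simp add: inner_vec_def sum_2 inner_complex_def)

lemma inner_i_left: "(\<i> *s z) \<bullet> (w :: complex ^ 2) = - (z \<bullet> (\<i> *s w))"
  by (simp add: inner_complex2)

lemma inner_i_i: "(\<i> *s z) \<bullet> (\<i> *s w :: complex ^ 2) = z \<bullet> w"
  by (simp add: inner_complex2)

lemma inner_i_self: "z \<bullet> (\<i> *s z :: complex ^ 2) = 0"
  by (simp add: inner_complex2)

definition pot :: "(real \<Rightarrow> real) \<Rightarrow> (real \<Rightarrow> real) \<Rightarrow> (real \<Rightarrow> real) \<Rightarrow> real \<Rightarrow> complex ^ 2 \<Rightarrow> complex ^ 2" where
  "pot q11 q12 q22 x z = vector [of_real (q11 x) * z $ 1 + of_real (q12 x) * z $ 2,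
     of_real (q12 x) * z $ 1 + of_real (q22 x) * z $ 2]"

section \<open>Nonnegative forms on complex-valued H^1 functions\<close>

locale schroedinger_form =
  fixes q11 q12 q22 :: "real \<Rightarrow> real"
  assumes coeff: "bounded_coeff q11" "bounded_coeff q12" "bounded_coeff q22"
    and form: "nonneg_form q11 q12 q22"
begin

definition B :: "(real \<Rightarrow> complex ^ 2) \<Rightarrow> (real \<Rightarrow> complex ^ 2) \<Rightarrow> (real \<Rightarrow> complex ^ 2) \<Rightarrow> (real \<Rightarrow> complex ^ 2) \<Rightarrow> real" where
  "B f f' g g' = (LINT x|lebesgue. f' x \<bullet> g' x + pot q11 q12 q22 x (f x) \<bullet> g x)"

lemma pot_inner: "pot q11 q12 q22 x z \<bullet> w = q11 x * (z $ 1 \<bullet> w $ 1) + q12 x * (z $ 2 \<bullet> w $ 1 + z $ 1 \<bullet> w $ 2) + q22 x * (z $ 2 \<bullet> w $ 2)"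
  by (simp add: inner_complex2 pot_def inner_complex_def algebra_simps)

lemma pot_integrable:
  assumes "L2_on UNIV f" "L2_on UNIV g"
  shows "integrable lebesgue (\<lambda>x. pot q11 q12 q22 x (f x) \<bullet> g x)"
  unfolding pot_inner
  by (intro Bochner_Integration.integrable_add integrable_bounded_coeff_mult coeff L2_inner_integrable
      L2_bounded_linear[OF assms(1) bounded_linear_vec_nth] L2_bounded_linear[OF assms(2) bounded_linear_vec_nth])

lemma B_integrable:
  assumes "H1_pair f f'" "H1_pair g g'"
  shows "integrable lebesgue (\<lambda>x. f' x \<bullet> g' x + pot q11 q12 q22 x (f x) \<bullet> g x)"
  using assms by (intro Bochner_Integration.integrable_add pot_integrable L2_inner_integrable) (auto simp: H1_pair_def)

text \<open>The coefficients are real, so the form splits into its values at the real and the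
  imaginary part of f.\<close>

lemma B_nonneg:
  assumes f: "H1_pair f f'"
  shows "0 \<le> B f f' f f'"
proof -
  define R where "R = (\<lambda>z :: complex ^ 2. (\<chi> i. Re (z $ i)) :: real ^ 2)"
  define I where "I = (\<lambda>z :: complex ^ 2. (\<chi> i. Im (z $ i)) :: real ^ 2)"
  have lin: "linear R" "linear I" by (auto intro!: linearI simp: R_def I_def vec_eq_iff)
  then have "bounded_linear R" "bounded_linear I" by (simp_all add: linear_conv_bounded_linear)
  note Rf = H1_pair_bounded_linear[OF f \<open>bounded_linear R\<close>, unfolded H1_pair_def]
    and If = H1_pair_bounded_linear[OF f \<open>bounded_linear I\<close>, unfolded H1_pair_def]
  let ?qR = "qform q11 q12 q22 (\<lambda>x. R (f x)) (\<lambda>x. R (f' x))"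
  let ?qI = "qform q11 q12 q22 (\<lambda>x. I (f x)) (\<lambda>x. I (f' x))"
  have "integrable lebesgue ?qR" "integrable lebesgue ?qI"
    using Rf If by (auto intro!: qform_integrable coeff)
  moreover have "0 \<le> (LINT x|lebesgue. ?qR x)" "0 \<le> (LINT x|lebesgue. ?qI x)"
    using form Rf If unfolding nonneg_form_def by blast+
  moreover have "f' x \<bullet> f' x + pot q11 q12 q22 x (f x) \<bullet> f x = ?qR x + ?qI x" for x
    unfolding pot_inner qform_def norm_vec2
    by (simp add: R_def I_def inner_complex2 inner_complex_def power2_eq_square algebra_simps)
  ultimately show ?thesis by (simp add: B_def)
qed

text \<open>This says that the Hermitian quadratic form is real: testing against i f extracts its
  imaginary part.\<close>

lemma B_i_self: "B f f' (\<lambda>x. \<i> *s f x) (\<lambda>x. \<i> *s f' x) = 0"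
proof -
  have "f' x \<bullet> (\<i> *s f' x) + pot q11 q12 q22 x (f x) \<bullet> (\<i> *s f x) = 0" for x
    unfolding inner_i_self pot_inner by (simp add: inner_complex_def algebra_simps)
  then show ?thesis by (simp add: B_def)
qed

text \<open>With B(f, f) = 0, nonnegativity at f + t g reads 2 t b + t^2 c \<ge> 0 for all real t,
  which forces b = 0.\<close>

lemma B_null:
  assumes f: "H1_pair f f'" and g: "H1_pair g g'" and null: "B f f' f f' = 0"
  shows "B f f' g g' = 0"
proof -
  have expand: "B (\<lambda>x. f x + t *\<^sub>R g x) (\<lambda>x. f' x + t *\<^sub>R g' x) (\<lambda>x. f x + t *\<^sub>R g x) (\<lambda>x. f' x + t *\<^sub>R g' x)
      = B f f' f f' + (2 * t * B f f' g g' + t\<^sup>2 * B g g' g g')" for t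
  proof -
    have "(f' x + t *\<^sub>R g' x) \<bullet> (f' x + t *\<^sub>R g' x) + pot q11 q12 q22 x (f x + t *\<^sub>R g x) \<bullet> (f x + t *\<^sub>R g x)
       = (f' x \<bullet> f' x + pot q11 q12 q22 x (f x) \<bullet> f x)
        + (2 * t * (f' x \<bullet> g' x + pot q11 q12 q22 x (f x) \<bullet> g x) + t\<^sup>2 * (g' x \<bullet> g' x + pot q11 q12 q22 x (g x) \<bullet> g x))" for x
      unfolding pot_inner by (simp add: inner_complex2 inner_complex_def power2_eq_square algebra_simps)
    then show ?thesis
      unfolding B_def using B_integrable[OF f f] B_integrable[OF f g] B_integrable[OF g g]
      by simp
  qed
  define b where "b = B f f' g g'"
  define c where "c = B g g' g g'"
  have c: "c \<ge> 0" unfolding c_def by (rule B_nonneg[OF g])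
  have nn: "0 \<le> 2 * t * b + t\<^sup>2 * c" for t
    using B_nonneg[OF H1_pair_add[OF f H1_pair_scaleR[OF g]], of t] expand[of t] null by (simp add: b_def c_def)
  \<comment> \<open>The choice t = -b s covers c = 0 as well, where the minimising t would divide by
    0.\<close>
  define s where "s = 1 / (c + 1)"
  have s: "0 < s" "s * c \<le> 1" using c by (simp_all add: s_def field_simps)
  have "b\<^sup>2 * (s * (2 - s * c)) \<le> 0"
    using nn[of "- b * s"] by (simp add: power2_eq_square algebra_simps)
  moreover have "0 < s * (2 - s * c)" using s by simp
  ultimately have "b = 0" using s by (auto simp: mult_le_0_iff)
  then show ?thesis by (simp add: b_def)
qed

lemma B_green:
  assumes f: "H1_pair f f1" "H1_pair f1 f2" and g: "H1_pair g g1"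
  shows "(LINT x|lebesgue. (- f2 x + pot q11 q12 q22 x (f x)) \<bullet> g x) = B f f1 g g1"
proof -
  note fg = f[unfolded H1_pair_def] g[unfolded H1_pair_def]
  have "(LINT x|lebesgue. f2 x \<bullet> g x) = - (LINT x|lebesgue. f1 x \<bullet> g1 x)"
    using fg by (intro L2_integration_by_parts) auto
  moreover have "integrable lebesgue (\<lambda>x. f2 x \<bullet> g x)" "integrable lebesgue (\<lambda>x. f1 x \<bullet> g1 x)"
    "integrable lebesgue (\<lambda>x. pot q11 q12 q22 x (f x) \<bullet> g x)"
    using fg by (auto intro!: L2_inner_integrable pot_integrable)
  ultimately show ?thesis unfolding B_def inner_add_left inner_minus_left by simp
qed

text \<open>Turns an a.e. equation L f = h into its weak form against arbitrary H^1
  functions.\<close>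

lemma B_eq_of_AE:
  assumes f: "H1_pair f f1" "H1_pair f1 f2" and g: "H1_pair g g1" and h: "L2_on UNIV h"
    and eq: "AE x in lebesgue. - f2 x + pot q11 q12 q22 x (f x) = h x"
  shows "B f f1 g g1 = (LINT x|lebesgue. h x \<bullet> g x)"
proof -
  note fg = f[unfolded H1_pair_def] g[unfolded H1_pair_def]
  have "integrable lebesgue (\<lambda>x. - (f2 x \<bullet> g x) + pot q11 q12 q22 x (f x) \<bullet> g x)"
    using fg by (intro Bochner_Integration.integrable_add Bochner_Integration.integrable_minus
        L2_inner_integrable pot_integrable) auto
  moreover have "integrable lebesgue (\<lambda>x. h x \<bullet> g x)" using fg h by (auto intro!: L2_inner_integrable)
  moreover have "AE x in lebesgue. - (f2 x \<bullet> g x) + pot q11 q12 q22 x (f x) \<bullet> g x = h x \<bullet> g x"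
    using eq
  proof eventually_elim
    case (elim x)
    show ?case unfolding elim[symmetric] inner_add_left inner_minus_left ..
  qed
  ultimately have "(LINT x|lebesgue. - (f2 x \<bullet> g x) + pot q11 q12 q22 x (f x) \<bullet> g x) = (LINT x|lebesgue. h x \<bullet> g x)"
    by (intro integral_cong_AE borel_measurable_integrable)
  then show ?thesis using B_green[OF f g] unfolding inner_add_left inner_minus_left by simp
qed

end

lemma L2_inner_self_zero:
  fixes f :: "real \<Rightarrow> 'a::euclidean_space"
  assumes f: "L2_on UNIV f" and zero: "(LINT x|lebesgue. f x \<bullet> f x) = 0"
  shows "AE x in lebesgue. f x = 0"
proof -
  have "AE x in lebesgue. f x \<bullet> f x = 0"
    using integral_nonneg_eq_0_iff_AE[OF L2_inner_integrable[OF f f]] zero by simp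
  then show ?thesis by simp
qed

text \<open>\<open>P\<close> and -\<open>Q\<close> are the real and imaginary parts of the Hermitian
  pairing of R with I. Testing both equations against i times the solution gives -Re \<mu> Q + Im
  \<mu> P = 0 and -Re \<mu> Q - Im \<mu> P = 0, hence Q = 0. The two forms then equal Re \<mu> P and
  -Re \<mu> P, and being nonnegative both vanish.\<close>

lemma no_unstable_eigenvalue:
  assumes plus: "schroedinger_form p11 p12 p22" and minus: "schroedinger_form m11 m12 m22"
    and R: "H1_pair R R1" "H1_pair R1 R2" and I: "H1_pair I I1" "H1_pair I1 I2"
    and eqR: "AE x in lebesgue. - R2 x + pot p11 p12 p22 x (R x) = - (\<mu> *s I x)"
    and eqI: "AE x in lebesgue. - I2 x + pot m11 m12 m22 x (I x) = \<mu> *s R x"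
    and \<mu>: "Re \<mu> \<noteq> 0"
  shows "AE x in lebesgue. R x = 0 \<and> I x = 0"
proof -
  interpret plus: schroedinger_form p11 p12 p22 by (rule plus)
  interpret minus: schroedinger_form m11 m12 m22 by (rule minus)
  note sc = H1_pair_bounded_linear[OF _ bounded_linear_complex_scale]
  have L2: "L2_on UNIV R" "L2_on UNIV I" using R I by (auto simp: H1_pair_def)
  note L2s = L2_bounded_linear[OF L2(1) bounded_linear_complex_scale] L2_bounded_linear[OF L2(2) bounded_linear_complex_scale]
  have L2m: "L2_on UNIV (\<lambda>x. - (\<mu> *s I x))"
    by (rule L2_bounded_linear[OF L2s(2) bounded_linear_minus[OF bounded_linear_ident]])
  note int = L2_inner_integrable[OF L2(1) L2(2)] L2_inner_integrable[OF L2s(1)[of \<i>] L2(2)]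
    L2_inner_integrable[OF L2(2) L2(1)] L2_inner_integrable[OF L2(2) L2s(1)[of \<i>]]
  note plus_eq = plus.B_eq_of_AE[OF R _ L2m eqR] and minus_eq = minus.B_eq_of_AE[OF I _ L2s(1) eqI]
  define P where "P = (LINT x|lebesgue. R x \<bullet> I x)"
  define Q where "Q = (LINT x|lebesgue. (\<i> *s R x) \<bullet> I x)"
  have 1: "minus.B I I1 I I1 = Re \<mu> * P + Im \<mu> * Q"
    unfolding minus_eq[OF I(1)] P_def Q_def complex_scale_eq[of \<mu>]
    using int by (simp add: inner_add_left)
  have "minus.B I I1 (\<lambda>x. \<i> *s I x) (\<lambda>x. \<i> *s I1 x) = - Re \<mu> * Q + Im \<mu> * P"
  proof -
    have "(\<mu> *s R x) \<bullet> (\<i> *s I x) = - Re \<mu> * ((\<i> *s R x) \<bullet> I x) + Im \<mu> * (R x \<bullet> I x)" for x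
      unfolding complex_scale_eq[of \<mu>] inner_add_left inner_scaleR_left inner_i_i by (simp add: inner_i_left)
    then show ?thesis
      unfolding minus_eq[OF sc[OF I(1)]] P_def Q_def using int by simp
  qed
  then have 2: "- Re \<mu> * Q + Im \<mu> * P = 0" by (simp add: minus.B_i_self)
  have 3: "plus.B R R1 R R1 = - Re \<mu> * P + Im \<mu> * Q"
  proof -
    have "(- (\<mu> *s I x)) \<bullet> R x = - Re \<mu> * (R x \<bullet> I x) + Im \<mu> * ((\<i> *s R x) \<bullet> I x)" for x
      unfolding complex_scale_eq[of \<mu>] inner_minus_left inner_add_left inner_scaleR_left inner_i_left[of "I x"]
      by (simp add: inner_commute)
    then show ?thesis
      unfolding plus_eq[OF R(1)] P_def Q_def using int by simp
  qed
  have "plus.B R R1 (\<lambda>x. \<i> *s R x) (\<lambda>x. \<i> *s R1 x) = - Re \<mu> * Q - Im \<mu> * P"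
  proof -
    have "(- (\<mu> *s I x)) \<bullet> (\<i> *s R x) = - Re \<mu> * ((\<i> *s R x) \<bullet> I x) - Im \<mu> * (R x \<bullet> I x)" for x
      unfolding complex_scale_eq[of \<mu>] inner_minus_left inner_add_left inner_scaleR_left inner_i_i
      by (simp add: inner_commute)
    then show ?thesis
      unfolding plus_eq[OF sc[OF R(1)]] P_def Q_def using int by simp
  qed
  then have 4: "- Re \<mu> * Q - Im \<mu> * P = 0" by (simp add: plus.B_i_self)
  have "Re \<mu> * Q = 0" using 2 4 by linarith
  then have "Q = 0" using \<mu> by simp
  then have "0 \<le> Re \<mu> * P" "0 \<le> - (Re \<mu> * P)"
    using 1 3 minus.B_nonneg[OF I(1)] plus.B_nonneg[OF R(1)] by simp_all
  then have "Re \<mu> * P = 0" by linarith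
  with \<open>Q = 0\<close> have null: "minus.B I I1 I I1 = 0" "plus.B R R1 R R1 = 0" using 1 3 by simp_all
  \<comment> \<open>The equation L_- I = \<mu> R is tested against \<mu> R itself, where the
    degenerate form gives 0.\<close>
  have "(LINT x|lebesgue. (\<mu> *s R x) \<bullet> (\<mu> *s R x)) = 0"
    using minus.B_null[OF I(1) sc[OF R(1)] null(1)] minus_eq[OF sc[OF R(1)]] by simp
  from L2_inner_self_zero[OF L2s(1) this] have "AE x in lebesgue. \<mu> *s R x = 0" .
  moreover have "(LINT x|lebesgue. (\<mu> *s I x) \<bullet> (\<mu> *s I x)) = 0"
    using plus.B_null[OF R(1) sc[OF I(1)] null(2)] plus_eq[OF sc[OF I(1)]] by simp
  from L2_inner_self_zero[OF L2s(2) this] have "AE x in lebesgue. \<mu> *s I x = 0" .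
  ultimately show ?thesis
  proof eventually_elim
    case (elim x)
    have "\<mu> \<noteq> 0" using \<mu> by auto
    then show ?case using elim by simp
  qed
qed

theorem theorem1p2:
  fixes W :: "complex ^ 2 \<Rightarrow> real" and F :: "real ^ 2 \<Rightarrow> real"
    and a b :: real and U :: "real \<Rightarrow> real ^ 2"
  assumes "admissible_potential W F a b"
    and "minimizer_in_X W a b U"
  shows "\<not> (\<exists>\<mu>::complex. spectral_eigenvalue F U \<mu> \<and> Re \<mu> \<noteq> 0)"
proof (intro notI, elim exE conjE)
  fix \<mu> assume "spectral_eigenvalue F U \<mu>" and \<mu>: "Re \<mu> \<noteq> 0"
  then obtain \<Phi>R \<Phi>I where H2: "H2 \<Phi>R" "H2 \<Phi>I" and nz: "\<not> (AE x in lebesgue. \<Phi>R x = 0 \<and> \<Phi>I x = 0)"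
    and eqR: "AE x in lebesgue. L_plus F U \<Phi>R x = - (\<mu> *s \<Phi>I x)"
    and eqI: "AE x in lebesgue. L_minus F U \<Phi>I x = \<mu> *s \<Phi>R x"
    unfolding spectral_eigenvalue_def by blast
  interpret minimizer_setting W F a b U by unfold_locales (fact assms)+
  obtain R R1 R2 where R: "H1_pair R R1" "H1_pair R1 R2"
    and R_ae: "AE x in lebesgue. \<Phi>R x = R x" "AE x in lebesgue. weak_deriv (weak_deriv \<Phi>R) x = R2 x"
    using H2_representative[OF H2(1)] unfolding H1_pair_def by blast
  obtain I I1 I2 where I: "H1_pair I I1" "H1_pair I1 I2"
    and I_ae: "AE x in lebesgue. \<Phi>I x = I x" "AE x in lebesgue. weak_deriv (weak_deriv \<Phi>I) x = I2 x"
    using H2_representative[OF H2(2)] unfolding H1_pair_def by blast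
  let ?p11 = "\<lambda>x. partial 1 F (sqv (U x)) + 2 * partial 1 (partial 1 F) (sqv (U x)) * (U x $ 1)\<^sup>2"
  let ?p12 = "\<lambda>x. 2 * partial 1 (partial 2 F) (sqv (U x)) * U x $ 1 * U x $ 2"
  let ?p22 = "\<lambda>x. partial 2 F (sqv (U x)) + 2 * partial 2 (partial 2 F) (sqv (U x)) * (U x $ 2)\<^sup>2"
  let ?m11 = "\<lambda>x. partial 1 F (sqv (U x))" and ?m22 = "\<lambda>x. partial 2 F (sqv (U x))"
  have plus: "schroedinger_form ?p11 ?p12 ?p22"
    by unfold_locales (intro nonneg_form_plus bounded_coeff_add bounded_coeff_mult bounded_coeff_partial
        bounded_coeff_partial2 bounded_coeff_U bounded_coeff_const | simp only: power2_eq_square)+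
  have minus: "schroedinger_form ?m11 (\<lambda>_. 0) ?m22"
    by unfold_locales (intro nonneg_form_minus bounded_coeff_partial bounded_coeff_const)+
  \<comment> \<open>Both off-diagonal entries of \<open>L_plus\<close> are written with
    \<open>partial 1 (partial 2 F)\<close>, so its matrix has the symmetric shape of
    \<open>pot\<close>.\<close>
  have "AE x in lebesgue. - R2 x + pot ?p11 ?p12 ?p22 x (R x) = - (\<mu> *s I x)"
    using eqR R_ae I_ae(1)
    by eventually_elim (simp add: L_plus_def pot_def Let_def vec_eq_iff forall_2 algebra_simps flip: sqv_def)
  moreover have "AE x in lebesgue. - I2 x + pot ?m11 (\<lambda>_. 0) ?m22 x (I x) = \<mu> *s R x"
    using eqI R_ae(1) I_ae
    by eventually_elim (simp add: L_minus_def pot_def Let_def vec_eq_iff forall_2 flip: sqv_def)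
  ultimately have "AE x in lebesgue. R x = 0 \<and> I x = 0"
    using \<mu> by (rule no_unstable_eigenvalue[OF plus minus R I])
  then have "AE x in lebesgue. \<Phi>R x = 0 \<and> \<Phi>I x = 0"
    using R_ae(1) I_ae(1) by eventually_elim simp
  with nz show False by contradiction
qed

end
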